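(* Let $\phi:\mathbb{R}^+\to\mathbb{R}$ be smooth and suppose there is $m_1>0$ such that for every integer $\alpha\ge2$: $|\phi'(r)|\sim r^{m_1-1}$ and $|\phi^{(\alpha)}(r)|\lesssim r^{m_1-\alpha}$ for $r\ge1$. Let $g\in C^\infty(\mathbb{R})$ be supported in $[1/2,2]$, and let $\eta\in C^\infty(\mathbb{R})$ be supported in $[1/5,5]$ with $\eta\equiv1$ on $[1/4,4]$. Then there exist $c_0>1$ and, for each $t>0$, functions $\rho_t(x,\lambda)$ and $a_t(s,\lambda)$ such that $$\operatorname{supp}\rho_t(\cdot,\lambda)\subset[\lambda^2/5,5\lambda^2],\qquad |\rho_t(x,\lambda)|\le C(k,\|g\|_{C^k},\phi)\,(t\lambda^{2m_1})^{-k}\quad\text{for every integer }k\ge0,$$ $$\operatorname{supp}a_t(\cdot,\lambda)\subset[2c_0^{-1},2c_0],\qquad |a_t(s,\lambda)|\le C(\|g\|_{C^1},\phi),$$ and $$g(\lambda^{-1}\sqrt x)e^{it\phi(x)}=\rho_t(x,\lambda)+t\lambda^{2m_1}\,\eta(\lambda^{-2}x)\int e^{ixt\lambda^{2m_1-2}s}a_t(s,\lambda)\,ds$$ for all $x,t>0$ and $\lambda\ge1$. If in addition there is $\alpha_1\in\mathbb{R}$ such that $|\phi''(r)|\sim r^{\alpha_1-2}$ for $r\ge1$, then there are $c_0$, $\rho_t$ and $a_t$ with the same support properties and bounds such that $$g(\lambda^{-1}\sqrt x)e^{it\phi(x)}=\rho_t(x,\lambda)+t^{\frac12}\lambda^{2m_1-\alpha_1}\,\eta(\lambda^{-2}x)\int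 e^{ixt\lambda^{2m_1-2}s}a_t(s,\lambda)\,ds$$ for all $x,t>0$ and $\lambda\ge1$.
   Context: $A\lesssim B$ means $A\le CB$ for a constant $C>0$ (independent of $r$, possibly depending on $\alpha$), and $A\sim B$ means $A\lesssim B$ and $B\lesssim A$. $C(k,\|g\|_{C^k},\phi)$ and $C(\|g\|_{C^1},\phi)$ denote constants depending only on the displayed quantities (and on the fixed cutoff $\eta$), in particular not on $t,\lambda,x,s$.
   Formalization: The support of a_t is taken in sgn(φ'(1))·[2/c_0,2c_0], since the printed one fails for decreasing φ; and λ≥1 is replaced by λ≥2 when φ' (in the second part φ' or φ'') has a zero on [1/4,1], where the claim for λ≥1 fails in general. *)

theory Defs
  imports "HOL-Analysis.Analysis"
begin

definition nth_deriv :: "nat \<Rightarrow> (real \<Rightarrow> 'a::real_normed_vector) \<Rightarrow> real \<Rightarrow> 'a" where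
  "nth_deriv k f = ((\<lambda>h x. vector_derivative h (at x)) ^^ k) f"

text \<open>Used for open \<open>S\<close> only, so that the two-sided derivatives are determined by \<open>f\<close> on \<open>S\<close>.\<close>
definition smooth_on :: "real set \<Rightarrow> (real \<Rightarrow> 'a::real_normed_vector) \<Rightarrow> bool" where
  "smooth_on S f \<longleftrightarrow> (\<forall>k. \<forall>x\<in>S. nth_deriv k f differentiable (at x))"

definition supp :: "(real \<Rightarrow> 'a::real_normed_vector) \<Rightarrow> real set" where
  "supp f = closure {x. f x \<noteq> 0}"

text \<open>Meaningful for functions with bounded derivatives; it is applied to compactly supported
  smooth functions only.\<close>
definition Ck_norm :: "nat \<Rightarrow> (real \<Rightarrow> 'a::real_normed_vector) \<Rightarrow> real" where
  "Ck_norm k f = (\<Sum>j\<le>k. SUP x. norm (nth_deriv j f x))"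

definition lesssim_on :: "real set \<Rightarrow> (real \<Rightarrow> real) \<Rightarrow> (real \<Rightarrow> real) \<Rightarrow> bool" where
  "lesssim_on S A B \<longleftrightarrow> (\<exists>C>0. \<forall>r\<in>S. A r \<le> C * B r)"

definition sim_on :: "real set \<Rightarrow> (real \<Rightarrow> real) \<Rightarrow> (real \<Rightarrow> real) \<Rightarrow> bool" where
  "sim_on S A B \<longleftrightarrow> lesssim_on S A B \<and> lesssim_on S B A"

text \<open>
  If \<open>g\<close> is supported in \<open>[1/2,2]\<close>, then \<open>x \<mapsto> g(sqrt x / lam)\<close> is supported in
  \<open>[lam\<^sup>2/4, 4 lam\<^sup>2]\<close>.  Lower bounds on derivatives of \<open>\<phi>\<close> for \<open>r \<ge> 1\<close> therefore cover this set
  when \<open>lam \<ge> 2\<close>, whereas for \<open>1 \<le> lam < 2\<close> nothing would prevent the derivative from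
  vanishing on a part of \<open>[1/4,1]\<close> (and the decomposition fails, for instance, if \<open>\<phi>\<close> is constant
  on an interval there).  All \<open>lam \<ge> 1\<close> are admitted as soon as the first \<open>n\<close> derivatives, those
  assumed bounded below, have no zero on \<open>[1/4,1]\<close>; the bounds then extend to \<open>r \<ge> 1/4\<close> by
  compactness.
\<close>
definition freq_start :: "nat \<Rightarrow> (real \<Rightarrow> real) \<Rightarrow> real" where
  "freq_start n \<phi> = (if \<forall>j\<in>{1..n}. \<forall>r\<in>{1/4..1}. nth_deriv j \<phi> r \<noteq> 0 then 1 else 2)"

text \<open>
  The prefactor \<open>A t lam\<close> of the oscillatory term and the range \<open>lam \<ge> \<Lambda>\<close> are parameters;
  \<open>C k\<close> bounds \<open>\<rho>\<close> and \<open>C'\<close> bounds \<open>a\<close>.  The derivative of \<open>\<phi>\<close> has constant sign on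
  \<open>[1,\<infinity>)\<close>, and the frequencies \<open>s\<close> carry that sign: if it is positive, the support condition
  on \<open>a\<close> is \<open>supp a \<subseteq> [2/c\<^sub>0, 2c\<^sub>0]\<close>; for decreasing \<open>\<phi>\<close>, such as \<open>- (r powr m\<^sub>1)\<close>, it is
  \<open>supp a \<subseteq> [-2c\<^sub>0, -2/c\<^sub>0]\<close>.
\<close>
definition oscillatory_decomposition ::
    "real \<Rightarrow> (real \<Rightarrow> real) \<Rightarrow> (real \<Rightarrow> complex) \<Rightarrow> (real \<Rightarrow> real \<Rightarrow> real) \<Rightarrow> real \<Rightarrow>
      (nat \<Rightarrow> real) \<Rightarrow> real \<Rightarrow> (real \<Rightarrow> complex) \<Rightarrow> bool" where
  "oscillatory_decomposition m\<^sub>1 \<phi> \<eta> A \<Lambda> C C' g \<longleftrightarrow>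
    (\<exists>c\<^sub>0>1. \<exists>(\<rho> :: real \<Rightarrow> real \<Rightarrow> real \<Rightarrow> complex) (a :: real \<Rightarrow> real \<Rightarrow> real \<Rightarrow> complex).
      \<forall>t>0. \<forall>lam\<ge>\<Lambda>.
        supp (\<lambda>x. \<rho> t x lam) \<subseteq> {lam\<^sup>2 / 5..5 * lam\<^sup>2} \<and>
        (\<forall>k x. norm (\<rho> t x lam) \<le> C k * (t * lam powr (2 * m\<^sub>1)) powi (- int k)) \<and>
        supp (\<lambda>s. a t s lam) \<subseteq> (\<lambda>s. sgn (nth_deriv 1 \<phi> 1) * s) ` {2 / c\<^sub>0..2 * c\<^sub>0} \<and>
        (\<forall>s. norm (a t s lam) \<le> C') \<and>
        integrable lborel (\<lambda>s. a t s lam) \<and>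
        (\<forall>x>0. g (sqrt x / lam) * exp (\<i> * complex_of_real (t * \<phi> x)) =
          \<rho> t x lam + complex_of_real (A t lam) * \<eta> (x / lam\<^sup>2) *
            (LINT s|lborel.
              exp (\<i> * complex_of_real (x * t * lam powr (2 * m\<^sub>1 - 2) * s)) * a t s lam)))"

end

(* In the variable z = x / lam^2 the function becomes g(sqrt z) exp(i T Phi(z)) with T = t lam^(2 m), where
   Phi has derivatives bounded uniformly in lam and sigma Phi' in [c1, c2] for a sign sigma. Hence it
   oscillates at the frequencies T s with sigma s in [c1, c2], and the oscillatory term is its inverse
   Fourier integral cut off smoothly to slightly larger s; up to the prefactor, a(s) is
   the integral of g(sqrt z) exp(i T (Phi(z) - s z)). Repeated integration by parts bounds the discarded
   frequencies by T^(-k). To spend only k derivatives of g, this is done for a Taylor polynomial of g at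
   the point of evaluation; the remainder, of size |z - y|^k, is controlled by the decay of the kernel of the
   cutoff. When Phi'' does not vanish, van der Corput's second derivative test improves the bound on a. *)
theory Submission
  imports Defs "HOL-Probability.Characteristic_Functions" "HOL-Probability.Sinc_Integral"
begin

text \<open>The difficulty is uniformity: one constant has to serve all \<open>t\<close>,
  \<open>lam\<close>, \<open>x\<close>, \<open>s\<close> and all \<open>g\<close> of given norm.
  Estimates are therefore proved for families, and whatever must not enter a constant becomes a
  parameter: the scaling, the frequency, the point of evaluation, even the Taylor coefficients of
  \<open>g\<close>. The direct argument loses a derivative. N integrations by parts bound the
  transform at a discarded frequency T s by a multiple of (T (1 + |s|))^(-N), but integrating over
  the frequencies costs a factor T, so T^(-k) takes k + 1 of them. A Taylor polynomial of degree
  below k has coefficients controlled by the C^k norm and can be differentiated k + 1 times; hence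
  the detour. The two statements differ only in how T is divided into a prefactor \<open>A\<close>
  and a weight \<open>W\<close> that goes into \<open>a\<close>: W = 1 in the first, while in the
  second the phase has second derivative at least of size t lam^(2 \<alpha>), with \<alpha> the
  exponent attached to \<phi>'', whatever \<open>s\<close> is, which allows the square root of this
  size as weight. All bounds on \<phi> are pushed slightly below the least argument that occurs, so
  that the work takes place in an open neighbourhood of [1/4, 4].\<close>

section \<open>Uniformly smooth families and nonstationary phase\<close>

text \<open>One bound serves all \<open>p\<close>, which makes every later constant uniform.
  Derivatives are existentially quantified, so that closure under products and quotients only has to
  exhibit one; they are two-sided, and \<open>S\<close> is open in all applications.\<close>

fun unif_smooth :: "nat \<Rightarrow> real set \<Rightarrow> 'p set \<Rightarrow> ('p \<Rightarrow> real \<Rightarrow> complex) \<Rightarrow> bool" where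
  "unif_smooth 0 S P f \<longleftrightarrow> (\<exists>C. \<forall>p\<in>P. \<forall>x\<in>S. norm (f p x) \<le> C)"
| "unif_smooth (Suc n) S P f \<longleftrightarrow> (\<exists>C. \<forall>p\<in>P. \<forall>x\<in>S. norm (f p x) \<le> C) \<and>
    (\<exists>f'. (\<forall>p\<in>P. \<forall>x\<in>S. (f p has_vector_derivative f' p x) (at x)) \<and> unif_smooth n S P f')"

lemma unif_smooth_bounded:
  assumes "unif_smooth n S P f"
  obtains C where "C \<ge> 0" "\<And>p x. p \<in> P \<Longrightarrow> x \<in> S \<Longrightarrow> norm (f p x) \<le> C"
proof -
  obtain C where "\<forall>p\<in>P. \<forall>x\<in>S. norm (f p x) \<le> C"
    using assms by (cases n) auto
  then show ?thesis
    using that[of "max C 0"] by fastforce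
qed

lemma unif_smooth_deriv:
  assumes "unif_smooth (Suc n) S P f"
  obtains f' where "\<And>p x. p\<in>P \<Longrightarrow> x\<in>S \<Longrightarrow> (f p has_vector_derivative f' p x) (at x)"
      "unif_smooth n S P f'"
proof -
  from assms have "\<exists>f'. (\<forall>p\<in>P. \<forall>x\<in>S. (f p has_vector_derivative f' p x) (at x)) \<and> unif_smooth n S P f'"
    by (simp only: unif_smooth.simps)
  then show ?thesis using that by blast
qed

lemma unif_smooth_SucI:
  assumes "\<And>p x. p\<in>P \<Longrightarrow> x\<in>S \<Longrightarrow> norm (f p x) \<le> C"
    "\<And>p x. p\<in>P \<Longrightarrow> x\<in>S \<Longrightarrow> (f p has_vector_derivative f' p x) (at x)" "unif_smooth n S P f'"
  shows "unif_smooth (Suc n) S P f"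
  unfolding unif_smooth.simps
  by (intro conjI exI[of _ C] exI[of _ f'] ballI assms; assumption)

lemma unif_smooth_SucD: "unif_smooth (Suc n) S P f \<Longrightarrow> unif_smooth n S P f"
proof (induction n arbitrary: f)
  case 0
  then show ?case by simp
next
  case (Suc n)
  obtain f' where f': "\<And>p x. p\<in>P \<Longrightarrow> x\<in>S \<Longrightarrow> (f p has_vector_derivative f' p x) (at x)"
      "unif_smooth (Suc n) S P f'"
    using unif_smooth_deriv[OF Suc.prems] by blast
  obtain C where "\<And>p x. p\<in>P \<Longrightarrow> x\<in>S \<Longrightarrow> norm (f p x) \<le> C"
    using unif_smooth_bounded[OF Suc.prems] by blast
  then show ?case by (rule unif_smooth_SucI[OF _ f'(1) Suc.IH[OF f'(2)]])
qed

lemma unif_smooth_le: "unif_smooth n S P f \<Longrightarrow> m \<le> n \<Longrightarrow> unif_smooth m S P f"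
  by (induction n) (auto simp: le_Suc_eq simp del: unif_smooth.simps dest: unif_smooth_SucD)

lemma unif_smooth_cong:
  assumes "unif_smooth n S P f" "open S" "\<And>p x. p \<in> P \<Longrightarrow> x \<in> S \<Longrightarrow> f p x = g p x"
  shows "unif_smooth n S P g"
proof (cases n)
  case 0
  then show ?thesis using assms by auto
next
  case (Suc k)
  then obtain f' C where f': "\<forall>p\<in>P. \<forall>x\<in>S. (f p has_vector_derivative f' p x) (at x)"
      "unif_smooth k S P f'" "\<forall>p\<in>P. \<forall>x\<in>S. norm (f p x) \<le> C"
    using assms(1) by auto
  have "(g p has_vector_derivative f' p x) (at x)" if "p \<in> P" "x \<in> S" for p x
    using has_vector_derivative_transform_within_open[of "f p" "f' p x" x S "g p"] f' assms that by auto
  then show ?thesis using f' assms(3) Suc by (auto intro!: exI[of _ C] exI[of _ f'])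
qed

text \<open>Used with a projection or a constant map \<open>h\<close>, it lets a family depend
  formally on further parameters, such as the frequency, at no cost in the bounds.\<close>

lemma unif_smooth_reindex:
  "unif_smooth n S P f \<Longrightarrow> h ` Q \<subseteq> P \<Longrightarrow> unif_smooth n S Q (\<lambda>q. f (h q))"
proof (induction n arbitrary: f)
  case (Suc n)
  then obtain f' C where "\<forall>p\<in>P. \<forall>x\<in>S. (f p has_vector_derivative f' p x) (at x)"
      "unif_smooth n S P f'" "\<forall>p\<in>P. \<forall>x\<in>S. norm (f p x) \<le> C"
    by auto
  with Suc show ?case by (auto intro!: exI[of _ C] exI[of _ "\<lambda>q. f' (h q)"] simp: image_subset_iff)
qed (force simp: image_subset_iff)

lemma unif_smooth_const:
  assumes "\<And>p. p \<in> P \<Longrightarrow> norm (c p) \<le> B"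
  shows "unif_smooth n S P (\<lambda>p x. c p)"
proof -
  have z: "unif_smooth n S P (\<lambda>p x. 0)" for n
    by (induction n) (auto intro!: exI[of _ "\<lambda>p x. 0"])
  show ?thesis using z assms
    by (cases n) (auto intro!: exI[of _ B] exI[of _ "\<lambda>p x. 0"])
qed

lemma unif_smooth_add:
  "unif_smooth n S P f \<Longrightarrow> unif_smooth n S P g \<Longrightarrow> unif_smooth n S P (\<lambda>p x. f p x + g p x)"
proof (induction n arbitrary: f g)
  case 0
  obtain C D where "\<And>p x. p \<in> P \<Longrightarrow> x \<in> S \<Longrightarrow> norm (f p x) \<le> C" "\<And>p x. p \<in> P \<Longrightarrow> x \<in> S \<Longrightarrow> norm (g p x) \<le> D"
    using unif_smooth_bounded[OF 0(1)] unif_smooth_bounded[OF 0(2)] by metis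
  then show ?case by (auto intro!: exI[of _ "C + D"] norm_triangle_mono)
next
  case (Suc n)
  obtain f' g' where d: "\<And>p x. p\<in>P \<Longrightarrow> x\<in>S \<Longrightarrow> (f p has_vector_derivative f' p x) (at x)"
      "\<And>p x. p\<in>P \<Longrightarrow> x\<in>S \<Longrightarrow> (g p has_vector_derivative g' p x) (at x)"
      "unif_smooth n S P f'" "unif_smooth n S P g'"
    using unif_smooth_deriv[OF Suc.prems(1)] unif_smooth_deriv[OF Suc.prems(2)] by metis
  obtain C D where b: "\<And>p x. p \<in> P \<Longrightarrow> x \<in> S \<Longrightarrow> norm (f p x) \<le> C" "\<And>p x. p \<in> P \<Longrightarrow> x \<in> S \<Longrightarrow> norm (g p x) \<le> D"
    using unif_smooth_bounded[OF Suc.prems(1)] unif_smooth_bounded[OF Suc.prems(2)] by metis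
  have "unif_smooth n S P (\<lambda>p x. f' p x + g' p x)" by (rule Suc.IH[OF d(3,4)])
  with d b show ?case
    by (auto intro!: exI[of _ "C + D"] exI[of _ "\<lambda>p x. f' p x + g' p x"] norm_triangle_mono
      has_vector_derivative_add)
qed

lemma unif_smooth_mult:
  "unif_smooth n S P f \<Longrightarrow> unif_smooth n S P g \<Longrightarrow> unif_smooth n S P (\<lambda>p x. f p x * g p x)"
proof (induction n arbitrary: f g)
  case 0
  obtain C D where "C \<ge> 0" "\<And>p x. p \<in> P \<Longrightarrow> x \<in> S \<Longrightarrow> norm (f p x) \<le> C" "\<And>p x. p \<in> P \<Longrightarrow> x \<in> S \<Longrightarrow> norm (g p x) \<le> D"
    using unif_smooth_bounded[OF 0(1)] unif_smooth_bounded[OF 0(2)] by metis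
  then show ?case by (auto intro!: exI[of _ "C * D"] mult_mono simp: norm_mult)
next
  case (Suc n)
  obtain f' g' where d: "\<And>p x. p\<in>P \<Longrightarrow> x\<in>S \<Longrightarrow> (f p has_vector_derivative f' p x) (at x)"
      "\<And>p x. p\<in>P \<Longrightarrow> x\<in>S \<Longrightarrow> (g p has_vector_derivative g' p x) (at x)"
      "unif_smooth n S P f'" "unif_smooth n S P g'"
    using unif_smooth_deriv[OF Suc.prems(1)] unif_smooth_deriv[OF Suc.prems(2)] by metis
  obtain C D where b: "C \<ge> 0" "\<And>p x. p \<in> P \<Longrightarrow> x \<in> S \<Longrightarrow> norm (f p x) \<le> C" "\<And>p x. p \<in> P \<Longrightarrow> x \<in> S \<Longrightarrow> norm (g p x) \<le> D"
    using unif_smooth_bounded[OF Suc.prems(1)] unif_smooth_bounded[OF Suc.prems(2)] by metis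
  have "unif_smooth n S P (\<lambda>p x. f p x * g' p x + f' p x * g p x)"
    using d Suc.prems by (intro unif_smooth_add Suc.IH) (auto intro: unif_smooth_SucD simp del: unif_smooth.simps)
  with d b show ?case
    by (auto intro!: exI[of _ "C * D"] exI[of _ "\<lambda>p x. f p x * g' p x + f' p x * g p x"] mult_mono
      has_vector_derivative_mult simp: norm_mult)
qed

lemma unif_smooth_cmult: "unif_smooth n S P f \<Longrightarrow> unif_smooth n S P (\<lambda>p x. c * f p x)"
  by (intro unif_smooth_mult unif_smooth_const[where B="norm c"]) auto

lemma unif_smooth_diff:
  "unif_smooth n S P f \<Longrightarrow> unif_smooth n S P g \<Longrightarrow> unif_smooth n S P (\<lambda>p x. f p x - g p x)"
  using unif_smooth_add[of n S P f "\<lambda>p x. (-1) * g p x"] unif_smooth_cmult[of n S P g "-1"] by simp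

lemma unif_smooth_power:
  "unif_smooth n S P f \<Longrightarrow> unif_smooth n S P (\<lambda>p x. f p x ^ j)"
  by (induction j) (auto simp del: unif_smooth.simps intro!: unif_smooth_mult unif_smooth_const[where B=1])

lemma unif_smooth_inverse:
  assumes "unif_smooth n S P f" "c > 0" "\<And>p x. p \<in> P \<Longrightarrow> x \<in> S \<Longrightarrow> c \<le> norm (f p x)"
  shows "unif_smooth n S P (\<lambda>p x. inverse (f p x))"
  using assms(1)
proof (induction n)
  case 0
  then show ?case using assms(2,3)
    by (auto intro!: exI[of _ "inverse c"] le_imp_inverse_le simp: norm_inverse)
next
  case (Suc n)
  obtain f' where d: "\<And>p x. p\<in>P \<Longrightarrow> x\<in>S \<Longrightarrow> (f p has_vector_derivative f' p x) (at x)"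
      "unif_smooth n S P f'"
    using unif_smooth_deriv[OF Suc.prems] by blast
  have i: "unif_smooth n S P (\<lambda>p x. inverse (f p x))"
    using Suc unif_smooth_SucD by blast
  have "unif_smooth n S P (\<lambda>p x. (-1) * (inverse (f p x) * f' p x * inverse (f p x)))"
    by (intro unif_smooth_cmult unif_smooth_mult i d)
  moreover have "((\<lambda>x. inverse (f p x)) has_vector_derivative (-1) * (inverse (f p x) * f' p x * inverse (f p x))) (at x)"
    if "p \<in> P" "x \<in> S" for p x
  proof -
    have "f p x \<noteq> 0" using assms(2,3) that by fastforce
    moreover have "(f p has_derivative (\<lambda>h. h *\<^sub>R f' p x)) (at x)"
      using d(1)[OF that] by (simp add: has_vector_derivative_def)
    ultimately have "((\<lambda>x. inverse (f p x)) has_derivative (\<lambda>h. - (inverse (f p x) * (h *\<^sub>R f' p x) * inverse (f p x)))) (at x)"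
      by (rule Deriv.has_derivative_inverse)
    then show ?thesis unfolding has_vector_derivative_def by (simp add: scaleR_conv_of_real algebra_simps)
  qed
  moreover have "norm (inverse (f p x)) \<le> inverse c" if "p \<in> P" "x \<in> S" for p x
    using assms(2,3) that by (auto intro!: le_imp_inverse_le simp: norm_inverse)
  ultimately show ?case by (intro unif_smooth_SucI[where f'="\<lambda>p x. (-1) * (inverse (f p x) * f' p x * inverse (f p x))"])
qed

lemma unif_smooth_divide:
  assumes "unif_smooth n S P g" "unif_smooth n S P f" "c > 0"
    "\<And>p x. p \<in> P \<Longrightarrow> x \<in> S \<Longrightarrow> c \<le> norm (f p x)"
  shows "unif_smooth n S P (\<lambda>p x. g p x / f p x)"
  unfolding divide_inverse by (intro unif_smooth_mult assms unif_smooth_inverse[where c=c]) auto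

lemma unif_smooth_continuous:
  assumes "unif_smooth (Suc n) S P f" "p \<in> P"
  shows "continuous_on S (f p)"
  by (rule unif_smooth_deriv[OF assms(1)])
    (auto intro!: continuous_at_imp_continuous_on has_vector_derivative_continuous assms(2))

lemma has_vector_derivative_cis:
  assumes "(\<psi> has_real_derivative d) (at x)"
  shows "((\<lambda>x. cis (\<tau> * \<psi> x)) has_vector_derivative \<i> * of_real (\<tau> * d) * cis (\<tau> * \<psi> x)) (at x)"
proof -
  have "((\<lambda>x. \<tau> * \<psi> x) has_vector_derivative \<tau> * d) (at x)"
    using DERIV_cmult[OF assms] by (simp add: has_real_derivative_iff_has_vector_derivative)
  from vector_diff_chain_at[OF this has_vector_derivative_iexp]
  show ?thesis by (simp add: cis_conv_exp scaleR_conv_of_real mult_ac o_def)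
qed

text \<open>Each integration by parts replaces the amplitude \<open>b\<close> by the derivative of \<open>b / r\<close> and gains
  a factor \<open>\<tau> \<sigma>\<close>.\<close>
lemma nonstationary_phase:
  fixes \<psi> r :: "'p \<Rightarrow> real \<Rightarrow> real"
  assumes S: "open S" "{l'..u'} \<subseteq> S" "l' < l" "u < u'"
    and r: "\<And>n. unif_smooth n S P (\<lambda>p x. of_real (r p x))" "c > 0"
      "\<And>p x. p \<in> P \<Longrightarrow> x \<in> S \<Longrightarrow> c \<le> \<bar>r p x\<bar>"
    and \<psi>: "\<And>p x. p \<in> P \<Longrightarrow> x \<in> S \<Longrightarrow> (\<psi> p has_real_derivative \<sigma> p * r p x) (at x)"
    and \<sigma>: "\<And>p. p \<in> P \<Longrightarrow> \<sigma> p > 0"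
    and b: "unif_smooth N S P b" "\<And>p x. p \<in> P \<Longrightarrow> x \<in> S \<Longrightarrow> x \<notin> {l..u} \<Longrightarrow> b p x = 0"
  shows "\<exists>C\<ge>0. \<forall>p\<in>P. \<forall>\<tau>>0. norm (integral {l'..u'} (\<lambda>x. b p x * cis (\<tau> * \<psi> p x))) \<le> C / (\<tau> * \<sigma> p) ^ N"
  using b
proof (induction N arbitrary: b)
  case 0
  obtain C where C: "C \<ge> 0" "\<And>p x. p \<in> P \<Longrightarrow> x \<in> S \<Longrightarrow> norm (b p x) \<le> C"
    using unif_smooth_bounded[OF 0(1)] by blast
  have "norm (integral {l'..u'} (\<lambda>x. b p x * cis (\<tau> * \<psi> p x))) \<le> C * \<bar>u' - l'\<bar>" if "p \<in> P" for p \<tau>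
  \<comment> \<open>At order 0 the amplitude is merely bounded and the integral may fail to exist;
    it then has the default value 0 and the bound survives.\<close>
  proof (cases "(\<lambda>x. b p x * cis (\<tau> * \<psi> p x)) integrable_on {l'..u'}")
    case True
    then have "norm (integral {l'..u'} (\<lambda>x. b p x * cis (\<tau> * \<psi> p x))) \<le> integral {l'..u'} (\<lambda>x. C)"
      using C that S by (intro integral_norm_bound_integral) (auto simp: norm_mult)
    also have "\<dots> \<le> C * \<bar>u' - l'\<bar>" using C by (auto simp: mult.commute abs_if)
    finally show ?thesis .
  next
    case False
    then show ?thesis using C by (simp add: not_integrable_integral)
  qed
  then show ?case using C by (auto intro!: exI[of _ "C * \<bar>u' - l'\<bar>"])
next
  case (Suc N)
  let ?w = "\<lambda>p x. b p x / of_real (r p x)"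
  have w: "unif_smooth (Suc N) S P ?w"
    using Suc.prems r by (intro unif_smooth_divide[where c=c]) (auto simp del: unif_smooth.simps)
  obtain w' where w': "\<And>p x. p\<in>P \<Longrightarrow> x\<in>S \<Longrightarrow> (?w p has_vector_derivative w' p x) (at x)"
      "unif_smooth N S P w'"
    using unif_smooth_deriv[OF w] by blast
  \<comment> \<open>The inductive hypothesis asks for an amplitude vanishing off
    \<open>{l..u}\<close>; \<open>w'\<close> does, since \<open>?w\<close> is zero on the open set
    of points of \<open>S\<close> outside this interval.\<close>
  have w0: "w' p x = 0" if "p \<in> P" "x \<in> S" "x \<notin> {l..u}" for p x
  proof -
    have "((\<lambda>x. 0) has_vector_derivative w' p x) (at x)"
    proof (rule has_vector_derivative_transform_within_open[OF w'(1)[OF that(1,2)]])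
      show "open (S \<inter> - {l..u})" using S by (auto intro: open_Int)
      show "\<And>x. x \<in> S \<inter> - {l..u} \<Longrightarrow> ?w p x = 0" using Suc.prems(2) that by auto
    qed (use that in auto)
    then show ?thesis using has_vector_derivative_const vector_derivative_unique_at by blast
  qed
  obtain C where C: "C \<ge> 0" "\<forall>p\<in>P. \<forall>\<tau>>0. norm (integral {l'..u'} (\<lambda>x. w' p x * cis (\<tau> * \<psi> p x))) \<le> C / (\<tau> * \<sigma> p) ^ N"
    using Suc.IH[OF w'(2) w0] by blast
  have "norm (integral {l'..u'} (\<lambda>x. b p x * cis (\<tau> * \<psi> p x))) \<le> C / (\<tau> * \<sigma> p) ^ Suc N"
    if p: "p \<in> P" and \<tau>: "\<tau> > 0" for p \<tau>
  proof (cases "l' \<le> u'")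
    case True
    let ?E = "\<lambda>x. cis (\<tau> * \<psi> p x)"
    have cE: "continuous_on {l'..u'} ?E"
      using has_vector_derivative_cis[OF \<psi>[OF p], of _ \<tau>] S
      by (auto intro!: continuous_at_imp_continuous_on has_vector_derivative_continuous)
    have ib: "(\<lambda>x. b p x * ?E x) integrable_on {l'..u'}"
      by (intro integrable_continuous_real continuous_on_mult cE S
          continuous_on_subset[OF unif_smooth_continuous[OF Suc.prems(1) p]])
    have "((\<lambda>x. ?w p x * (\<i> * of_real (\<tau> * (\<sigma> p * r p x)) * ?E x) + w' p x * ?E x) has_integral
        (?w p u' * ?E u' - ?w p l' * ?E l')) {l'..u'}"
    proof (rule fundamental_theorem_of_calculus[OF True])
      fix x assume "x \<in> {l'..u'}"
      then have x: "x \<in> S" using S by auto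
      show "((\<lambda>x. ?w p x * ?E x) has_vector_derivative
          ?w p x * (\<i> * of_real (\<tau> * (\<sigma> p * r p x)) * ?E x) + w' p x * ?E x) (at x within {l'..u'})"
        by (rule has_vector_derivative_at_within, rule has_vector_derivative_mult,
            rule w'(1)[OF p x], rule has_vector_derivative_cis[OF \<psi>[OF p x]])
    qed
    \<comment> \<open>The padding l' < l and u < u' is there to kill the boundary terms.\<close>
    moreover have "b p u' = 0" "b p l' = 0"
      using Suc.prems(2)[OF p, of u'] Suc.prems(2)[OF p, of l'] S True by (auto simp: subset_iff)
    then have "?w p u' * ?E u' - ?w p l' * ?E l' = 0" by simp
    ultimately have "((\<lambda>x. ?w p x * (\<i> * of_real (\<tau> * (\<sigma> p * r p x)) * ?E x) + w' p x * ?E x) has_integral 0) {l'..u'}"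
      by (simp only:)
    moreover have "?w p x * (\<i> * of_real (\<tau> * (\<sigma> p * r p x)) * ?E x) + w' p x * ?E x =
        \<i> * of_real (\<tau> * \<sigma> p) * (b p x * ?E x) + w' p x * ?E x" if "x \<in> {l'..u'}" for x
    proof -
      have "r p x \<noteq> 0" using r(2) r(3)[OF p, of x] that S by fastforce
      then show ?thesis by (simp add: field_simps)
    qed
    ultimately have "((\<lambda>x. \<i> * of_real (\<tau> * \<sigma> p) * (b p x * ?E x) + w' p x * ?E x) has_integral 0) {l'..u'}"
      by (rule has_integral_eq[rotated])
    from has_integral_diff[OF this has_integral_mult_right[OF integrable_integral[OF ib], of "\<i> * of_real (\<tau> * \<sigma> p)"]]
    have "((\<lambda>x. w' p x * ?E x) has_integral - (\<i> * of_real (\<tau> * \<sigma> p) * integral {l'..u'} (\<lambda>x. b p x * ?E x))) {l'..u'}"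
      by (simp only: add_diff_cancel_left' diff_0)
    then have "integral {l'..u'} (\<lambda>x. w' p x * ?E x) = - (\<i> * of_real (\<tau> * \<sigma> p) * integral {l'..u'} (\<lambda>x. b p x * ?E x))"
      by (rule integral_unique)
    \<comment> \<open>Integration by parts is now an identity between the integrals with amplitudes
      \<open>w'\<close> and \<open>b\<close>, up to the factor - i \<tau> \<sigma>. Hence order
      \<open>N\<close> for \<open>w'\<close> gives order \<open>Suc N\<close> for
      \<open>b\<close>.\<close>
    then have "\<tau> * \<sigma> p * norm (integral {l'..u'} (\<lambda>x. b p x * ?E x)) \<le> C / (\<tau> * \<sigma> p) ^ N"
      using C(2)[rule_format, OF p \<tau>] \<tau> \<sigma>[OF p] by (simp add: norm_mult)
    then show ?thesis using \<tau> \<sigma>[OF p] by (simp add: pos_le_divide_eq mult_ac)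
  next
    case False
    then show ?thesis using C \<tau> \<sigma>[OF p] by simp
  qed
  then show ?case using C by blast
qed

section \<open>Fourier inversion\<close>

lemma integrable_std_normal_density: "integrable lborel (std_normal_density :: real \<Rightarrow> real)"
  using integrable_normal_density[of 1 0] by simp

lemma integrable_continuous_compact_support:
  fixes f :: "real \<Rightarrow> 'a::euclidean_space"
  assumes "continuous_on UNIV f" "\<And>x. x \<notin> {l..u} \<Longrightarrow> f x = 0"
  shows "integrable lborel f"
proof -
  have "set_integrable lborel {l..u} f"
    using assms(1) by (intro borel_integrable_atLeastAtMost') (auto intro: continuous_on_subset)
  moreover have "(\<lambda>x. indicat_real {l..u} x *\<^sub>R f x) = f"
    using assms(2) by (auto simp: indicator_def fun_eq_iff)
  ultimately show ?thesis by (simp add: set_integrable_def)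
qed

text \<open>The characteristic function of the standard normal distribution, by which the Gaussian
  reproduces itself under the Fourier transform up to the factor sqrt (2 pi).\<close>

lemma LINT_cis_std_normal_density:
  "(LINT w|lborel. std_normal_density w *\<^sub>R cis (a * w)) = of_real (exp (- (a\<^sup>2 / 2)))"
proof -
  have "char std_normal_distribution a = (LINT w|lborel. std_normal_density w *\<^sub>R cis (a * w))"
    unfolding char_def by (subst integral_density) (auto simp: cis_conv_exp)
  then show ?thesis by (simp add: char_std_normal_distribution)
qed

text \<open>Inserting the factor \<open>std_normal_density (w / n)\<close> justifies the use of Fubini's theorem;
  both sides of the resulting identity converge by dominated convergence.\<close>
lemma Fourier_inversion:
  fixes f :: "real \<Rightarrow> complex"
  assumes f: "continuous_on UNIV f" "\<And>x. x \<notin> {l..u} \<Longrightarrow> f x = 0"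
    and F: "\<And>w. F w = (LINT z|lborel. f z * cis (- (w * z)))" "integrable lborel F"
  shows "(LINT w|lborel. F w * cis (y * w)) = 2 * pi * f y"
proof -
  let ?G = "std_normal_density :: real \<Rightarrow> real"
  have fi: "integrable lborel f" by (rule integrable_continuous_compact_support[OF f])
  have [measurable]: "f \<in> borel_measurable borel" using f(1) by (rule borel_measurable_continuous_onI)
  have [measurable]: "F \<in> borel_measurable borel" using F(2) by auto
  have [measurable]: "cis \<in> borel_measurable borel"
    by (intro borel_measurable_continuous_onI) (auto intro!: continuous_intros)
  obtain B where B: "\<And>x. norm (f x) \<le> B"
  proof -
    have "compact (f ` {l..u})" using f(1) by (intro compact_continuous_image) (auto intro: continuous_on_subset)
    then obtain B where "\<forall>z\<in>f ` {l..u}. norm z \<le> B" using compact_imp_bounded bounded_iff by blast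
    then have "norm (f x) \<le> max B 0" for x using f(2)[of x] by (cases "x \<in> {l..u}") (force intro: max.coboundedI1)+
    then show ?thesis using that by blast
  qed
  \<comment> \<open>With the density bounded by 1, norm (F w) dominates the regularized
    integrands.\<close>
  have Gle: "?G x \<le> 1" for x
  proof -
    have "?G x \<le> 1 / sqrt (2 * pi)" by (simp add: std_normal_density_def divide_simps)
    also have "\<dots> \<le> 1" using pi_gt3 by (simp add: divide_simps)
    finally show ?thesis .
  qed
  define A where "A n = (LINT w|lborel. ?G (w / real (Suc n)) *\<^sub>R (F w * cis (y * w)))" for n
  have A: "A \<longlonglongrightarrow> (LINT w|lborel. ?G 0 *\<^sub>R (F w * cis (y * w)))"
    unfolding A_def
  proof (rule integral_dominated_convergence[where w="\<lambda>w. norm (F w)"])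
    have "(\<lambda>n. ?G (w / real (Suc n))) \<longlonglongrightarrow> ?G 0" for w
      by (rule isCont_tendsto_compose[OF _ LIMSEQ_Suc[OF lim_const_over_n]])
        (auto simp: std_normal_density_def intro!: continuous_intros)
    then show "AE w in lborel. (\<lambda>n. ?G (w / real (Suc n)) *\<^sub>R (F w * cis (y * w))) \<longlonglongrightarrow> ?G 0 *\<^sub>R (F w * cis (y * w))"
      by (auto intro!: tendsto_intros)
    show "\<And>n. AE w in lborel. norm (?G (w / real (Suc n)) *\<^sub>R (F w * cis (y * w))) \<le> norm (F w)"
      using Gle by (auto simp: norm_mult intro!: mult_left_le_one_le)
    show "integrable lborel (\<lambda>w. norm (F w))" using F(2) by (rule integrable_norm)
  qed measurable
  \<comment> \<open>Fubini replaces the Gaussian by its own transform, and the substitution z = y +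
    w / Suc n turns the result into a Gaussian average of \<open>f\<close> around
    \<open>y\<close>.\<close>
  have A_eq: "A n = sqrt (2 * pi) *\<^sub>R (LINT w|lborel. ?G w *\<^sub>R f (y + w / real (Suc n)))" for n
  proof -
    let ?m = "real (Suc n)"
    let ?h = "\<lambda>w z. ?G (w / ?m) *\<^sub>R (f z * cis (w * (y - z)))"
    have Gi: "integrable lborel (\<lambda>w. ?G (w / ?m))"
      using lborel_integrable_real_affine[of ?G "1 / ?m" 0] integrable_std_normal_density by simp
    have "A n = (LINT w|lborel. LINT z|lborel. ?h w z)"
      unfolding A_def F(1)
    proof (intro Bochner_Integration.integral_cong refl)
      fix w
      have "?G (w / ?m) *\<^sub>R ((LINT z|lborel. f z * cis (- (w * z))) * cis (y * w)) =
         ?G (w / ?m) *\<^sub>R (LINT z|lborel. f z * cis (- (w * z)) * cis (y * w))"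
        by simp
      also have "\<dots> = (LINT z|lborel. ?G (w / ?m) *\<^sub>R (f z * cis (- (w * z)) * cis (y * w)))"
        by simp
      also have "\<dots> = (LINT z|lborel. ?h w z)"
        by (intro Bochner_Integration.integral_cong refl) (simp add: mult.assoc cis_mult algebra_simps)
      finally show "?G (w / ?m) *\<^sub>R ((LINT z|lborel. f z * cis (- (w * z))) * cis (y * w)) = (LINT z|lborel. ?h w z)" .
    qed
    also have "\<dots> = (LINT z|lborel. LINT w|lborel. ?h w z)"
    proof (rule lborel_pair.Fubini_integral[symmetric])
      show "integrable (lborel \<Otimes>\<^sub>M lborel) (\<lambda>(w, z). ?h w z)"
      proof (rule lborel_pair.Fubini_integrable)
        show "(\<lambda>(w, z). ?h w z) \<in> borel_measurable (lborel \<Otimes>\<^sub>M lborel)" by measurable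
        have nh: "(LINT z|lborel. norm (?h w z)) = ?G (w / ?m) * (LINT z|lborel. norm (f z))" for w
          by (simp add: norm_mult)
        show "integrable lborel (\<lambda>w. LINT z|lborel. norm (case (w, z) of (w, z) \<Rightarrow> ?h w z))"
          unfolding prod.case nh using Gi by (rule integrable_mult_left)
        have "integrable lborel (\<lambda>z. ?h w z)" for w
          by (rule Bochner_Integration.integrable_bound[OF integrable_scaleR_right[OF fi, of "?G (w / ?m)"]])
            (auto simp: norm_mult)
        then show "AE w in lborel. integrable lborel (\<lambda>z. case (w, z) of (w, z) \<Rightarrow> ?h w z)" by simp
      qed
    qed
    also have "\<dots> = (LINT z|lborel. (?m * sqrt (2 * pi) * ?G (?m * (y - z))) *\<^sub>R f z)"
    proof (intro Bochner_Integration.integral_cong refl)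
      fix z
      have "(LINT w|lborel. ?h w z) = (LINT w|lborel. f z * (?G (w / ?m) *\<^sub>R cis (w * (y - z))))"
        by (intro Bochner_Integration.integral_cong refl) simp
      also have "\<dots> = f z * (LINT w|lborel. ?G (w / ?m) *\<^sub>R cis (w * (y - z)))"
        by (rule integral_mult_right_zero)
      also have "(LINT w|lborel. ?G (w / ?m) *\<^sub>R cis (w * (y - z))) = ?m *\<^sub>R (LINT w|lborel. ?G w *\<^sub>R cis ((?m * (y - z)) * w))"
        by (subst lborel_integral_real_affine[of ?m _ 0]) (simp_all add: mult_ac del: of_nat_Suc)
      also have "\<dots> = of_real (?m * sqrt (2 * pi) * ?G (?m * (y - z)))"
        unfolding LINT_cis_std_normal_density
        by (simp add: std_normal_density_def scaleR_conv_of_real del: of_nat_Suc)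
      finally show "(LINT w|lborel. ?h w z) = (?m * sqrt (2 * pi) * ?G (?m * (y - z))) *\<^sub>R f z"
        by (simp add: scaleR_conv_of_real)
    qed
    also have "\<dots> = (LINT w|lborel. sqrt (2 * pi) *\<^sub>R ?G w *\<^sub>R f (y + w / ?m))"
      by (subst lborel_integral_real_affine[of "1 / ?m" _ y]) (simp_all add: std_normal_density_def flip: integral_scaleR_right del: of_nat_Suc)
    finally show ?thesis by (simp only: integral_scaleR_right)
  qed
  have "(\<lambda>n. sqrt (2 * pi) *\<^sub>R (LINT w|lborel. ?G w *\<^sub>R f (y + w / real (Suc n))))
     \<longlonglongrightarrow> sqrt (2 * pi) *\<^sub>R (LINT w|lborel. ?G w *\<^sub>R f y)"
  proof (intro tendsto_intros integral_dominated_convergence[where w="\<lambda>w. ?G w * B"])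
    have "isCont f y" using f(1) by (simp add: continuous_on_eq_continuous_at)
    moreover have "(\<lambda>n. y + w / real (Suc n)) \<longlonglongrightarrow> y" for w
      using tendsto_add[OF tendsto_const LIMSEQ_Suc[OF lim_const_over_n[of w]], of y] by simp
    ultimately show "AE w in lborel. (\<lambda>n. ?G w *\<^sub>R f (y + w / real (Suc n))) \<longlonglongrightarrow> ?G w *\<^sub>R f y"
      by (auto intro!: tendsto_scaleR tendsto_const isCont_tendsto_compose[of _ f])
    show "\<And>n. AE w in lborel. norm (?G w *\<^sub>R f (y + w / real (Suc n))) \<le> ?G w * B"
      using B by (auto intro!: mult_left_mono)
    show "integrable lborel (\<lambda>w. ?G w * B)" using integrable_std_normal_density by simp
  qed measurable
  then have "(LINT w|lborel. ?G 0 *\<^sub>R (F w * cis (y * w))) = sqrt (2 * pi) *\<^sub>R (LINT w|lborel. ?G w *\<^sub>R f y)"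
    unfolding A_eq[symmetric] by (rule LIMSEQ_unique[OF A])
  also have "(LINT w|lborel. ?G w *\<^sub>R f y) = f y"
    by simp
  \<comment> \<open>The factor on the left is the density at 0; the two normalizations together give
    the 2 pi of the statement.\<close>
  finally have "(1 / sqrt (2 * pi)) *\<^sub>R (LINT w|lborel. F w * cis (y * w)) = sqrt (2 * pi) *\<^sub>R f y"
    by (simp add: std_normal_density_def)
  then have "sqrt (2 * pi) *\<^sub>R (1 / sqrt (2 * pi)) *\<^sub>R (LINT w|lborel. F w * cis (y * w)) = sqrt (2 * pi) *\<^sub>R sqrt (2 * pi) *\<^sub>R f y"
    by simp
  then show ?thesis by (simp add: scaleR_conv_of_real flip: of_real_mult)
qed

section \<open>Iterated derivatives and smooth cutoffs\<close>

lemma nth_deriv_0 [simp]: "nth_deriv 0 f = f"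
  by (simp add: nth_deriv_def)

lemma nth_deriv_Suc: "nth_deriv (Suc k) f x = vector_derivative (nth_deriv k f) (at x)"
  by (simp add: nth_deriv_def)

lemma smooth_on_nth_deriv:
  assumes "smooth_on S f" "x \<in> S"
  shows "(nth_deriv k f has_vector_derivative nth_deriv (Suc k) f x) (at x)"
  using assms by (auto simp: smooth_on_def nth_deriv_Suc vector_derivative_works)

lemma nth_deriv_cong_open:
  assumes "open U" "\<And>x. x \<in> U \<Longrightarrow> f x = g x" "x \<in> U"
  shows "nth_deriv j f x = nth_deriv j g x"
  using assms(3)
proof (induction j arbitrary: x)
  case (Suc j)
  have "eventually (\<lambda>y. nth_deriv j f y = nth_deriv j g y) (nhds x)"
    using eventually_nhds_in_open[OF assms(1) Suc.prems] by eventually_elim (rule Suc.IH)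
  then show ?case unfolding nth_deriv_Suc by (intro vector_derivative_cong_eq) auto
qed (use assms in auto)

lemma nth_deriv_const: "nth_deriv (Suc j) (\<lambda>x. c) x = 0"
proof (induction j arbitrary: x)
  case 0
  then show ?case by (simp add: nth_deriv_Suc)
next
  case (Suc j)
  have "nth_deriv (Suc j) (\<lambda>x. c) = (\<lambda>x. 0)" using Suc by auto
  then show ?case by (subst nth_deriv_Suc) simp
qed

lemma supp_zero: "supp f \<subseteq> A \<Longrightarrow> x \<notin> A \<Longrightarrow> f x = 0"
  unfolding supp_def using closure_subset[of "{x. f x \<noteq> 0}"] by blast

lemma nth_deriv_zero_outside:
  assumes "supp f \<subseteq> {a..b}" "x \<notin> {a..b}"
  shows "nth_deriv j f x = 0"
proof -
  have "nth_deriv j f x = nth_deriv j (\<lambda>x. 0) x"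
    using assms supp_zero[OF assms(1)] by (intro nth_deriv_cong_open[of "- {a..b}"]) auto
  then show ?thesis by (cases j) (auto simp: nth_deriv_const)
qed

text \<open>For families whose successive derivatives are known in closed form: a tail of the
  sequence \<open>F\<close> is again such a sequence, so the induction generalizes over
  \<open>j\<close>.\<close>

lemma unif_smooth_derivs:
  assumes "\<And>j p x. p \<in> P \<Longrightarrow> x \<in> S \<Longrightarrow> (F j p has_vector_derivative F (Suc j) p x) (at x)"
    "\<And>j. \<exists>C. \<forall>p\<in>P. \<forall>x\<in>S. norm (F j p x) \<le> C"
  shows "unif_smooth n S P (F j)"
proof (induction n arbitrary: j)
  case 0
  then show ?case using assms(2) by simp
next
  case (Suc n)
  obtain C where "\<And>p x. p \<in> P \<Longrightarrow> x \<in> S \<Longrightarrow> norm (F j p x) \<le> C" using assms(2)[of j] by blast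
  then show ?case by (rule unif_smooth_SucI[OF _ assms(1) Suc.IH])
qed

lemma smooth_on_nth_deriv_bounded:
  assumes "smooth_on S f" "{a..b} \<subseteq> S"
  shows "\<exists>C. \<forall>x\<in>{a..b}. norm (nth_deriv j f x) \<le> C"
proof -
  have "continuous_on {a..b} (nth_deriv j f)"
    using assms by (auto intro!: continuous_at_imp_continuous_on
        has_vector_derivative_continuous smooth_on_nth_deriv[OF assms(1)])
  then have "bounded (nth_deriv j f ` {a..b})"
    by (intro compact_imp_bounded compact_continuous_image) auto
  then show ?thesis by (auto simp: bounded_iff)
qed

text \<open>A family over a one-point parameter set, so that \<open>unif_smooth_reindex\<close>
  makes a test function a constant member of any family.\<close>

definition test_function :: "real \<Rightarrow> real \<Rightarrow> (real \<Rightarrow> complex) \<Rightarrow> bool" where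
  "test_function \<alpha> \<beta> \<theta> \<longleftrightarrow> (\<forall>n. unif_smooth n UNIV (UNIV :: unit set) (\<lambda>_. \<theta>)) \<and> (\<forall>s. s \<notin> {\<alpha>..\<beta>} \<longrightarrow> \<theta> s = 0)"

text \<open>All cutoffs are built from the given \<eta>: its rising edge between 1/5 and 1/4 is kept
  and continued by 1. This is smooth because \<eta> is already 1 around the junction at 1.\<close>

definition smooth_step :: "(real \<Rightarrow> complex) \<Rightarrow> real \<Rightarrow> complex" where
  "smooth_step \<eta> x = (if x < 1 then \<eta> x else 1)"

context
  fixes \<eta> :: "real \<Rightarrow> complex"
  assumes \<eta>: "smooth_on UNIV \<eta>" "supp \<eta> \<subseteq> {1/5..5}" "\<And>x. x \<in> {1/4..4} \<Longrightarrow> \<eta> x = 1"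
begin

lemma smooth_step_values:
  "x < 1/5 \<Longrightarrow> smooth_step \<eta> x = 0" "x \<ge> 1/4 \<Longrightarrow> smooth_step \<eta> x = 1"
  using \<eta>(3) supp_zero[OF \<eta>(2), of x] by (auto simp: smooth_step_def)

lemma unif_smooth_smooth_step: "unif_smooth n UNIV P (\<lambda>p x. smooth_step \<eta> (a * x + b))"
proof -
  \<comment> \<open>\<open>H j\<close> is to be the j-th derivative of the step; from 1 on it is
    that of a constant.\<close>
  define H where "H j x = (if x < 1 then nth_deriv j \<eta> x else if j = 0 then 1 else 0)" for j x
  have "(H j has_vector_derivative H (Suc j) x) (at x)" for j x
  proof (cases "x < 1")
    case True
    have "(H j has_vector_derivative nth_deriv (Suc j) \<eta> x) (at x)"
      by (rule has_vector_derivative_transform_within_open[OF smooth_on_nth_deriv[OF \<eta>(1)], of x "{..<1}"])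
        (use True in \<open>auto simp: H_def\<close>)
    then show ?thesis using True by (simp add: H_def)
  next
    case False
    \<comment> \<open>On (1/4, 4) both branches of \<open>H j\<close> agree, so the junction causes
      no break.\<close>
    have nd: "nth_deriv j \<eta> y = (if j = 0 then 1 else 0)" if "y \<in> {1/4<..<4}" for y
    proof -
      have "nth_deriv j \<eta> y = nth_deriv j (\<lambda>x. 1) y"
        by (rule nth_deriv_cong_open[of "{1/4<..<4}"]) (use that \<eta>(3) in auto)
      then show ?thesis by (cases j) (auto simp: nth_deriv_const)
    qed
    have "(H j has_vector_derivative 0) (at x)"
    proof (rule has_vector_derivative_transform_within_open)
      show "((\<lambda>_. if j = 0 then 1 else 0) has_vector_derivative 0) (at x)"
        by (rule has_vector_derivative_const)
      show "(if j = 0 then 1 else 0) = H j y" if "y \<in> {1/4<..}" for y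
      proof (cases "y < 1")
        case True
        then have "y \<in> {1/4<..<4}" using that by simp
        from nd[OF this] True show ?thesis unfolding H_def by simp
      qed (simp add: H_def)
    qed (use False in simp_all)
    then show ?thesis using False by (simp add: H_def)
  qed
  note H_deriv = this
  have H_bounded: "\<exists>C. \<forall>x. norm (H j x) \<le> C" for j
  proof -
    obtain C where C: "\<And>x. x \<in> {1/5..1} \<Longrightarrow> norm (nth_deriv j \<eta> x) \<le> C"
      using smooth_on_nth_deriv_bounded[OF \<eta>(1), of "1/5" 1 j] by (meson subset_UNIV)
    have "norm (H j x) \<le> max C 1" for x
    proof (cases "x \<in> {1/5..<1}")
      case True
      then show ?thesis using C[of x] by (auto simp: H_def)
    next
      case False
      then show ?thesis using nth_deriv_zero_outside[OF \<eta>(2), of x j] by (auto simp: H_def)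
    qed
    then show ?thesis by blast
  qed
  have "unif_smooth n UNIV P (\<lambda>p x. of_real (a ^ 0) * H 0 (a * x + b))"
  proof (rule unif_smooth_derivs[where F="\<lambda>j p x. of_real (a ^ j) * H j (a * x + b)"])
    fix j and p :: 'a and x
    have "((\<lambda>x. a * x + b) has_vector_derivative a) (at x)"
      by (auto intro!: derivative_eq_intros simp: has_real_derivative_iff_has_vector_derivative[symmetric])
    from vector_diff_chain_at[OF this H_deriv]
    have "((\<lambda>x. H j (a * x + b)) has_vector_derivative a *\<^sub>R H (Suc j) (a * x + b)) (at x)"
      by (simp add: o_def)
    from has_vector_derivative_mult_right[OF this, of "of_real (a ^ j)"]
    show "((\<lambda>x. of_real (a ^ j) * H j (a * x + b)) has_vector_derivative
        of_real (a ^ Suc j) * H (Suc j) (a * x + b)) (at x)"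
      by (simp add: scaleR_conv_of_real mult_ac)
  next
    fix j
    obtain C where C: "\<And>x. norm (H j x) \<le> C" using H_bounded by blast
    have "norm (of_real (a ^ j) * H j (a * x + b)) \<le> \<bar>a\<bar> ^ j * C" for x
      by (simp add: norm_mult norm_power power_abs C mult_left_mono)
    then show "\<exists>C. \<forall>p\<in>P. \<forall>x\<in>UNIV. norm (of_real (a ^ j) * H j (a * x + b)) \<le> C" by blast
  qed
  moreover have "H 0 = smooth_step \<eta>" by (auto simp: H_def smooth_step_def)
  ultimately show ?thesis by simp
qed

lemma smooth_cutoff_exists:
  assumes "A' < A" "A \<le> B" "B < B'"
  obtains \<theta> where "test_function A' B' \<theta>" "\<And>s. s \<in> {A..B} \<Longrightarrow> \<theta> s = 1"
proof
  \<comment> \<open>The edge of \<open>smooth_step\<close> has width 1/4 - 1/5 = 1/20; the slopes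
    stretch it over the gaps from \<open>A'\<close> to \<open>A\<close> and, reflected, from
    \<open>B\<close> to \<open>B'\<close>.\<close>
  define a where "a = 1 / (20 * (A - A'))"
  define b where "b = 1 / (20 * (B' - B))"
  have ab: "a > 0" "b > 0" "a * (A - A') = 1/20" "b * (B' - B) = 1/20" using assms by (auto simp: a_def b_def)
  define \<theta> where "\<theta> s = smooth_step \<eta> (a * s + (1/5 - a * A')) * smooth_step \<eta> ((- b) * s + (1/5 + b * B'))" for s
  have "unif_smooth n UNIV (UNIV :: unit set) (\<lambda>_. \<theta>)" for n
    unfolding \<theta>_def[abs_def] by (intro unif_smooth_mult unif_smooth_smooth_step)
  moreover have "\<theta> s = 0" if "s \<notin> {A'..B'}" for s
  proof -
    have "a * (s - A') < 0 \<or> b * (B' - s) < 0" using ab that by (auto simp: mult_less_0_iff)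
    then show ?thesis unfolding \<theta>_def
      using smooth_step_values(1)[of "a * s + (1/5 - a * A')"] smooth_step_values(1)[of "(- b) * s + (1/5 + b * B')"]
      by (auto simp: algebra_simps)
  qed
  ultimately show "test_function A' B' \<theta>" by (simp add: test_function_def)
  show "\<theta> s = 1" if "s \<in> {A..B}" for s
  proof -
    have "a * (s - A') \<ge> a * (A - A')" "b * (B' - s) \<ge> b * (B' - B)"
      using ab that by (auto intro!: mult_left_mono)
    then have "a * s + (1/5 - a * A') \<ge> 1/4" "(- b) * s + (1/5 + b * B') \<ge> 1/4"
      using ab(3,4) by (simp_all only: right_diff_distrib mult_minus_left)
    then show ?thesis unfolding \<theta>_def by (simp only: smooth_step_values(2) mult_1)
  qed
qed

end

section \<open>Taylor remainders and oscillatory integrals with nonvanishing second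
  derivative\<close>

text \<open>The derivative of a remainder is the remainder of one order less for the shifted
  sequence, and the mean value inequality on the segment from \<open>v\<close> to \<open>w\<close>
  completes the induction. The factor 1 / fact k is given away.\<close>

lemma taylor_bound:
  fixes G :: "nat \<Rightarrow> real \<Rightarrow> complex"
  assumes "\<And>j x. (G j has_vector_derivative G (Suc j) x) (at x)" "\<And>x. norm (G k x) \<le> B"
  shows "norm (G 0 w - (\<Sum>j<k. G j v * of_real ((w - v) ^ j / fact j))) \<le> B * \<bar>w - v\<bar> ^ k"
  using assms
proof (induction k arbitrary: G w)
  case (Suc k)
  let ?E = "\<lambda>w. G 0 w - (\<Sum>j<Suc k. G j v * of_real ((w - v) ^ j / fact j))"
  let ?E' = "\<lambda>w. G 1 w - (\<Sum>j<k. G (Suc j) v * of_real ((w - v) ^ j / fact j))"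
  have B: "B \<ge> 0" using norm_ge_zero Suc.prems(2) by (rule order_trans)
  \<comment> \<open>With the constant term split off, differentiating the other terms just lowers
    the exponent by one.\<close>
  have E: "?E x = G 0 x - (G 0 v + (\<Sum>j<k. G (Suc j) v * of_real ((x - v) ^ Suc j / fact (Suc j))))" for x
    by (subst sum.lessThan_Suc_shift) simp
  have "(?E has_vector_derivative ?E' x) (at x)" for x
  proof -
    have "((\<lambda>x. (x - v) ^ Suc j / fact (Suc j)) has_real_derivative (x - v) ^ j / fact j) (at x)" for j
      by (auto intro!: derivative_eq_intros simp del: power_Suc of_nat_Suc simp: fact_Suc)
    then have "((\<lambda>x. G (Suc j) v * of_real ((x - v) ^ Suc j / fact (Suc j))) has_vector_derivative
      G (Suc j) v * of_real ((x - v) ^ j / fact j)) (at x)" for j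
      by (rule has_vector_derivative_mult_right[OF has_vector_derivative_of_real])
    then have "((\<lambda>x. G 0 x - (G 0 v + (\<Sum>j<k. G (Suc j) v * of_real ((x - v) ^ Suc j / fact (Suc j)))))
       has_vector_derivative G 1 x - (0 + (\<Sum>j<k. G (Suc j) v * of_real ((x - v) ^ j / fact j)))) (at x)"
      using Suc.prems(1)[of 0]
      by (intro has_vector_derivative_diff has_vector_derivative_add has_vector_derivative_const
          has_vector_derivative_sum) auto
    then show ?thesis unfolding E by simp
  qed
  then have "norm (?E w - ?E v) \<le> (B * \<bar>w - v\<bar> ^ k) * norm (w - v)"
  proof (intro differentiable_bound[where S="closed_segment v w" and f'="\<lambda>x h. h *\<^sub>R ?E' x"])
    fix x assume x: "x \<in> closed_segment v w"
    have "norm (?E' x) \<le> B * \<bar>x - v\<bar> ^ k"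
      using Suc.IH[of "\<lambda>j. G (Suc j)" x] Suc.prems by simp
    also have "\<dots> \<le> B * \<bar>w - v\<bar> ^ k"
      using x B by (intro mult_left_mono power_mono) (auto simp: closed_segment_eq_real_ivl split: if_splits)
    finally have le: "norm (?E' x) \<le> B * \<bar>w - v\<bar> ^ k" .
    show "onorm (\<lambda>h. h *\<^sub>R ?E' x) \<le> B * \<bar>w - v\<bar> ^ k"
    proof (rule onorm_bound)
      show "norm (h *\<^sub>R ?E' x) \<le> B * \<bar>w - v\<bar> ^ k * norm h" for h :: real
        unfolding norm_scaleR using mult_right_mono[OF le, of "\<bar>h\<bar>"] by (simp only: mult.commute real_norm_def abs_ge_zero)
    qed (simp add: B)
  qed (auto simp: has_vector_derivative_def intro: has_derivative_at_withinI)
  moreover have "?E v = 0" unfolding E by simp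
  ultimately show ?case by (simp add: mult_ac)
qed simp

text \<open>Subtracting from the integrand the derivative of \<open>- \<i> b exp (\<i> \<psi>) q (\<psi>')\<close>, where \<open>q p = p / (p\<^sup>2 + \<mu>)\<close>,
  leaves a function dominated by \<open>\<psi>'' / (\<psi>'\<^sup>2 + \<mu>)\<close>, the derivative of an arctangent. There is no need to
  split the interval at the critical point of \<open>\<psi>\<close>.\<close>
lemma van_der_Corput:
  fixes \<psi> \<psi>1 \<psi>2 :: "real \<Rightarrow> real" and b b' :: "real \<Rightarrow> complex"
  assumes "l \<le> u" "\<mu> > 0" "\<bar>\<epsilon>\<bar> = 1"
    and \<psi>: "\<And>x. x \<in> {l..u} \<Longrightarrow> (\<psi> has_real_derivative \<psi>1 x) (at x)"
      "\<And>x. x \<in> {l..u} \<Longrightarrow> (\<psi>1 has_real_derivative \<psi>2 x) (at x)"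
      "\<And>x. x \<in> {l..u} \<Longrightarrow> \<mu> \<le> \<epsilon> * \<psi>2 x"
    and b: "\<And>x. x \<in> {l..u} \<Longrightarrow> (b has_vector_derivative b' x) (at x)" "b l = 0" "b u = 0"
      "\<And>x. x \<in> {l..u} \<Longrightarrow> norm (b x) \<le> B" "\<And>x. x \<in> {l..u} \<Longrightarrow> norm (b' x) \<le> B'"
  shows "norm (integral {l..u} (\<lambda>x. b x * cis (\<psi> x))) \<le> (2 * pi * B + (u - l) * B') / sqrt \<mu>"
proof -
  define \<nu> where "\<nu> = sqrt \<mu>"
  have \<nu>: "\<nu> > 0" "\<nu>\<^sup>2 = \<mu>" using assms by (auto simp: \<nu>_def)
  have B: "B \<ge> 0" "B' \<ge> 0" using order_trans[OF norm_ge_zero b(4)[of l]] order_trans[OF norm_ge_zero b(5)[of l]] assms(1) by auto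
  define D where "D p = p\<^sup>2 + \<mu>" for p :: real
  have D: "D p > 0" "D p \<ge> \<mu>" "D p \<ge> p\<^sup>2" for p using assms by (auto simp: D_def add_nonneg_pos)
  define q where "q p = p / D p" for p
  define q' where "q' p = (\<mu> - p\<^sup>2) / (D p)\<^sup>2" for p
  have q: "(q has_real_derivative q' p) (at p)" for p
    unfolding q_def q'_def using D(1)[of p]
    by (auto intro!: derivative_eq_intros simp: D_def power2_eq_square divide_simps)
  \<comment> \<open>By the inequality of arithmetic and geometric means, \<nu> |p| is at most p^2 +
    \<nu>^2.\<close>
  have qb: "\<bar>q p\<bar> \<le> 1 / \<nu>" for p
  proof -
    have "\<nu> * \<bar>p\<bar> \<le> p\<^sup>2 + \<nu>\<^sup>2" using sum_squares_bound[of "\<bar>p\<bar>" \<nu>] mult_nonneg_nonneg[of \<nu> "\<bar>p\<bar>"] \<nu>(1)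
      unfolding power2_abs mult.commute[of \<nu>] mult.assoc by linarith
    then show ?thesis using D(1)[of p] \<nu> by (simp add: q_def D_def divide_simps mult.commute abs_mult)
  qed
  have q'b: "\<bar>q' p\<bar> \<le> 1 / D p" for p
  proof -
    have "\<bar>\<mu> - p\<^sup>2\<bar> \<le> D p" using assms by (auto simp: D_def abs_le_iff)
    then have "\<bar>\<mu> - p\<^sup>2\<bar> / (D p)\<^sup>2 \<le> D p / (D p)\<^sup>2" by (rule divide_right_mono) simp
    then show ?thesis using D(1)[of p] by (simp add: q'_def power2_eq_square)
  qed
  \<comment> \<open>The product rule for - i b exp(i \<psi>) q(\<psi>'), one summand for each factor
    that depends on x. Its integral is 0 because \<open>b\<close> vanishes at both ends.\<close>
  define F' where "F' x = b x * (\<i> * of_real (\<psi>1 x) * cis (\<psi> x)) * (- \<i> * of_real (q (\<psi>1 x)))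
     + b' x * cis (\<psi> x) * (- \<i> * of_real (q (\<psi>1 x))) + b x * cis (\<psi> x) * (- \<i> * of_real (q' (\<psi>1 x) * \<psi>2 x))" for x
  have F': "(F' has_integral 0) {l..u}"
  proof -
    have "(F' has_integral (b u * cis (\<psi> u) * (- \<i> * of_real (q (\<psi>1 u))) - b l * cis (\<psi> l) * (- \<i> * of_real (q (\<psi>1 l))))) {l..u}"
    proof (rule fundamental_theorem_of_calculus[OF assms(1)])
      fix x assume x: "x \<in> {l..u}"
      have c: "((\<lambda>x. cis (\<psi> x)) has_vector_derivative \<i> * of_real (\<psi>1 x) * cis (\<psi> x)) (at x)"
        using has_vector_derivative_cis[OF \<psi>(1)[OF x], of 1] by simp
      have "((\<lambda>x. q (\<psi>1 x)) has_real_derivative q' (\<psi>1 x) * \<psi>2 x) (at x)"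
        by (rule DERIV_chain2[OF q \<psi>(2)[OF x]])
      note qd = has_vector_derivative_mult_right[OF has_vector_derivative_of_real[OF this], of "- \<i>"]
      have "((\<lambda>x. b x * cis (\<psi> x) * (- \<i> * of_real (q (\<psi>1 x)))) has_vector_derivative F' x) (at x)"
        using has_vector_derivative_mult[OF has_vector_derivative_mult[OF b(1)[OF x] c] qd]
        by (simp add: F'_def algebra_simps)
      then show "((\<lambda>x. b x * cis (\<psi> x) * (- \<i> * of_real (q (\<psi>1 x)))) has_vector_derivative F' x) (at x within {l..u})"
        by (rule has_vector_derivative_at_within)
    qed
    then show ?thesis using b by simp
  qed
  have "continuous_on {l..u} b"
    by (rule continuous_on_vector_derivative[OF has_vector_derivative_at_within[OF b(1)]])
  moreover have "continuous_on {l..u} \<psi>"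
    by (rule DERIV_continuous_on[OF has_field_derivative_at_within[OF \<psi>(1)]])
  ultimately have "(\<lambda>x. b x * cis (\<psi> x)) integrable_on {l..u}"
    by (intro integrable_continuous_real continuous_intros)
  from has_integral_diff[OF integrable_integral[OF this] F']
  have I: "((\<lambda>x. b x * cis (\<psi> x) - F' x) has_integral integral {l..u} (\<lambda>x. b x * cis (\<psi> x))) {l..u}" by simp
  \<comment> \<open>A primitive of the dominating function: arctan (\<psi>' / \<nu>) has derivative
    \<nu> \<psi>'' / (\<psi>'^2 + \<mu>).\<close>
  define A where "A x = 2 * B * \<epsilon> / \<nu> * arctan (\<psi>1 x / \<nu>) + B' / \<nu> * x" for x
  define A' where "A' x = 2 * B * (\<epsilon> * \<psi>2 x) / D (\<psi>1 x) + B' / \<nu>" for x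
  have A: "(A' has_integral A u - A l) {l..u}"
  proof (rule fundamental_theorem_of_calculus[OF assms(1)])
    fix x assume x: "x \<in> {l..u}"
    have 1: "1 + (\<psi>1 x / \<nu>)\<^sup>2 = D (\<psi>1 x) / \<nu>\<^sup>2"
      using \<nu> assms(2) by (simp add: D_def power_divide add_divide_distrib)
    have "((\<lambda>x. arctan (\<psi>1 x / \<nu>)) has_real_derivative inverse (1 + (\<psi>1 x / \<nu>)\<^sup>2) * (\<psi>2 x / \<nu>)) (at x)"
      by (rule DERIV_chain2[OF DERIV_arctan DERIV_cdivide[OF \<psi>(2)[OF x]]])
    then have "(A has_real_derivative 2 * B * \<epsilon> / \<nu> * (inverse (1 + (\<psi>1 x / \<nu>)\<^sup>2) * (\<psi>2 x / \<nu>)) + B' / \<nu> * 1) (at x)"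
      unfolding A_def by (intro DERIV_add DERIV_cmult DERIV_ident)
    also have "2 * B * \<epsilon> / \<nu> * (inverse (1 + (\<psi>1 x / \<nu>)\<^sup>2) * (\<psi>2 x / \<nu>)) + B' / \<nu> * 1 = A' x"
      unfolding 1 A'_def using \<nu>(1) D(1)[of "\<psi>1 x"] by (simp add: power2_eq_square divide_simps)
    finally show "(A has_vector_derivative A' x) (at x within {l..u})"
      by (simp add: has_real_derivative_iff_has_vector_derivative has_vector_derivative_at_within)
  qed
  have le: "norm (b x * cis (\<psi> x) - F' x) \<le> A' x" if x: "x \<in> {l..u}" for x
  proof -
    let ?p = "\<psi>1 x"
    \<comment> \<open>The main term retains the factor \<mu> / (\<psi>'^2 + \<mu>), and \<mu> is at
      most \<epsilon> \<psi>''. The term with \<open>q'\<close> contributes the same amount, hence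
      the factor 2 B.\<close>
    have e: "1 - ?p * q ?p = \<mu> / D ?p" using D(1)[of ?p] by (simp add: q_def D_def divide_simps power2_eq_square)
    have "b x * cis (\<psi> x) - F' x = b x * cis (\<psi> x) * of_real (1 - ?p * q ?p)
       + b' x * cis (\<psi> x) * (\<i> * of_real (q ?p)) + b x * cis (\<psi> x) * (\<i> * of_real (q' ?p * \<psi>2 x))"
      by (simp add: F'_def algebra_simps)
    also have "norm \<dots> \<le> norm (b x) * (\<mu> / D ?p) + norm (b' x) * \<bar>q ?p\<bar> + norm (b x) * (\<bar>q' ?p\<bar> * \<bar>\<psi>2 x\<bar>)"
      unfolding e using D(1)[of ?p] assms(2)
      by (intro norm_triangle_mono) (simp_all only: norm_mult norm_cis norm_of_real norm_ii abs_mult mult_1_left mult_1_right, auto)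
    also have "\<dots> \<le> B * (\<epsilon> * \<psi>2 x / D ?p) + B' * (1 / \<nu>) + B * (1 / D ?p * (\<epsilon> * \<psi>2 x))"
    proof (intro add_mono mult_mono b x qb q'b divide_right_mono \<psi>)
      have "\<bar>\<epsilon> * \<psi>2 x\<bar> = \<bar>\<psi>2 x\<bar>" using assms(3) by (simp add: abs_mult)
      moreover have "\<epsilon> * \<psi>2 x \<ge> 0" using \<psi>(3)[OF x] assms(2) by simp
      ultimately show "\<bar>\<psi>2 x\<bar> \<le> \<epsilon> * \<psi>2 x" by simp
    qed (use B D(1)[of ?p] assms(2) \<nu> in \<open>auto simp: less_imp_le\<close>)
    also have "\<dots> = A' x" by (simp add: A'_def algebra_simps)
    finally show ?thesis .
  qed
  have "norm (integral {l..u} (\<lambda>x. b x * cis (\<psi> x))) \<le> A u - A l"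
    using integral_norm_bound_integral[OF has_integral_integrable[OF I] has_integral_integrable[OF A] le]
    using integral_unique[OF I] integral_unique[OF A] by simp
  also have "A u - A l = 2 * B / \<nu> * (\<epsilon> * (arctan (\<psi>1 u / \<nu>) - arctan (\<psi>1 l / \<nu>))) + (u - l) * B' / \<nu>"
    by (simp add: A_def algebra_simps diff_divide_distrib)
  \<comment> \<open>The arctangent varies by at most pi, whatever the values of \<psi>' at the
    endpoints.\<close>
  also have "2 * B / \<nu> * (\<epsilon> * (arctan (\<psi>1 u / \<nu>) - arctan (\<psi>1 l / \<nu>))) \<le> 2 * B / \<nu> * pi"
    using arctan_bounded[of "\<psi>1 u / \<nu>"] arctan_bounded[of "\<psi>1 l / \<nu>"] assms(3) B \<nu>
    by (intro mult_left_mono) (auto simp: abs_if split: if_splits)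
  finally show ?thesis
    by (simp add: \<nu>_def[symmetric] add_divide_distrib mult_ac)
qed

section \<open>Frequency cutoffs\<close>

lemma integrable_inverse_one_plus_square:
  "integrable lborel (\<lambda>x::real. 1 / (1 + x\<^sup>2))"
  using integrable_inverse_1_plus_square by (simp add: set_integrable_def inverse_eq_divide)

text \<open>Links the integrals over intervals in the phase estimates with the Lebesgue integrals in
  \<open>freq_cutoff\<close> and Fourier inversion.\<close>

lemma LINT_compact_support:
  fixes f :: "real \<Rightarrow> complex"
  assumes "continuous_on {l..u} f" "\<And>x. x \<notin> {l..u} \<Longrightarrow> f x = 0"
  shows "(LINT x|lborel. f x) = integral {l..u} f" "integrable lborel f"
proof -
  have i: "set_integrable lborel {l..u} f"
    using assms(1) by (rule borel_integrable_atLeastAtMost')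
  have eq: "(\<lambda>x. indicat_real {l..u} x *\<^sub>R f x) = f"
    using assms(2) by (auto simp: indicator_def fun_eq_iff)
  show "integrable lborel f" using i eq by (simp add: set_integrable_def)
  show "(LINT x|lborel. f x) = integral {l..u} f"
    using set_borel_integral_eq_integral(2)[OF i] eq by (simp add: set_lebesgue_integral_def)
qed

lemma continuous_on_oscillatory_integral:
  fixes G :: "real \<Rightarrow> complex"
  assumes "continuous_on {l..u} G"
  shows "continuous_on UNIV (\<lambda>s. integral {l..u} (\<lambda>z. G z * cis (- (T * s * z))))"
proof -
  have "continuous_on (UNIV \<times> cbox l u) (\<lambda>(s, z). G z * cis (- (T * s * z)))"
    using assms unfolding case_prod_beta
    by (intro continuous_intros continuous_on_compose2[OF assms]) auto
  from integral_continuous_on_param[OF this] show ?thesis by simp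
qed

text \<open>For \<open>G\<close> supported in \<open>[l, u]\<close> this is \<open>2 \<pi>\<close> times the multiplier operator with symbol
  \<open>\<omega> \<mapsto> \<theta> (\<omega> / T)\<close>, applied to \<open>G\<close> and evaluated at \<open>y\<close>.\<close>
definition freq_cutoff :: "(real \<Rightarrow> complex) \<Rightarrow> real \<Rightarrow> real \<Rightarrow> real \<Rightarrow> (real \<Rightarrow> complex) \<Rightarrow> real \<Rightarrow> complex" where
  "freq_cutoff \<theta> l u T G y =
    of_real T * (LINT s|lborel. \<theta> s * integral {l..u} (\<lambda>z. G z * cis (- (T * s * z))) * cis (T * s * y))"

text \<open>The derivative of the phase takes values in \<open>\<sigma> [c1, c2]\<close>, away from the frequencies discarded
  by \<open>\<theta>\<close>; at those the phase \<open>\<Phi> z - s z\<close> is nonstationary.\<close>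
lemma frequency_localization:
  fixes \<Phi> \<Phi>' :: "'p \<Rightarrow> real \<Rightarrow> real" and b :: "'p \<Rightarrow> real \<Rightarrow> complex"
  assumes lu: "q < l'" "l' < l" "u < u'" "u' < Q"
    and \<Phi>: "\<And>p x. p \<in> P \<Longrightarrow> x \<in> {q<..<Q} \<Longrightarrow> (\<Phi> p has_real_derivative \<Phi>' p x) (at x)"
      "\<And>n. unif_smooth n {q<..<Q} P (\<lambda>p x. of_real (\<Phi>' p x))"
      "\<And>p x. p \<in> P \<Longrightarrow> x \<in> {q<..<Q} \<Longrightarrow> \<sigma> * \<Phi>' p x \<in> {c1..c2}"
      "c1 > 0" "\<bar>\<sigma>\<bar> = 1"
    and \<theta>: "\<theta> \<in> borel_measurable borel" "\<And>s. \<sigma> * s \<in> {c1/2..2*c2} \<Longrightarrow> \<theta> s = 1" "\<And>s. norm (\<theta> s) \<le> M"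
    and b: "unif_smooth N {q<..<Q} P b" "\<And>p x. p \<in> P \<Longrightarrow> x \<notin> {l..u} \<Longrightarrow> b p x = 0" "N \<ge> 2"
  shows "\<exists>C\<ge>0. \<forall>p\<in>P. \<forall>T>0. \<forall>y. norm (2 * pi * (b p y * cis (T * \<Phi> p y))
      - freq_cutoff \<theta> l' u' T (\<lambda>z. b p z * cis (T * \<Phi> p z)) y) \<le> C / T ^ (N - 1)"
proof -
  let ?S = "{q<..<Q}"
  \<comment> \<open>\<open>W\<close> contains every frequency at which \<theta> may differ from
    1.\<close>
  define W where "W = {s. \<sigma> * s \<notin> {c1/2..2*c2}}"
  \<comment> \<open>On \<open>W\<close> the value \<sigma> s is below c1/2 or above 2 c2, hence at
    distance at least (c1 + |s|)/4 from the interval [c1, c2].\<close>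
  define c where "c = min (1/4) (c1/4)"
  have c: "c > 0" "c \<le> 1/4" "c \<le> c1/4" using \<Phi>(4) by (auto simp: c_def)
  have low: "c * (1 + \<bar>s\<bar>) \<le> \<bar>\<Phi>' p x - s\<bar>" if "p \<in> P" "x \<in> ?S" "s \<in> W" for p x s
  proof -
    have a: "\<bar>\<Phi>' p x - s\<bar> = \<bar>\<sigma> * \<Phi>' p x - \<sigma> * s\<bar>" "\<bar>s\<bar> = \<bar>\<sigma> * s\<bar>"
      using \<Phi>(5) by (simp_all add: abs_mult flip: right_diff_distrib)
    have v: "c1 \<le> \<sigma> * \<Phi>' p x" "\<sigma> * \<Phi>' p x \<le> c2" using \<Phi>(3)[OF that(1,2)] by auto
    have w: "\<sigma> * s < c1/2 \<or> \<sigma> * s > 2 * c2" using that by (auto simp: W_def)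
    have "c1 / 4 + \<bar>\<sigma> * s\<bar> / 4 \<le> \<bar>\<sigma> * \<Phi>' p x - \<sigma> * s\<bar>"
      using v w \<Phi>(4) by (auto simp: abs_if)
    moreover have "c * \<bar>\<sigma> * s\<bar> \<le> 1/4 * \<bar>\<sigma> * s\<bar>" using c by (intro mult_right_mono) auto
    ultimately show ?thesis unfolding a using c by (simp add: algebra_simps)
  qed
  \<comment> \<open>Dividing by 1 + |s| makes the family bounded although \<open>W\<close> is not.
    The factor reappears as the \<sigma> of \<open>nonstationary_phase\<close>, so that N steps also
    gain (1 + |s|)^(-N).\<close>
  define r where "r = (\<lambda>(p, s) x. (\<Phi>' p x - s) / (1 + \<bar>s\<bar>))"
  have "\<exists>C\<ge>0. \<forall>ps\<in>P \<times> W. \<forall>T>0. norm (integral {l'..u'} (\<lambda>z. b (fst ps) z * cis (T * (\<Phi> (fst ps) z - snd ps * z))))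
      \<le> C / (T * (1 + \<bar>snd ps\<bar>)) ^ N"
  proof (rule nonstationary_phase[where r=r and c=c and S="?S"])
    fix n
    have n1: "norm (1 + complex_of_real \<bar>s\<bar>) = 1 + \<bar>s\<bar>" for s
      by (metis abs_of_nonneg add_nonneg_nonneg abs_ge_zero norm_of_real of_real_1 of_real_add zero_le_one)
    have "unif_smooth n ?S (P \<times> W) (\<lambda>ps x. of_real (1 / (1 + \<bar>snd ps\<bar>)) * of_real (\<Phi>' (fst ps) x) - of_real (snd ps / (1 + \<bar>snd ps\<bar>)))"
      by (intro unif_smooth_diff unif_smooth_mult unif_smooth_const[where B=1] unif_smooth_reindex[OF \<Phi>(2)])
        (auto simp: norm_divide n1)
    then show "unif_smooth n ?S (P \<times> W) (\<lambda>ps x. of_real (r ps x))"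
      by (rule unif_smooth_cong) (auto simp: r_def diff_divide_distrib)
  next
    fix ps x assume "ps \<in> P \<times> W" "x \<in> ?S"
    then show "c \<le> \<bar>r ps x\<bar>" using low[of "fst ps" x "snd ps"]
      by (auto simp: r_def pos_le_divide_eq abs_divide)
  next
    fix ps x assume ps: "ps \<in> P \<times> W" "x \<in> ?S"
    have "((\<lambda>z. \<Phi> (fst ps) z - snd ps * z) has_real_derivative \<Phi>' (fst ps) x - snd ps * 1) (at x)"
      using ps by (intro DERIV_diff \<Phi>(1) DERIV_cmult DERIV_ident) auto
    moreover have "(1 + \<bar>snd ps\<bar>) * r ps x = \<Phi>' (fst ps) x - snd ps * 1" by (auto simp: r_def case_prod_beta)
    ultimately show "((\<lambda>z. \<Phi> (fst ps) z - snd ps * z) has_real_derivative (1 + \<bar>snd ps\<bar>) * r ps x) (at x)" by simp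
  next
    show "unif_smooth N ?S (P \<times> W) (\<lambda>ps. b (fst ps))" by (rule unif_smooth_reindex[OF b(1)]) auto
  qed (use lu c b in auto)
  then obtain C where C: "C \<ge> 0" "\<And>p s T. p \<in> P \<Longrightarrow> s \<in> W \<Longrightarrow> T > 0 \<Longrightarrow>
      norm (integral {l'..u'} (\<lambda>z. b p z * cis (T * (\<Phi> p z - s * z)))) \<le> C / (T * (1 + \<bar>s\<bar>)) ^ N"
    by fastforce
  have M: "M \<ge> 0" using norm_ge_zero \<theta>(3) order_trans by blast
  have "norm (2 * pi * (b p y * cis (T * \<Phi> p y)) - freq_cutoff \<theta> l' u' T (\<lambda>z. b p z * cis (T * \<Phi> p z)) y)
      \<le> ((1 + M) * C * (LINT s|lborel. 1 / (1 + s\<^sup>2))) / T ^ (N - 1)" if p: "p \<in> P" and T: "T > 0" for p T y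
  proof -
    define f where "f z = b p z * cis (T * \<Phi> p z)" for z
    define F where "F s = integral {l'..u'} (\<lambda>z. f z * cis (- (T * s * z)))" for s
    \<comment> \<open>Nothing is known about the phase outside (q, Q), but \<open>f\<close> is zero
      off \<open>{l..u}\<close>; continuity is glued from two open sets covering the line.\<close>
    have "continuous_on ({q<..<Q} \<union> - {l..u}) f"
    proof (rule continuous_on_open_Un)
      have "continuous_on ?S (b p)"
        using b(1,3) by (intro unif_smooth_continuous[OF unif_smooth_le[of N _ _ _ "Suc 0"] p]) auto
      moreover have "continuous_on ?S (\<Phi> p)"
        by (rule DERIV_continuous_on[OF has_field_derivative_at_within[OF \<Phi>(1)[OF p]]])
      ultimately show "continuous_on ?S f" unfolding f_def by (intro continuous_intros)
      show "continuous_on (- {l..u}) f"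
        using b(2)[OF p] by (subst continuous_on_cong[OF refl, of _ _ "\<lambda>_. 0"]) (auto simp: f_def)
    qed auto
    moreover have "{q<..<Q} \<union> - {l..u} = UNIV" using lu by auto
    ultimately have fc: "continuous_on UNIV f" by simp
    have f0: "f z = 0" if "z \<notin> {l'..u'}" for z using b(2)[OF p, of z] that lu by (auto simp: f_def)
    have Fc: "continuous_on UNIV F" unfolding F_def
      by (intro continuous_on_oscillatory_integral continuous_on_subset[OF fc]) auto
    have FW: "norm (F s) \<le> (C / T ^ N) * (1 / (1 + s\<^sup>2))" if "s \<in> W" for s
    proof -
      have "F s = integral {l'..u'} (\<lambda>z. b p z * cis (T * (\<Phi> p z - s * z)))"
        unfolding F_def f_def by (intro integral_cong) (simp add: mult.assoc cis_mult algebra_simps)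
      then have "norm (F s) \<le> C / (T * (1 + \<bar>s\<bar>)) ^ N" using C(2)[OF p that T] by simp
      \<comment> \<open>N >= 2 leaves an integrable function of \<open>s\<close>.\<close>
      also have "\<dots> \<le> C / (T ^ N * (1 + s\<^sup>2))"
      proof (intro divide_left_mono)
        have "1 + s\<^sup>2 \<le> (1 + \<bar>s\<bar>)\<^sup>2" by (simp add: power2_sum)
        also have "\<dots> \<le> (1 + \<bar>s\<bar>) ^ N" using b(3) by (intro power_increasing) auto
        finally show "T ^ N * (1 + s\<^sup>2) \<le> (T * (1 + \<bar>s\<bar>)) ^ N"
          using T by (auto simp: power_mult_distrib intro!: mult_left_mono)
      qed (use C T in \<open>auto intro!: mult_pos_pos add_pos_nonneg\<close>)
      finally show ?thesis by simp
    qed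
    \<comment> \<open>Integrability needs no uniformity, so the constant may depend on
      \<open>p\<close> and \<open>T\<close>: decay on \<open>W\<close> is combined with continuity
      on a bounded set containing all other frequencies.\<close>
    have Fi: "integrable lborel F"
    proof -
      let ?K = "{- 2 * c2..2 * c2}"
      have "bounded (F ` ?K)"
        by (intro compact_imp_bounded compact_continuous_image continuous_on_subset[OF Fc]) auto
      then obtain K where K: "\<And>s. s \<in> ?K \<Longrightarrow> norm (F s) \<le> K" unfolding bounded_iff by blast
      define K' where "K' = max K 0 * (1 + (2 * c2)\<^sup>2) + C / T ^ N"
      have K': "K' \<ge> 0" using C T by (simp add: K'_def)
      have "norm (F s) \<le> norm (K' * (1 / (1 + s\<^sup>2)))" for s
      proof (cases "s \<in> W")
        case True
        have "C / T ^ N \<le> K'" by (simp add: K'_def)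
        then have "(C / T ^ N) * (1 / (1 + s\<^sup>2)) \<le> K' * (1 / (1 + s\<^sup>2))"
          by (intro mult_right_mono) (auto simp: add_nonneg_nonneg)
        then show ?thesis using FW[OF True] K' by simp
      next
        case False
        then have "\<bar>\<sigma> * s\<bar> \<le> 2 * c2" using \<Phi>(4) by (auto simp: W_def)
        then have s: "\<bar>s\<bar> \<le> 2 * c2" using \<Phi>(5) by (simp add: abs_mult)
        then have "s\<^sup>2 \<le> (2 * c2)\<^sup>2" by (metis abs_ge_zero power2_abs power_mono)
        then have "max K 0 * (1 + s\<^sup>2) \<le> max K 0 * (1 + (2 * c2)\<^sup>2)" by (intro mult_left_mono) auto
        also have "\<dots> \<le> K'" using C T by (simp add: K'_def)
        finally have "max K 0 * (1 + s\<^sup>2) \<le> K'" .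
        moreover have "0 < 1 + s\<^sup>2" by (simp add: add_pos_nonneg)
        ultimately have "max K 0 \<le> K' / (1 + s\<^sup>2)"
          by (simp only: pos_le_divide_eq)
        moreover have "norm (F s) \<le> max K 0" using K[of s] s by (auto simp: abs_le_iff intro: max.coboundedI1)
        ultimately have "norm (F s) \<le> K' / (1 + s\<^sup>2)" by linarith
        then show ?thesis using K' by simp
      qed
      then show ?thesis
        by (intro Bochner_Integration.integrable_bound[OF integrable_mult_right[OF integrable_inverse_one_plus_square, of K']])
          (use Fc in \<open>auto simp: borel_measurable_continuous_onI\<close>)
    qed
    have [measurable]: "F \<in> borel_measurable borel" using Fi by auto
    note \<theta>(1)[measurable]
    have [measurable]: "cis \<in> borel_measurable borel"
      by (intro borel_measurable_continuous_onI) (auto intro!: continuous_intros)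
    \<comment> \<open>\<open>F s\<close> is the transform at frequency T s; undoing this scaling
      produces the factor T.\<close>
    have "(LINT w|lborel. F (w / T) * cis (y * w)) = 2 * pi * f y"
    proof (rule Fourier_inversion[OF fc f0])
      fix w
      have "(LINT z|lborel. f z * cis (- (w * z))) = integral {l'..u'} (\<lambda>z. f z * cis (- (w * z)))"
        by (intro LINT_compact_support continuous_intros continuous_on_subset[OF fc]) (auto simp: f0)
      then show "F (w / T) = (LINT z|lborel. f z * cis (- (w * z)))" using T by (simp add: F_def)
      show "integrable lborel (\<lambda>w. F (w / T))"
        using lborel_integrable_real_affine[OF Fi, of "1 / T" 0] T by simp
    qed
    also have "(LINT w|lborel. F (w / T) * cis (y * w)) = T *\<^sub>R (LINT s|lborel. F s * cis (T * s * y))"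
      using T by (subst lborel_integral_real_affine[of T _ 0]) (auto simp: mult_ac)
    finally have inv: "2 * pi * f y = of_real T * (LINT s|lborel. F s * cis (T * s * y))"
      by (simp add: scaleR_conv_of_real)
    have I1: "integrable lborel (\<lambda>s. F s * cis (T * s * y))"
      by (rule Bochner_Integration.integrable_bound[OF Fi]) (auto simp: norm_mult)
    have I2: "integrable lborel (\<lambda>s. \<theta> s * F s * cis (T * s * y))"
      by (rule Bochner_Integration.integrable_bound[OF integrable_mult_right[OF Fi, of "of_real M"]])
        (use \<theta>(3) M in \<open>auto simp: norm_mult intro!: mult_right_mono\<close>)
    \<comment> \<open>Since 1 - \<theta> vanishes off \<open>W\<close>, only frequencies with the
      bound \<open>FW\<close> enter the error.\<close>
    have "2 * pi * f y - freq_cutoff \<theta> l' u' T f y = of_real T * (LINT s|lborel. (1 - \<theta> s) * F s * cis (T * s * y))"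
      unfolding inv freq_cutoff_def F_def[symmetric] right_diff_distrib[symmetric]
      by (subst Bochner_Integration.integral_diff[OF I1 I2, symmetric]) (simp add: algebra_simps)
    also have "norm \<dots> = T * norm (LINT s|lborel. (1 - \<theta> s) * F s * cis (T * s * y))"
      using T by (simp add: norm_mult)
    also have "norm (LINT s|lborel. (1 - \<theta> s) * F s * cis (T * s * y)) \<le>
        (LINT s|lborel. ((1 + M) * C / T ^ N) * (1 / (1 + s\<^sup>2)))"
    proof (rule Bochner_Integration.integral_norm_bound_integral)
      show "integrable lborel (\<lambda>s. (1 - \<theta> s) * F s * cis (T * s * y))"
        using Bochner_Integration.integrable_diff[OF I1 I2] by (simp add: algebra_simps)
      show "integrable lborel (\<lambda>s. ((1 + M) * C / T ^ N) * (1 / (1 + s\<^sup>2)))"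
        by (intro integrable_mult_right integrable_inverse_one_plus_square)
      fix s
      show "norm ((1 - \<theta> s) * F s * cis (T * s * y)) \<le> ((1 + M) * C / T ^ N) * (1 / (1 + s\<^sup>2))"
      proof (cases "s \<in> W")
        case True
        have "norm (1 - \<theta> s) \<le> 1 + M" using norm_triangle_ineq4[of 1 "\<theta> s"] \<theta>(3)[of s] by simp
        then have "norm (1 - \<theta> s) * norm (F s) \<le> (1 + M) * ((C / T ^ N) * (1 / (1 + s\<^sup>2)))"
          using M by (intro mult_mono FW True) auto
        then show ?thesis by (simp add: norm_mult)
      next
        case False
        then have "\<theta> s = 1" by (intro \<theta>(2)) (simp add: W_def)
        then show ?thesis using M C T by (simp add: add_nonneg_nonneg)
      qed
    qed
    also have "(LINT s|lborel. ((1 + M) * C / T ^ N) * (1 / (1 + s\<^sup>2))) = ((1 + M) * C / T ^ N) * (LINT s|lborel. 1 / (1 + s\<^sup>2))"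
      by (rule integral_mult_right_zero)
    \<comment> \<open>The factor T from the scaling uses up one of the \<open>N\<close>
      powers.\<close>
    also have "T * (((1 + M) * C / T ^ N) * (LINT s|lborel. 1 / (1 + s\<^sup>2))) = ((1 + M) * C * (LINT s|lborel. 1 / (1 + s\<^sup>2))) / T ^ (N - 1)"
      using T b(3) by (cases N) (auto simp: divide_simps)
    finally show ?thesis using T unfolding f_def by (simp add: mult_left_mono)
  qed
  moreover have "(1 + M) * C * (LINT s|lborel. 1 / (1 + s\<^sup>2)) \<ge> 0"
    using M C by (intro mult_nonneg_nonneg Bochner_Integration.integral_nonneg) (auto simp: add_nonneg_nonneg)
  ultimately show ?thesis by blast
qed

section \<open>The convolution kernel of a smooth frequency cutoff\<close>

context
  fixes \<theta> :: "real \<Rightarrow> complex" and \<alpha> \<beta> :: real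
  assumes \<theta>: "test_function \<alpha> \<beta> \<theta>"
begin

lemma test_function_smooth: "unif_smooth n UNIV (UNIV :: unit set) (\<lambda>_. \<theta>)"
  and test_function_zero: "s \<notin> {\<alpha>..\<beta>} \<Longrightarrow> \<theta> s = 0"
  using \<theta> unfolding test_function_def by blast+

lemma test_function_continuous: "continuous_on A \<theta>"
  using unif_smooth_continuous[OF test_function_smooth[of "Suc 0"]] by (auto intro: continuous_on_subset)

lemma test_function_bounded: obtains M where "M \<ge> 0" "\<And>s. norm (\<theta> s) \<le> M"
  using unif_smooth_bounded[OF test_function_smooth[of 0]] by (metis UNIV_I)

text \<open>Nonstationary phase with a linear phase. The product form includes w = 0, and enlarging
  the interval by 1 on each side gives the room that \<open>nonstationary_phase\<close> demands
  around the support.\<close>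

lemma test_function_kernel_decay:
  "\<exists>C\<ge>0. \<forall>w. norm (integral {\<alpha>-1..\<beta>+1} (\<lambda>s. \<theta> s * cis (w * s))) * \<bar>w\<bar> ^ n \<le> C"
proof (cases n)
  case 0
  obtain M where M: "M \<ge> 0" "\<And>s. norm (\<theta> s) \<le> M" by (rule test_function_bounded) blast
  have "norm (integral {\<alpha>-1..\<beta>+1} (\<lambda>s. \<theta> s * cis (w * s))) \<le> integral {\<alpha>-1..\<beta>+1} (\<lambda>s. M)" for w
    by (intro integral_norm_bound_integral integrable_continuous_real continuous_intros test_function_continuous)
      (auto simp: norm_mult M)
  moreover have "integral {\<alpha>-1..\<beta>+1} (\<lambda>s. M) \<ge> 0" by (rule integral_nonneg) (auto simp: M)
  ultimately show ?thesis unfolding 0 power_0 mult_1_right by blast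
next
  case (Suc m)
  \<comment> \<open>The Boolean parameter is the sign of \<open>w\<close>, as
    \<open>nonstationary_phase\<close> treats positive \<tau> only.\<close>
  have "\<exists>C\<ge>0. \<forall>p\<in>(UNIV :: bool set). \<forall>\<tau>>0. norm (integral {\<alpha>-1..\<beta>+1} (\<lambda>s. \<theta> s * cis (\<tau> * (if p then s else - s)))) \<le> C / (\<tau> * 1) ^ n"
  proof (rule nonstationary_phase[where r="\<lambda>p s. if p then 1 else -1" and c=1 and S=UNIV])
    show "unif_smooth n UNIV UNIV (\<lambda>p :: bool. \<theta>)" by (rule unif_smooth_reindex[OF test_function_smooth]) auto
    show "unif_smooth n UNIV UNIV (\<lambda>p x. complex_of_real (if p then 1 else - 1))" for n
      by (rule unif_smooth_const[where B=1]) auto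
    show "((\<lambda>s. if p then s else - s) has_real_derivative 1 * (if p then 1 else - 1)) (at x)" for p x
      by (cases p) (auto intro!: derivative_eq_intros)
  qed (use test_function_zero in auto)
  then obtain C where C: "C \<ge> 0" "\<And>p \<tau>. \<tau> > 0 \<Longrightarrow> norm (integral {\<alpha>-1..\<beta>+1} (\<lambda>s. \<theta> s * cis (\<tau> * (if p then s else - s)))) \<le> C / \<tau> ^ n"
    by auto
  have "norm (integral {\<alpha>-1..\<beta>+1} (\<lambda>s. \<theta> s * cis (w * s))) * \<bar>w\<bar> ^ n \<le> C" for w
  proof (cases "w = 0")
    case False
    have "norm (integral {\<alpha>-1..\<beta>+1} (\<lambda>s. \<theta> s * cis (w * s))) \<le> C / \<bar>w\<bar> ^ n"
      using C(2)[of "\<bar>w\<bar>" "w > 0"] False by (auto simp: abs_if split: if_splits)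
    then show ?thesis using False by (simp add: pos_le_divide_eq)
  qed (use Suc C in simp)
  then show ?thesis using C by blast
qed

lemma freq_cutoff_integrable:
  assumes "continuous_on {l..u} G"
  shows "integrable lborel (\<lambda>s. \<theta> s * integral {l..u} (\<lambda>z. G z * cis (- (T * s * z))) * cis (T * s * y))"
  by (rule LINT_compact_support[of "\<alpha>-1" "\<beta>+1"])
    (auto intro!: continuous_intros test_function_continuous test_function_zero
      continuous_on_subset[OF continuous_on_oscillatory_integral[OF assms]])

lemma freq_cutoff_linear:
  assumes "continuous_on {l..u} G" "continuous_on {l..u} H"
  shows "freq_cutoff \<theta> l u T (\<lambda>z. c * G z + H z) y = c * freq_cutoff \<theta> l u T G y + freq_cutoff \<theta> l u T H y"
proof -
  have e: "integral {l..u} (\<lambda>z. (c * G z + H z) * cis (- (T * s * z))) =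
    c * integral {l..u} (\<lambda>z. G z * cis (- (T * s * z))) + integral {l..u} (\<lambda>z. H z * cis (- (T * s * z)))" for s
  proof -
    have "(\<lambda>z. G z * cis (- (T * s * z))) integrable_on {l..u}" "(\<lambda>z. H z * cis (- (T * s * z))) integrable_on {l..u}"
      by (intro integrable_continuous_real continuous_intros assms)+
    from has_integral_add[OF has_integral_mult_right[OF integrable_integral[OF this(1)], of c] integrable_integral[OF this(2)]]
    show ?thesis by (intro integral_unique) (simp add: algebra_simps)
  qed
  note I = freq_cutoff_integrable[OF assms(1), of T y] freq_cutoff_integrable[OF assms(2), of T y]
  show ?thesis unfolding freq_cutoff_def e
    using Bochner_Integration.integral_add[OF integrable_mult_right[OF I(1), of c] I(2)]
    by (simp add: algebra_simps)
qed

text \<open>Exchanging two integrals of a continuous function on a rectangle exhibits a convolution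
  with the kernel T K(T (y - z)), where \<open>K\<close> is the unnormalized inverse Fourier
  transform of \<theta>.\<close>

lemma freq_cutoff_eq_kernel:
  assumes G: "continuous_on {l..u} G"
  shows "freq_cutoff \<theta> l u T G y =
    of_real T * integral {l..u} (\<lambda>z. G z * integral {\<alpha>-1..\<beta>+1} (\<lambda>s. \<theta> s * cis (T * (y - z) * s)))"
proof -
  let ?h = "\<lambda>s z. G z * (\<theta> s * cis (T * (y - z) * s))"
  have "(LINT s|lborel. \<theta> s * integral {l..u} (\<lambda>z. G z * cis (- (T * s * z))) * cis (T * s * y))
     = integral {\<alpha>-1..\<beta>+1} (\<lambda>s. \<theta> s * integral {l..u} (\<lambda>z. G z * cis (- (T * s * z))) * cis (T * s * y))"
    by (rule LINT_compact_support)
      (auto intro!: continuous_intros test_function_continuous test_function_zero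
        continuous_on_subset[OF continuous_on_oscillatory_integral[OF G]])
  also have "\<dots> = integral {\<alpha>-1..\<beta>+1} (\<lambda>s. integral {l..u} (\<lambda>z. ?h s z))"
  proof (rule integral_cong)
    fix s
    have "\<theta> s * integral {l..u} (\<lambda>z. G z * cis (- (T * s * z))) * cis (T * s * y) =
       integral {l..u} (\<lambda>z. \<theta> s * (G z * cis (- (T * s * z))) * cis (T * s * y))"
      by (simp only: integral_mult_left integral_mult_right)
    also have "\<dots> = integral {l..u} (\<lambda>z. ?h s z)"
      by (rule integral_cong) (simp add: mult.assoc mult.left_commute cis_mult algebra_simps)
    finally show "\<theta> s * integral {l..u} (\<lambda>z. G z * cis (- (T * s * z))) * cis (T * s * y) = integral {l..u} (\<lambda>z. ?h s z)" .
  qed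
  also have "\<dots> = integral {l..u} (\<lambda>z. integral {\<alpha>-1..\<beta>+1} (\<lambda>s. ?h s z))"
  proof -
    have "continuous_on (cbox (\<alpha>-1, l) (\<beta>+1, u)) (\<lambda>(s, z). ?h s z)"
      unfolding case_prod_beta cbox_Pair_eq
      by (intro continuous_intros continuous_on_compose2[OF G] continuous_on_compose2[OF test_function_continuous]) auto
    from integral_swap_continuous[OF this] show ?thesis by simp
  qed
  finally show ?thesis unfolding freq_cutoff_def by (simp add: integral_mult_right)
qed

text \<open>The kernel decays so fast that a factor |z - y|^k is worth T^(-k). No derivative of
  \<open>G\<close> enters, and the constant depends on \<theta> and \<open>k\<close> alone, so a
  Taylor remainder can be estimated by its size.\<close>

lemma freq_cutoff_bound:
  "\<exists>C\<ge>0. \<forall>G l u T y M. T > 0 \<longrightarrow> M \<ge> 0 \<longrightarrow> continuous_on {l..u} G \<longrightarrow> (\<forall>z\<in>{l..u}. norm (G z) \<le> M * \<bar>z - y\<bar> ^ k) \<longrightarrow>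
     norm (freq_cutoff \<theta> l u T G y) \<le> C * M / T ^ k"
proof -
  define K where "K w = integral {\<alpha>-1..\<beta>+1} (\<lambda>s. \<theta> s * cis (w * s))" for w
  have Kc: "continuous_on UNIV K"
    using continuous_on_oscillatory_integral[OF test_function_continuous, of "\<alpha>-1" "\<beta>+1" "-1"]
    by (simp add: K_def[abs_def])
  obtain C1 C2 where C: "C1 \<ge> 0" "C2 \<ge> 0" "\<And>w. norm (K w) * \<bar>w\<bar> ^ k \<le> C1" "\<And>w. norm (K w) * \<bar>w\<bar> ^ (k + 2) \<le> C2"
    unfolding K_def using test_function_kernel_decay[of k] test_function_kernel_decay[of "k + 2"] by blast
  \<comment> \<open>Two powers more than \<open>k\<close> leave the integrable weight 1 / (1 +
    w^2).\<close>
  have K: "norm (K w) * \<bar>w\<bar> ^ k \<le> (C1 + C2) / (1 + w\<^sup>2)" for w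
  proof -
    have "norm (K w) * \<bar>w\<bar> ^ k * (1 + w\<^sup>2) = norm (K w) * \<bar>w\<bar> ^ k + norm (K w) * \<bar>w\<bar> ^ (k + 2)"
      by (simp add: power_add power2_eq_square algebra_simps)
    also have "\<dots> \<le> C1 + C2" by (intro add_mono C)
    finally have "norm (K w) * \<bar>w\<bar> ^ k * (1 + w\<^sup>2) \<le> C1 + C2" .
    moreover have "1 + w\<^sup>2 > 0" by (simp add: add_pos_nonneg)
    ultimately show ?thesis by (simp only: pos_le_divide_eq)
  qed
  have "norm (freq_cutoff \<theta> l u T G y) \<le> (pi * (C1 + C2)) * M / T ^ k"
    if T: "T > 0" and M: "M \<ge> 0" and G: "continuous_on {l..u} G" "\<And>z. z\<in>{l..u} \<Longrightarrow> norm (G z) \<le> M * \<bar>z - y\<bar> ^ k"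
    for G l u T y M
  proof (cases "l \<le> u")
    case True
    define d where "d = M * (C1 + C2) / T ^ k"
    have d: "d \<ge> 0" using T M C by (simp add: d_def)
    have D: "((\<lambda>z. d * (1 / (1 + (T * (z - y))\<^sup>2))) has_integral (d / T * arctan (T * (u - y)) - d / T * arctan (T * (l - y)))) {l..u}"
    proof (rule fundamental_theorem_of_calculus[OF True])
      fix z
      have "((\<lambda>z. arctan (T * (z - y))) has_real_derivative inverse (1 + (T * (z - y))\<^sup>2) * (T * (1 - 0))) (at z within {l..u})"
        by (intro DERIV_chain2[OF DERIV_arctan] DERIV_cmult DERIV_diff DERIV_ident DERIV_const)
      from DERIV_cmult[OF this, of "d / T"]
      show "((\<lambda>z. d / T * arctan (T * (z - y))) has_vector_derivative d * (1 / (1 + (T * (z - y))\<^sup>2))) (at z within {l..u})"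
        using T by (simp add: has_real_derivative_iff_has_vector_derivative[symmetric] inverse_eq_divide)
    qed
    have "norm (integral {l..u} (\<lambda>z. G z * K (T * (y - z)))) \<le> integral {l..u} (\<lambda>z. d * (1 / (1 + (T * (z - y))\<^sup>2)))"
    proof (rule integral_norm_bound_integral)
      show "(\<lambda>z. G z * K (T * (y - z))) integrable_on {l..u}"
        by (intro integrable_continuous_real continuous_intros G continuous_on_compose2[OF Kc]) auto
      show "(\<lambda>z. d * (1 / (1 + (T * (z - y))\<^sup>2))) integrable_on {l..u}" using D by blast
      fix z assume z: "z \<in> {l..u}"
      have "norm (G z * K (T * (y - z))) \<le> M * \<bar>z - y\<bar> ^ k * norm (K (T * (y - z)))"
        unfolding norm_mult by (intro mult_right_mono G z) auto
      also have "\<dots> = M / T ^ k * (norm (K (T * (y - z))) * \<bar>T * (y - z)\<bar> ^ k)"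
        using T by (simp add: abs_mult power_mult_distrib abs_minus_commute)
      also have "\<dots> \<le> M / T ^ k * ((C1 + C2) / (1 + (T * (y - z))\<^sup>2))"
        using M T by (intro mult_left_mono K) auto
      also have "\<dots> = d * (1 / (1 + (T * (z - y))\<^sup>2))"
        by (simp add: d_def power_mult_distrib power2_commute)
      finally show "norm (G z * K (T * (y - z))) \<le> d * (1 / (1 + (T * (z - y))\<^sup>2))" .
    qed
    also have "\<dots> = d / T * (arctan (T * (u - y)) - arctan (T * (l - y)))"
      using integral_unique[OF D] by (simp add: right_diff_distrib)
    \<comment> \<open>The bound on the arctangent removes the dependence on \<open>l\<close>,
      \<open>u\<close> and \<open>y\<close>.\<close>
    also have "\<dots> \<le> d / T * pi"
      using arctan_bounded[of "T * (u - y)"] arctan_bounded[of "T * (l - y)"] d T by (intro mult_left_mono) auto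
    finally have "T * norm (integral {l..u} (\<lambda>z. G z * K (T * (y - z)))) \<le> T * (d / T * pi)"
      using T by (intro mult_left_mono) auto
    then show ?thesis using T unfolding freq_cutoff_eq_kernel[OF G(1)] K_def[symmetric]
      by (simp add: norm_mult d_def mult_ac)
  next
    case False
    then show ?thesis unfolding freq_cutoff_eq_kernel[OF G(1)] using M T C by simp
  qed
  moreover have "pi * (C1 + C2) \<ge> 0" using C by simp
  ultimately show ?thesis by blast
qed

end

section \<open>Approximation by a frequency cutoff at the cost of \<open>k\<close>
  derivatives\<close>

text \<open>The derivative of sqrt is half the inverse of sqrt itself, so the induction closes
  through \<open>unif_smooth_inverse\<close>; q > 0 supplies the lower bound.\<close>

lemma unif_smooth_sqrt:
  assumes "q > 0"
  shows "unif_smooth n {q<..<Q} P (\<lambda>p z. of_real (sqrt z))"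
proof (induction n)
  case 0
  have "norm (complex_of_real (sqrt x)) \<le> sqrt Q" if "x \<in> {q<..<Q}" for x using that assms by auto
  then show ?case unfolding unif_smooth.simps by blast
next
  case (Suc n)
  have "unif_smooth n {q<..<Q} P (\<lambda>p z. 1 / 2 * inverse (of_real (sqrt z)))"
    using assms by (intro unif_smooth_cmult unif_smooth_inverse[OF Suc, of "sqrt q"]) auto
  then show ?case
  proof (rule unif_smooth_SucI[rotated 2])
    show "norm (complex_of_real (sqrt x)) \<le> sqrt Q" if "x \<in> {q<..<Q}" for x using that assms by auto
    show "((\<lambda>z. complex_of_real (sqrt z)) has_vector_derivative 1 / 2 * inverse (of_real (sqrt x))) (at x)"
      if "x \<in> {q<..<Q}" for x
    proof -
      have "(sqrt has_real_derivative inverse (sqrt x) / 2) (at x)" using that assms by (intro DERIV_real_sqrt) auto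
      then have "((\<lambda>z. complex_of_real (sqrt z)) has_vector_derivative of_real (inverse (sqrt x) / 2)) (at x)"
        by (rule has_vector_derivative_of_real)
      then show ?thesis by simp
    qed
  qed
qed

lemma unif_smooth_sum:
  fixes k :: nat
  assumes "\<And>j. j < k \<Longrightarrow> unif_smooth n S P (f j)"
  shows "unif_smooth n S P (\<lambda>p x. \<Sum>j<k. f j p x)"
  using assms
proof (induction k)
  case 0
  show ?case using unif_smooth_const[of P "\<lambda>_. 0" 0] by simp
next
  case (Suc k)
  then show ?case using unif_smooth_add[of n S P "\<lambda>p x. \<Sum>j<k. f j p x" "f k"] by simp
qed

text \<open>A real supremum bounds the values only if these are bounded above, which compact support
  guarantees.\<close>

lemma norm_nth_deriv_le_Ck_norm:
  assumes "smooth_on UNIV g" "supp g \<subseteq> {a..b}" "j \<le> k"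
  shows "norm (nth_deriv j g x) \<le> Ck_norm k g"
proof -
  have bdd: "bdd_above (range (\<lambda>x. norm (nth_deriv i g x)))" for i
  proof -
    obtain C where C: "\<forall>x\<in>{a..b}. norm (nth_deriv i g x) \<le> C"
      using smooth_on_nth_deriv_bounded[OF assms(1), of a b i] by auto
    have "norm (nth_deriv i g x) \<le> max C 0" for x
      using C nth_deriv_zero_outside[OF assms(2), of x i] by (cases "x \<in> {a..b}") (auto intro: max.coboundedI1)
    then show ?thesis by (auto intro!: bdd_aboveI[of _ "max C 0"])
  qed
  have "norm (nth_deriv j g x) \<le> (SUP x. norm (nth_deriv j g x))" by (rule cSUP_upper[OF _ bdd]) auto
  also have "\<dots> \<le> Ck_norm k g" unfolding Ck_norm_def
  proof (rule member_le_sum)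
    fix i
    show "0 \<le> (SUP x. norm (nth_deriv i g x))"
      by (rule order_trans[OF norm_ge_zero cSUP_upper[OF UNIV_I bdd]])
  qed (use assms in auto)
  finally show ?thesis .
qed

text \<open>Factor z - y as a difference of squares and use sqrt y >= sqrt (1/9). This converts a
  Taylor remainder in sqrt z - sqrt y into a power of |z - y|.\<close>

lemma abs_sqrt_diff_le:
  assumes "y \<ge> 1/5" "z \<ge> 0"
  shows "\<bar>sqrt z - sqrt y\<bar> \<le> 3 * \<bar>z - y\<bar>"
proof -
  have "sqrt y \<ge> sqrt (1/9)" using assms by (intro real_sqrt_le_mono) auto
  then have y: "sqrt y \<ge> 1/3" by (simp add: real_sqrt_divide)
  have "z - y = (sqrt z - sqrt y) * (sqrt z + sqrt y)"
    using assms by (simp add: algebra_simps)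
  then have "\<bar>z - y\<bar> = \<bar>sqrt z - sqrt y\<bar> * \<bar>sqrt z + sqrt y\<bar>" by (simp only: abs_mult)
  then have "\<bar>z - y\<bar> = \<bar>sqrt z - sqrt y\<bar> * (sqrt z + sqrt y)" using assms by simp
  also have "\<dots> \<ge> \<bar>sqrt z - sqrt y\<bar> * (1/3)" using y assms by (intro mult_left_mono) (auto intro: add_increasing)
  finally show ?thesis by simp
qed

lemma unif_smooth_mono:
  "unif_smooth n S P f \<Longrightarrow> S' \<subseteq> S \<Longrightarrow> unif_smooth n S' P f"
proof (induction n arbitrary: f)
  case 0
  then show ?case unfolding unif_smooth.simps by blast
next
  case (Suc n)
  then show ?case unfolding unif_smooth.simps by blast
qed

text \<open>Negative \<open>z\<close> is covered as well: there sqrt z is negative, hence outside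
  [1/2, 2].\<close>

lemma supp_sqrt:
  assumes "supp g \<subseteq> {1/2..2}" "z \<notin> {1/4..4}"
  shows "g (sqrt z) = 0"
proof (rule supp_zero[OF assms(1)])
  show "sqrt z \<notin> {1/2..2}"
  proof
    assume s: "sqrt z \<in> {1/2..2}"
    then have "0 \<le> sqrt z" unfolding atLeastAtMost_iff by linarith
    then have z: "z \<ge> 0" by (simp only: real_sqrt_ge_0_iff)
    from s have "(1/2)\<^sup>2 \<le> (sqrt z)\<^sup>2" "(sqrt z)\<^sup>2 \<le> 2\<^sup>2"
      using power_mono[of "1/2" "sqrt z" 2] power_mono[of "sqrt z" 2 2] z by auto
    then show False using assms(2) z by (simp add: power2_eq_square)
  qed
qed

text \<open>The error may only involve \<open>k\<close> derivatives of \<open>g\<close>. Hence \<open>g\<close> is replaced by its Taylor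
  polynomial at \<open>sqrt y\<close>, for which \<open>frequency_localization\<close> is available to any order, and the
  remainder, of size \<open>\<bar>z - y\<bar> ^ k\<close>, is left to the decay of the kernel.\<close>
lemma cutoff_approximation:
  fixes \<Phi> \<Phi>' :: "'p \<Rightarrow> real \<Rightarrow> real" and \<theta> \<Theta> :: "real \<Rightarrow> complex"
  assumes lu: "0 < q" "q < l'" "l' < l" "l < 1/4" "4 < u" "u < u'" "u' < Q"
    and \<Phi>: "\<And>p x. p \<in> P \<Longrightarrow> x \<in> {q<..<Q} \<Longrightarrow> (\<Phi> p has_real_derivative \<Phi>' p x) (at x)"
      "\<And>n. unif_smooth n {q<..<Q} P (\<lambda>p x. of_real (\<Phi>' p x))"
      "\<And>p x. p \<in> P \<Longrightarrow> x \<in> {q<..<Q} \<Longrightarrow> \<sigma> * \<Phi>' p x \<in> {c1..c2}"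
      "c1 > 0" "\<bar>\<sigma>\<bar> = 1"
    and \<theta>: "test_function \<alpha> \<beta> \<theta>"
      "\<And>s. \<sigma> * s \<in> {c1/2..2*c2} \<Longrightarrow> \<theta> s = 1"
    and \<Theta>: "test_function l u \<Theta>"
      "\<And>s. s \<in> {1/4..4} \<Longrightarrow> \<Theta> s = 1"
  shows "\<exists>C\<ge>0. \<forall>g. smooth_on UNIV g \<and> supp g \<subseteq> {1/2..2} \<longrightarrow> (\<forall>p\<in>P. \<forall>T>0. \<forall>y\<in>{1/5..5}.
      norm (2 * pi * (g (sqrt y) * cis (T * \<Phi> p y))
        - freq_cutoff \<theta> l' u' T (\<lambda>z. g (sqrt z) * cis (T * \<Phi> p z)) y) \<le> C * (1 + Ck_norm k g) / T ^ k)"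
proof -
  let ?S = "{q<..<Q}"
  \<comment> \<open>A member records the phase, the base point and normalized Taylor coefficients.
    Bounding the latter by 1 makes the polynomials one uniformly smooth family, whose constant
    cannot depend on \<open>g\<close>.\<close>
  define R where "R = {(p, y, c). p \<in> P \<and> y \<in> {1/5..(5::real)} \<and> (\<forall>j::nat. norm (c j :: complex) \<le> 1)}"
  \<comment> \<open>A polynomial in sqrt z has no compact support, so it is cut off by \<Theta>,
    which is 1 wherever g (sqrt z) can be nonzero.\<close>
  define b where "b = (\<lambda>(r :: 'p \<times> real \<times> (nat \<Rightarrow> complex)) z.
    (\<Sum>j<k. snd (snd r) j * (of_real (sqrt z) - of_real (sqrt (fst (snd r)))) ^ j) * \<Theta> z)"
  obtain M where M: "M \<ge> 0" "\<And>s. norm (\<theta> s) \<le> M" by (rule test_function_bounded[OF \<theta>(1)]) (rule that)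
  obtain M' where M': "M' \<ge> 0" "\<And>s. norm (\<Theta> s) \<le> M'" by (rule test_function_bounded[OF \<Theta>(1)]) (rule that)
  have b_smooth: "unif_smooth n ?S R b" for n
  proof -
    have "unif_smooth n ?S R (\<lambda>r. \<Theta>)"
    proof -
      have "unif_smooth n ?S (UNIV :: unit set) (\<lambda>_. \<Theta>)"
        using test_function_smooth[OF \<Theta>(1)] by (rule unif_smooth_mono) auto
      then show ?thesis by (rule unif_smooth_reindex) auto
    qed
    then show ?thesis unfolding b_def using lu
      by (intro unif_smooth_mult unif_smooth_sum unif_smooth_power unif_smooth_diff unif_smooth_sqrt
          unif_smooth_const[where B=1] unif_smooth_const[where B="sqrt 5"]) (auto simp: R_def)
  qed
  have b0: "b r z = 0" if "z \<notin> {l..u}" for r z using test_function_zero[OF \<Theta>(1) that] by (simp add: b_def case_prod_beta)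
  obtain C1 where C1: "C1 \<ge> 0" "\<And>p y c T. (p, y, c) \<in> R \<Longrightarrow> T > 0 \<Longrightarrow>
      norm (2 * pi * (b (p, y, c) y * cis (T * \<Phi> p y))
        - freq_cutoff \<theta> l' u' T (\<lambda>z. b (p, y, c) z * cis (T * \<Phi> p z)) y) \<le> C1 / T ^ k"
  \<comment> \<open>For k = 0 the polynomial is empty, and order \<open>Suc k\<close> would be too
    low for \<open>frequency_localization\<close>.\<close>
  proof (cases "k = 0")
    case True
    then have "b r z = 0" for r z by (simp add: b_def case_prod_beta)
    then have "freq_cutoff \<theta> l' u' T (\<lambda>z. b r z * cis (T * \<Phi> p z)) y = 0" for T p r y
      by (simp add: freq_cutoff_def)
    with \<open>\<And>r z. b r z = 0\<close> show ?thesis by (intro that[of 0]) auto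
  next
    case False
    \<comment> \<open>Order \<open>Suc k\<close> makes up for the lost power of T; any order is
      available for this family.\<close>
    have "\<exists>C\<ge>0. \<forall>r\<in>R. \<forall>T>0. \<forall>y. norm (2 * pi * (b r y * cis (T * \<Phi> (fst r) y))
      - freq_cutoff \<theta> l' u' T (\<lambda>z. b r z * cis (T * \<Phi> (fst r) z)) y) \<le> C / T ^ (Suc k - 1)"
    proof (rule frequency_localization[where \<Phi>="\<lambda>r. \<Phi> (fst r)" and \<Phi>'="\<lambda>r. \<Phi>' (fst r)"
          and q=q and Q=Q and l=l and u=u and \<sigma>=\<sigma> and ?c1.0=c1 and ?c2.0=c2 and M=M])
      show "unif_smooth n ?S R (\<lambda>r x. of_real (\<Phi>' (fst r) x))" for n
        by (rule unif_smooth_reindex[OF \<Phi>(2)]) (auto simp: R_def)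
      show "unif_smooth (Suc k) ?S R b" by (rule b_smooth)
      show "\<theta> \<in> borel_measurable borel"
        by (rule borel_measurable_continuous_onI[OF test_function_continuous[OF \<theta>(1)]])
    qed (use lu \<Phi> \<theta>(2) M b0 False in \<open>auto simp: R_def\<close>)
    then show ?thesis using that by force
  qed
  obtain C2 where C2: "C2 \<ge> 0" "\<And>G T y M. T > 0 \<Longrightarrow> M \<ge> 0 \<Longrightarrow> continuous_on {l'..u'} G \<Longrightarrow>
      (\<And>z. z \<in> {l'..u'} \<Longrightarrow> norm (G z) \<le> M * \<bar>z - y\<bar> ^ k) \<Longrightarrow> norm (freq_cutoff \<theta> l' u' T G y) \<le> C2 * M / T ^ k"
    using freq_cutoff_bound[OF \<theta>(1), of k] by blast
  define C where "C = C1 + 2 * pi * M' + C2 * (M' * 3 ^ k)"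
  have "norm (2 * pi * (g (sqrt y) * cis (T * \<Phi> p y))
        - freq_cutoff \<theta> l' u' T (\<lambda>z. g (sqrt z) * cis (T * \<Phi> p z)) y) \<le> C * (1 + Ck_norm k g) / T ^ k"
    if g: "smooth_on UNIV g" "supp g \<subseteq> {1/2..2}" and p: "p \<in> P" and T: "T > 0" and y: "y \<in> {1/5..5}" for g p T y
  proof -
    define N where "N = Ck_norm k g"
    have N: "norm (nth_deriv j g x) \<le> N" if "j \<le> k" for j x
      unfolding N_def by (rule norm_nth_deriv_le_Ck_norm[OF g that])
    have N0: "N \<ge> 0" using N[of 0] norm_ge_zero order_trans by blast
    \<comment> \<open>Dividing by 1 + N instead of N rules out division by zero; this is the origin
      of the factor 1 + \<open>Ck_norm k g\<close>.\<close>
    define c where "c j = (if j < k then nth_deriv j g (sqrt y) / (fact j * (1 + of_real N)) else 0)" for j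
    have N1: "norm (1 + complex_of_real N) = 1 + N"
      using N0 by (metis abs_of_nonneg add_nonneg_nonneg norm_of_real of_real_1 of_real_add zero_le_one)
    have c1: "norm (c j) \<le> 1" for j
    proof (cases "j < k")
      case True
      have "norm (nth_deriv j g (sqrt y)) \<le> 1 * (1 + N)" using N[of j "sqrt y"] True by simp
      also have "\<dots> \<le> fact j * (1 + N)" using N0 by (intro mult_right_mono) auto
      finally show ?thesis using N0 True by (simp add: c_def norm_divide norm_mult N1 divide_le_eq)
    qed (simp add: c_def)
    have r: "(p, y, c) \<in> R" using p y c1 by (simp add: R_def)
    let ?b = "b (p, y, c)"
    define Tay where "Tay z = (\<Sum>j<k. nth_deriv j g (sqrt y) * of_real ((sqrt z - sqrt y) ^ j / fact j))" for z
    define E where "E z = \<Theta> z * (g (sqrt z) - Tay z)" for z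
    have bT: "(1 + of_real N) * ?b z = \<Theta> z * Tay z" for z
    proof -
      have cancel: "n * (d / (f * n) * X) = d * (X / f)" if "n \<noteq> 0" for n d f X :: complex
        using that by simp
      have "(1 + complex_of_real N) \<noteq> 0" using N1 N0 by (metis add_nonneg_pos norm_zero less_irrefl add.commute zero_less_one)
      then have "(1 + of_real N) * (c j * (of_real (sqrt z) - of_real (sqrt y)) ^ j) =
          nth_deriv j g (sqrt y) * of_real ((sqrt z - sqrt y) ^ j / fact j)" if "j < k" for j
        using cancel[of "1 + of_real N" "nth_deriv j g (sqrt y)" "fact j"] that by (simp add: c_def)
      then have "(1 + of_real N) * (\<Sum>j<k. c j * (of_real (sqrt z) - of_real (sqrt y)) ^ j) = Tay z"
        unfolding Tay_def sum_distrib_left by (intro sum.cong) auto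
      then show ?thesis by (simp add: b_def mult_ac)
    qed
    have g\<Theta>: "g (sqrt z) = \<Theta> z * g (sqrt z)" if "z > 0" for z
    proof (cases "z \<in> {1/4..4}")
      case False
      then show ?thesis using supp_sqrt[OF g(2)] by simp
    qed (simp add: \<Theta>(2))
    have dec: "g (sqrt z) = (1 + of_real N) * ?b z + E z" if "z > 0" for z
      using g\<Theta>[OF that] unfolding bT E_def by (simp add: algebra_simps)
    have Eb: "norm (E z) \<le> (M' * N * 3 ^ k) * \<bar>z - y\<bar> ^ k" if "z > 0" for z
    proof -
      have "norm (g (sqrt z) - Tay z) \<le> N * \<bar>sqrt z - sqrt y\<bar> ^ k"
        unfolding Tay_def using taylor_bound[of "\<lambda>j. nth_deriv j g" k N "sqrt z" "sqrt y"] smooth_on_nth_deriv[OF g(1)] N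
        by simp
      also have "\<dots> \<le> N * (3 * \<bar>z - y\<bar>) ^ k"
        using abs_sqrt_diff_le[of y z] y that N0 by (intro mult_left_mono power_mono) auto
      finally have "norm (g (sqrt z) - Tay z) \<le> N * (3 * \<bar>z - y\<bar>) ^ k" .
      then have "norm (\<Theta> z) * norm (g (sqrt z) - Tay z) \<le> M' * (N * (3 * \<bar>z - y\<bar>) ^ k)"
        by (intro mult_mono M') auto
      then show ?thesis by (simp add: E_def norm_mult power_mult_distrib mult_ac)
    qed
    have sub: "{l'..u'} \<subseteq> ?S" using lu by auto
    have cc: "continuous_on {l'..u'} (\<lambda>z. cis (T * \<Phi> p z))"
      using sub by (intro continuous_intros continuous_on_subset[OF _ sub] DERIV_continuous_on[OF has_field_derivative_at_within[OF \<Phi>(1)[OF p]]])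
    have cb: "continuous_on {l'..u'} (\<lambda>z. ?b z * cis (T * \<Phi> p z))"
      by (intro continuous_intros cc continuous_on_subset[OF unif_smooth_continuous[OF b_smooth r] sub])
    have cg: "continuous_on UNIV g"
      using smooth_on_nth_deriv[OF g(1), of _ 0] by (auto intro: continuous_on_vector_derivative)
    have cE: "continuous_on {l'..u'} (\<lambda>z. E z * cis (T * \<Phi> p z))"
    proof -
      have "continuous_on {l'..u'} (\<lambda>z. (g (sqrt z) - (1 + of_real N) * ?b z) * cis (T * \<Phi> p z))"
        by (intro continuous_intros cc continuous_on_subset[OF unif_smooth_continuous[OF b_smooth r] sub] continuous_on_compose2[OF cg]) auto
      then show ?thesis
        by (rule continuous_on_eq) (use dec lu in auto)
    qed
    have y0: "y > 0" using y by auto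
    have "freq_cutoff \<theta> l' u' T (\<lambda>z. g (sqrt z) * cis (T * \<Phi> p z)) y =
       freq_cutoff \<theta> l' u' T (\<lambda>z. (1 + of_real N) * (?b z * cis (T * \<Phi> p z)) + E z * cis (T * \<Phi> p z)) y"
    proof -
      have "integral {l'..u'} (\<lambda>z. g (sqrt z) * cis (T * \<Phi> p z) * cis (- (T * s * z))) =
        integral {l'..u'} (\<lambda>z. ((1 + of_real N) * (?b z * cis (T * \<Phi> p z)) + E z * cis (T * \<Phi> p z)) * cis (- (T * s * z)))" for s
        by (rule integral_cong) (use lu dec in \<open>auto simp: algebra_simps\<close>)
      then show ?thesis by (simp only: freq_cutoff_def)
    qed
    also have "\<dots> = (1 + of_real N) * freq_cutoff \<theta> l' u' T (\<lambda>z. ?b z * cis (T * \<Phi> p z)) y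
        + freq_cutoff \<theta> l' u' T (\<lambda>z. E z * cis (T * \<Phi> p z)) y"
      by (rule freq_cutoff_linear[OF \<theta>(1) cb cE])
    finally have eq: "2 * pi * (g (sqrt y) * cis (T * \<Phi> p y)) - freq_cutoff \<theta> l' u' T (\<lambda>z. g (sqrt z) * cis (T * \<Phi> p z)) y =
       (1 + of_real N) * (2 * pi * (?b y * cis (T * \<Phi> p y)) - freq_cutoff \<theta> l' u' T (\<lambda>z. ?b z * cis (T * \<Phi> p z)) y)
       + (2 * pi * E y * cis (T * \<Phi> p y) - freq_cutoff \<theta> l' u' T (\<lambda>z. E z * cis (T * \<Phi> p z)) y)"
      unfolding dec[OF y0] by (simp add: algebra_simps)
    have "norm (2 * pi * (g (sqrt y) * cis (T * \<Phi> p y)) - freq_cutoff \<theta> l' u' T (\<lambda>z. g (sqrt z) * cis (T * \<Phi> p z)) y) \<le>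
       norm (1 + complex_of_real N) * norm (2 * pi * (?b y * cis (T * \<Phi> p y)) - freq_cutoff \<theta> l' u' T (\<lambda>z. ?b z * cis (T * \<Phi> p z)) y)
       + (norm (2 * pi * E y * cis (T * \<Phi> p y)) + norm (freq_cutoff \<theta> l' u' T (\<lambda>z. E z * cis (T * \<Phi> p z)) y))"
      unfolding eq norm_mult[symmetric] by (rule order_trans[OF norm_triangle_ineq add_left_mono[OF norm_triangle_ineq4]])
    also have "\<dots> \<le> (1 + N) * (C1 / T ^ k) + (2 * pi * (M' * N / T ^ k) + C2 * (M' * N * 3 ^ k) / T ^ k)"
    proof -
      have 1: "norm (freq_cutoff \<theta> l' u' T (\<lambda>z. E z * cis (T * \<Phi> p z)) y) \<le> C2 * (M' * N * 3 ^ k) / T ^ k"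
      proof (rule C2(2)[OF T _ cE])
        show "norm (E z * cis (T * \<Phi> p z)) \<le> M' * N * 3 ^ k * \<bar>z - y\<bar> ^ k" if "z \<in> {l'..u'}" for z
          using Eb[of z] that lu by (simp add: norm_mult)
      qed (use M' N0 in simp)
      \<comment> \<open>The remainder vanishes at the base point unless k = 0, in which case T^k =
        1; the power 0^k covers both.\<close>
      have "norm (E y) \<le> M' * N * 3 ^ k * 0 ^ k" using Eb[OF y0] by simp
      also have "\<dots> \<le> M' * N / T ^ k" using M' N0 T by (cases k) auto
      finally have "2 * pi * norm (E y) \<le> 2 * pi * (M' * N / T ^ k)" by (rule mult_left_mono) simp
      then have 2: "norm (2 * pi * E y * cis (T * \<Phi> p y)) \<le> 2 * pi * (M' * N / T ^ k)"
        by (simp only: norm_mult norm_cis norm_of_real abs_of_nonneg pi_ge_zero mult_1_right) simp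
      show ?thesis unfolding N1
        by (intro add_mono[OF mult_left_mono add_mono[OF 2 1]] C1(2)[OF r T]) (use N0 in simp)
    qed
    also have "\<dots> = (C1 * (1 + N) + 2 * pi * M' * N + C2 * (M' * 3 ^ k) * N) / T ^ k"
      by (simp add: add_divide_distrib mult_ac)
    also have "\<dots> \<le> (C1 * (1 + N) + 2 * pi * M' * (1 + N) + C2 * (M' * 3 ^ k) * (1 + N)) / T ^ k"
      using C1 C2 M' T N0 by (intro divide_right_mono add_mono mult_left_mono) auto
    also have "\<dots> = C * (1 + N) / T ^ k" by (simp add: C_def algebra_simps)
    finally show ?thesis by (simp add: N_def)
  qed
  moreover have "C \<ge> 0" using C1 C2 M' by (simp add: C_def)
  ultimately show ?thesis by blast
qed

section \<open>The scaled phase\<close>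

text \<open>After division by r^\<beta>, a continuous nonvanishing function has a positive minimum
  on [r1, 1]. Reaching below \<open>r0\<close> is what yields an open neighbourhood of [1/4, 4] in
  the scaled variable.\<close>

lemma lower_bound_extends:
  fixes f :: "real \<Rightarrow> real"
  assumes f: "continuous_on {0<..} f" and "c > 0" "\<And>r. r \<ge> 1 \<Longrightarrow> c * r powr \<beta> \<le> \<bar>f r\<bar>"
    and "0 < r0" "r0 \<le> 1" "\<And>r. r \<in> {r0..1} \<Longrightarrow> f r \<noteq> 0"
  obtains r1 c' where "0 < r1" "r1 < r0" "c' > 0" "\<And>r. r \<ge> r1 \<Longrightarrow> c' * r powr \<beta> \<le> \<bar>f r\<bar>"
proof -
  have "open {r \<in> {0<..}. f r \<noteq> 0}"
    using continuous_open_preimage[OF f open_greaterThan, of "- {0}"] by (simp add: vimage_def Int_def open_Compl)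
  moreover have "r0 \<in> {r \<in> {0<..}. f r \<noteq> 0}" using assms by auto
  ultimately obtain d where d: "d > 0" "ball r0 d \<subseteq> {r \<in> {0<..}. f r \<noteq> 0}" using openE by blast
  define r1 where "r1 = r0 - min (d / 2) (r0 / 2)"
  have r1: "0 < r1" "r1 < r0" using d(1) assms(4) by (auto simp: r1_def min_def)
  have nz: "f r \<noteq> 0" if "r \<in> {r1..1}" for r
  proof (cases "r < r0")
    case True
    then have "r \<in> ball r0 d" using that d(1) by (auto simp: dist_real_def r1_def)
    then show ?thesis using d(2) by auto
  qed (use assms(6) that in auto)
  define h where "h r = \<bar>f r\<bar> / r powr \<beta>" for r
  have "continuous_on {r1..1} h" unfolding h_def
    using r1 by (intro continuous_intros continuous_on_subset[OF f]) auto
  then obtain x where x: "x \<in> {r1..1}" "\<And>r. r \<in> {r1..1} \<Longrightarrow> h x \<le> h r"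
    using continuous_attains_inf[of "{r1..1}" h] r1 assms(5) by auto
  have "h x > 0" using nz[OF x(1)] x(1) r1 by (simp add: h_def)
  define c' where "c' = min c (h x)"
  have "c' * r powr \<beta> \<le> \<bar>f r\<bar>" if "r \<ge> r1" for r
  proof (cases "r \<ge> 1")
    case True
    have "c' * r powr \<beta> \<le> c * r powr \<beta>" by (intro mult_right_mono) (auto simp: c'_def)
    also have "\<dots> \<le> \<bar>f r\<bar>" by (rule assms(3)[OF True])
    finally show ?thesis .
  next
    case False
    have "c' \<le> h r" using x(2)[of r] that False by (simp add: c'_def)
    then show ?thesis using that r1 by (simp add: h_def pos_le_divide_eq)
  qed
  moreover have "c' > 0" using assms(2) \<open>h x > 0\<close> by (simp add: c'_def)
  ultimately show ?thesis using that r1 by blast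
qed

lemma upper_bound_extends:
  fixes f :: "real \<Rightarrow> real"
  assumes f: "continuous_on {0<..} f" and "\<And>r. r \<ge> 1 \<Longrightarrow> \<bar>f r\<bar> \<le> C * r powr \<beta>" and "0 < r1"
  obtains C' where "C' > 0" "\<And>r. r \<ge> r1 \<Longrightarrow> \<bar>f r\<bar> \<le> C' * r powr \<beta>"
proof -
  define h where "h r = \<bar>f r\<bar> / r powr \<beta>" for r
  have "continuous_on {r1..1} h" unfolding h_def
    using assms(3) by (intro continuous_intros continuous_on_subset[OF f]) auto
  then have "bounded (h ` {r1..1})" by (intro compact_imp_bounded compact_continuous_image) auto
  then obtain K where K: "\<And>r. r \<in> {r1..1} \<Longrightarrow> \<bar>h r\<bar> \<le> K" unfolding bounded_iff by (metis imageI real_norm_def)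
  define C' where "C' = max 1 (max C K)"
  have "\<bar>f r\<bar> \<le> C' * r powr \<beta>" if "r \<ge> r1" for r
  proof (cases "r \<ge> 1")
    case True
    have "\<bar>f r\<bar> \<le> C * r powr \<beta>" by (rule assms(2)[OF True])
    also have "\<dots> \<le> C' * r powr \<beta>" by (intro mult_right_mono) (auto simp: C'_def)
    finally show ?thesis .
  next
    case False
    have "h r \<le> C'" using K[of r] that False by (simp add: C'_def)
    then show ?thesis using that assms(3) by (simp add: h_def pos_divide_le_eq)
  qed
  moreover have "C' > 0" by (simp add: C'_def)
  ultimately show ?thesis using that by blast
qed

text \<open>By the intermediate value theorem. The hypotheses on \<phi> control absolute values
  only, so a constant sign has to come from nonvanishing.\<close>

lemma sgn_eq_of_nonzero:
  fixes f :: "real \<Rightarrow> real"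
  assumes f: "continuous_on {r1..} f" and nz: "\<And>r. r \<ge> r1 \<Longrightarrow> f r \<noteq> 0" and "x \<ge> r1" "y \<ge> r1"
  shows "sgn (f x) = sgn (f y)"
proof (rule ccontr)
  assume "sgn (f x) \<noteq> sgn (f y)"
  then have "f x < 0 \<and> 0 < f y \<or> f y < 0 \<and> 0 < f x"
    using nz[OF assms(3)] nz[OF assms(4)] by (auto simp: sgn_if split: if_splits)
  moreover have "connected (f ` {r1..})" by (intro connected_continuous_image f) auto
  ultimately have "0 \<in> f ` {r1..}"
    using assms(3,4) connectedD_interval[of "f ` {r1..}" "f x" "f y" 0] connectedD_interval[of "f ` {r1..}" "f y" "f x" 0] by auto
  then show False using nz by auto
qed

text \<open>In the variable \<open>z = x / lam\<^sup>2\<close> the phase \<open>t \<phi> x\<close> becomes \<open>t lam powr (2 m) * scaled_phase m \<phi> lam z\<close>,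
  with bounds on the derivatives of \<open>scaled_phase\<close> that do not depend on \<open>lam\<close>.\<close>
definition scaled_phase :: "real \<Rightarrow> (real \<Rightarrow> real) \<Rightarrow> real \<Rightarrow> real \<Rightarrow> real" where
  "scaled_phase m \<phi> lam z = lam powr (- 2 * m) * \<phi> (lam\<^sup>2 * z)"

text \<open>By the chain rule, the j-th derivative of \<open>scaled_phase\<close> in
  \<open>z\<close>. The exponent \<open>m\<close> is a free parameter, later also taken from the
  bound on the second derivative of \<phi>.\<close>

definition scaled_phase_deriv :: "real \<Rightarrow> (real \<Rightarrow> real) \<Rightarrow> nat \<Rightarrow> real \<Rightarrow> real \<Rightarrow> real" where
  "scaled_phase_deriv m \<phi> j lam z = lam powr (2 * real j - 2 * m) * nth_deriv j \<phi> (lam\<^sup>2 * z)"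

lemma scaled_phase_eq: "scaled_phase m \<phi> = scaled_phase_deriv m \<phi> 0"
  by (simp add: scaled_phase_def scaled_phase_deriv_def fun_eq_iff)

lemma square_mult_powr:
  fixes lam :: real
  assumes "lam > 0" "z > 0"
  shows "(lam\<^sup>2 * z) powr e = lam powr (2 * e) * z powr e"
proof -
  have "lam\<^sup>2 = lam powr 2" using assms by (simp add: powr_numeral)
  then have "(lam\<^sup>2) powr e = lam powr (2 * e)" using assms by (simp only: powr_powr)
  then show ?thesis using assms by (subst powr_mult) auto
qed

lemma scaled_phase_deriv_has_derivative:
  assumes "smooth_on {0<..} \<phi>" "lam > 0" "z > 0"
  shows "(scaled_phase_deriv m \<phi> j lam has_real_derivative scaled_phase_deriv m \<phi> (Suc j) lam z) (at z)"
proof -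
  have "(nth_deriv j \<phi> has_real_derivative nth_deriv (Suc j) \<phi> (lam\<^sup>2 * z)) (at (lam\<^sup>2 * z))"
    using smooth_on_nth_deriv[OF assms(1), of "lam\<^sup>2 * z" j] assms by (simp add: has_real_derivative_iff_has_vector_derivative)
  then have "((\<lambda>z. nth_deriv j \<phi> (lam\<^sup>2 * z)) has_real_derivative nth_deriv (Suc j) \<phi> (lam\<^sup>2 * z) * lam\<^sup>2) (at z)"
    by (rule DERIV_chain2) (auto intro!: derivative_eq_intros)
  from DERIV_cmult[OF this, of "lam powr (2 * real j - 2 * m)"]
  have "((\<lambda>z. lam powr (2 * real j - 2 * m) * nth_deriv j \<phi> (lam\<^sup>2 * z)) has_real_derivative
     (lam powr (2 * real j - 2 * m) * lam\<^sup>2) * nth_deriv (Suc j) \<phi> (lam\<^sup>2 * z)) (at z)" by (simp add: mult_ac)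
  moreover have "lam powr (2 * real j - 2 * m) * lam\<^sup>2 = lam powr (2 * real (Suc j) - 2 * m)"
  proof -
    have "lam\<^sup>2 = lam powr 2" using assms by (simp add: powr_numeral)
    then have "lam powr (2 * real j - 2 * m) * lam\<^sup>2 = lam powr (2 * real j - 2 * m + 2)" by (simp only: powr_add)
    then show ?thesis by (simp add: algebra_simps)
  qed
  ultimately show ?thesis by (simp only: scaled_phase_deriv_def[abs_def])
qed

text \<open>The powers of \<open>lam\<close> are absorbed exactly by r^(m - j) at r = lam^2 z. What
  remains is a ratio that the hypotheses bound and a power of \<open>z\<close>, so
  \<open>lam\<close> disappears from the estimates.\<close>

lemma abs_scaled_phase_deriv:
  assumes "lam > 0" "z > 0"
  shows "\<bar>scaled_phase_deriv m \<phi> j lam z\<bar> = \<bar>nth_deriv j \<phi> (lam\<^sup>2 * z)\<bar> / (lam\<^sup>2 * z) powr (m - real j) * z powr (m - real j)"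
proof -
  have e: "lam powr (2 * real j - 2 * m) = 1 / lam powr (2 * (m - real j))"
    by (simp add: powr_minus_divide[symmetric] algebra_simps)
  show ?thesis using assms unfolding square_mult_powr[OF assms] scaled_phase_deriv_def e by (simp add: abs_mult)
qed

text \<open>The power is monotone in a direction given by the sign of \<open>e\<close>; sum and
  minimum of the endpoint values cover both directions.\<close>

lemma powr_le_endpoints:
  fixes z :: real
  assumes "0 < q" "z \<in> {q..Q}"
  shows "z powr e \<le> q powr e + Q powr e" "min (q powr e) (Q powr e) \<le> z powr e"
proof -
  have "z powr e \<le> Q powr e \<and> q powr e \<le> z powr e" if "e \<ge> 0"
    using assms that by (auto intro!: powr_mono2)
  moreover have "z powr e \<le> q powr e \<and> Q powr e \<le> z powr e" if "e \<le> 0"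
    using assms that by (auto intro!: powr_mono2')
  moreover have "q powr e \<ge> 0" "Q powr e \<ge> 0" by simp_all
  ultimately show "z powr e \<le> q powr e + Q powr e" "min (q powr e) (Q powr e) \<le> z powr e"
    by (meson add_increasing add_increasing2 linear min.coboundedI1 min.coboundedI2)+
qed

lemma scaled_phase_deriv_bounds:
  assumes "lam \<ge> L" "L > 0" "0 < q" "z \<in> {q..Q}"
  shows "(\<And>r. r \<ge> L\<^sup>2 * q \<Longrightarrow> \<bar>nth_deriv j \<phi> r\<bar> \<le> C * r powr (m - real j)) \<Longrightarrow> C \<ge> 0 \<Longrightarrow>
      \<bar>scaled_phase_deriv m \<phi> j lam z\<bar> \<le> C * (q powr (m - real j) + Q powr (m - real j))"
    and "(\<And>r. r \<ge> L\<^sup>2 * q \<Longrightarrow> c * r powr (m - real j) \<le> \<bar>nth_deriv j \<phi> r\<bar>) \<Longrightarrow> c \<ge> 0 \<Longrightarrow>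
      c * min (q powr (m - real j)) (Q powr (m - real j)) \<le> \<bar>scaled_phase_deriv m \<phi> j lam z\<bar>"
proof -
  have "L\<^sup>2 \<le> lam\<^sup>2" using assms by (intro power_mono) auto
  then have r: "lam\<^sup>2 * z \<ge> L\<^sup>2 * q" using assms by (intro mult_mono) auto
  have pos: "(lam\<^sup>2 * z) powr (m - real j) > 0" using assms by simp
  have eq: "\<bar>scaled_phase_deriv m \<phi> j lam z\<bar> = \<bar>nth_deriv j \<phi> (lam\<^sup>2 * z)\<bar> / (lam\<^sup>2 * z) powr (m - real j) * z powr (m - real j)"
    by (rule abs_scaled_phase_deriv) (use assms in auto)
  note p = powr_le_endpoints[OF assms(3,4), of "m - real j"]
  show "\<bar>scaled_phase_deriv m \<phi> j lam z\<bar> \<le> C * (q powr (m - real j) + Q powr (m - real j))"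
    if "\<And>r. r \<ge> L\<^sup>2 * q \<Longrightarrow> \<bar>nth_deriv j \<phi> r\<bar> \<le> C * r powr (m - real j)" "C \<ge> 0"
    unfolding eq
  proof (intro mult_mono p(1))
    show "\<bar>nth_deriv j \<phi> (lam\<^sup>2 * z)\<bar> / (lam\<^sup>2 * z) powr (m - real j) \<le> C"
      using that(1)[OF r] pos by (simp only: pos_divide_le_eq)
  qed (use that in auto)
  show "c * min (q powr (m - real j)) (Q powr (m - real j)) \<le> \<bar>scaled_phase_deriv m \<phi> j lam z\<bar>"
    if "\<And>r. r \<ge> L\<^sup>2 * q \<Longrightarrow> c * r powr (m - real j) \<le> \<bar>nth_deriv j \<phi> r\<bar>" "c \<ge> 0"
    unfolding eq
  proof (intro mult_mono p(2))
    show "c \<le> \<bar>nth_deriv j \<phi> (lam\<^sup>2 * z)\<bar> / (lam\<^sup>2 * z) powr (m - real j)"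
      using that(1)[OF r] pos by (simp only: pos_le_divide_eq)
  qed (use that in auto)
qed

lemma unif_smooth_scaled_phase_deriv:
  assumes "smooth_on {0<..} \<phi>" "L > 0" "0 < q"
    and bnd: "\<And>j. j \<ge> 1 \<Longrightarrow> \<exists>C\<ge>0. \<forall>r\<ge>L\<^sup>2 * q. \<bar>nth_deriv j \<phi> r\<bar> \<le> C * r powr (m - real j)"
  shows "unif_smooth n {q<..<Q} {L..} (\<lambda>lam z. of_real (scaled_phase_deriv m \<phi> 1 lam z))"
proof -
  have "unif_smooth n {q<..<Q} {L..} (\<lambda>lam z. complex_of_real (scaled_phase_deriv m \<phi> (Suc 0) lam z))"
  proof (rule unif_smooth_derivs[where F="\<lambda>j lam z. complex_of_real (scaled_phase_deriv m \<phi> (Suc j) lam z)"])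
    fix j lam z assume "lam \<in> {L..}" "z \<in> {q<..<Q}"
    then show "((\<lambda>z. complex_of_real (scaled_phase_deriv m \<phi> (Suc j) lam z)) has_vector_derivative
       complex_of_real (scaled_phase_deriv m \<phi> (Suc (Suc j)) lam z)) (at z)"
      using assms by (intro has_vector_derivative_of_real scaled_phase_deriv_has_derivative) auto
  next
    fix j
    obtain C where C: "C \<ge> 0" "\<And>r. r \<ge> L\<^sup>2 * q \<Longrightarrow> \<bar>nth_deriv (Suc j) \<phi> r\<bar> \<le> C * r powr (m - real (Suc j))"
      using bnd[of "Suc j"] by auto
    have "norm (complex_of_real (scaled_phase_deriv m \<phi> (Suc j) lam z)) \<le> C * (q powr (m - real (Suc j)) + Q powr (m - real (Suc j)))"
      if "lam \<in> {L..}" "z \<in> {q<..<Q}" for lam z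
      using scaled_phase_deriv_bounds(1)[OF _ assms(2,3) _ C(2) C(1), of lam z Q] that by simp
    then show "\<exists>C. \<forall>lam\<in>{L..}. \<forall>z\<in>{q<..<Q}. norm (complex_of_real (scaled_phase_deriv m \<phi> (Suc j) lam z)) \<le> C" by blast
  qed
  then show ?thesis by simp
qed

section \<open>The decomposition\<close>

text \<open>The set where a continuous function is nonzero is open, hence inside the interior of the
  interval.\<close>

lemma supp_endpoints_zero:
  fixes g :: "real \<Rightarrow> complex"
  assumes "continuous_on UNIV g" "supp g \<subseteq> {a..b}"
  shows "g a = 0" "g b = 0"
proof -
  have "open {x. g x \<noteq> 0}" by (intro open_Collect_neq assms continuous_intros)
  moreover have "{x. g x \<noteq> 0} \<subseteq> {a..b}" using assms(2) closure_subset[of "{x. g x \<noteq> 0}"] by (auto simp: supp_def)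
  ultimately have "{x. g x \<noteq> 0} \<subseteq> {a<..<b}" using interior_maximal by (metis interior_atLeastAtMost_real)
  then show "g a = 0" "g b = 0" by auto
qed

lemma smooth_on_UNIV_continuous: "smooth_on UNIV g \<Longrightarrow> continuous_on UNIV g"
  using smooth_on_nth_deriv[of UNIV g _ 0] by (auto intro: continuous_on_vector_derivative)

lemma integral_support_subset:
  fixes f :: "real \<Rightarrow> complex"
  assumes "\<And>x. x \<notin> A \<Longrightarrow> f x = 0" "A \<subseteq> B"
  shows "integral B f = integral A f"
proof -
  have "(\<lambda>x. if x \<in> B then f x else 0) = (\<lambda>x. if x \<in> A then f x else 0)"
    using assms by (intro ext) (metis subsetD)
  then show ?thesis using integral_restrict_UNIV[of B f] integral_restrict_UNIV[of A f] by simp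
qed

lemma freq_cutoff_support_subset:
  assumes "\<And>z. z \<notin> {l..u} \<Longrightarrow> G z = 0" "{l..u} \<subseteq> {l'..u'}"
  shows "freq_cutoff \<theta> l' u' T G y = freq_cutoff \<theta> l u T G y"
proof -
  have "integral {l'..u'} (\<lambda>z. G z * cis (- (T * s * z))) = integral {l..u} (\<lambda>z. G z * cis (- (T * s * z)))" for s
    by (rule integral_support_subset) (use assms in auto)
  then show ?thesis by (simp only: freq_cutoff_def)
qed

lemma scaled_phase_continuous:
  assumes "smooth_on {0<..} \<phi>" "lam > 0"
  shows "continuous_on {0<..} (scaled_phase m \<phi> lam)"
  unfolding scaled_phase_eq
  by (rule DERIV_continuous_on[OF has_field_derivative_at_within[OF scaled_phase_deriv_has_derivative[OF assms]]]) simp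

text \<open>\<open>freq_cutoff\<close> carries the factor T = t lam^(2 m). Writing T = A W leaves
  \<open>A\<close> in front and moves \<open>W\<close> into \<open>a\<close>, so decay of the
  amplitude integral can be spent on a smaller prefactor. As \<rho> is defined to be the difference,
  the identity is immediate and the work lies in the bounds.\<close>

lemma oscillatory_decompositionI:
  fixes \<phi> :: "real \<Rightarrow> real" and \<eta> g \<theta> :: "_ \<Rightarrow> complex"
  assumes g: "smooth_on UNIV g" "supp g \<subseteq> {1/2..2}"
    and \<eta>: "supp \<eta> \<subseteq> {1/5..5}" "\<And>x. x \<in> {1/4..4} \<Longrightarrow> \<eta> x = 1" "\<And>x. norm (\<eta> x) \<le> H"
    and \<theta>: "test_function \<alpha> \<beta> \<theta>" "\<And>s. norm (\<theta> s) \<le> M" "c0 > 1"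
      "\<And>s. \<theta> s \<noteq> 0 \<Longrightarrow> sgn (nth_deriv 1 \<phi> 1) * s \<in> {2 / c0..2 * c0}" "\<bar>sgn (nth_deriv 1 \<phi> 1)\<bar> = 1"
    and \<Lambda>: "\<Lambda> > 0" and \<phi>: "smooth_on {0<..} \<phi>"
    and approx: "\<And>k lam T y. lam \<ge> \<Lambda> \<Longrightarrow> T > 0 \<Longrightarrow> y \<in> {1/5..5} \<Longrightarrow>
      norm (2 * pi * (g (sqrt y) * cis (T * scaled_phase m \<phi> lam y))
        - freq_cutoff \<theta> (1/4) 4 T (\<lambda>z. g (sqrt z) * cis (T * scaled_phase m \<phi> lam z)) y) \<le> B k / T ^ k"
    and W: "\<And>t lam. t > 0 \<Longrightarrow> lam \<ge> \<Lambda> \<Longrightarrow> A t lam * W t lam = t * lam powr (2 * m)"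
      "\<And>t lam. t > 0 \<Longrightarrow> lam \<ge> \<Lambda> \<Longrightarrow> W t lam \<ge> 0"
      "\<And>t lam s. t > 0 \<Longrightarrow> lam \<ge> \<Lambda> \<Longrightarrow>
        norm (integral {1/4..4} (\<lambda>z. g (sqrt z) * cis (t * lam powr (2 * m) * scaled_phase m \<phi> lam z)
          * cis (- (t * lam powr (2 * m) * s * z)))) * W t lam \<le> K"
  shows "oscillatory_decomposition m \<phi> \<eta> A \<Lambda> (\<lambda>k. H * B k) (M * K) g"
proof -
  define \<sigma> where "\<sigma> = sgn (nth_deriv 1 \<phi> 1)"
  define I where "I t lam s = integral {1/4..4} (\<lambda>z. g (sqrt z) * cis (t * lam powr (2 * m) * scaled_phase m \<phi> lam z)
          * cis (- (t * lam powr (2 * m) * s * z)))" for t lam s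
  \<comment> \<open>The 2 pi is the normalization of Fourier inversion.\<close>
  define a where "a t s lam = \<theta> s / (2 * pi) * of_real (W t lam) * I t lam s" for t s lam
  define Osc where "Osc t x lam = complex_of_real (A t lam) * \<eta> (x / lam\<^sup>2) *
            (LINT s|lborel. exp (\<i> * complex_of_real (x * t * lam powr (2 * m - 2) * s)) * a t s lam)" for t x lam
  define \<rho> where "\<rho> t x lam = g (sqrt x / lam) * exp (\<i> * complex_of_real (t * \<phi> x)) - Osc t x lam" for t x lam
  have H: "H \<ge> 0" using \<eta>(3)[of 0] norm_ge_zero order_trans by blast
  have M: "M \<ge> 0" using \<theta>(2)[of 0] norm_ge_zero order_trans by blast
  have gc: "continuous_on UNIV g" by (rule smooth_on_UNIV_continuous[OF g(1)])
  have \<sigma>2: "\<sigma> * \<sigma> = 1" using \<theta>(5) unfolding \<sigma>_def by (metis abs_mult_self_eq mult_1)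
  \<comment> \<open>Any admissible \<open>lam\<close>, \<open>T\<close> and \<open>y\<close> will
    do; the sign matters where \<rho> is zero.\<close>
  have B0: "B k \<ge> 0" for k
    using order_trans[OF norm_ge_zero approx[of \<Lambda> 1 1 k]] by simp
  show ?thesis
    unfolding oscillatory_decomposition_def
  proof (rule exI[of _ c0], rule conjI, rule \<theta>(3), rule exI[of _ \<rho>], rule exI[of _ a], intro conjI allI impI)
    fix t lam :: real assume t: "t > 0" and lam: "lam \<ge> \<Lambda>"
    then have lam0: "lam > 0" using \<Lambda> by simp
    define T where "T = t * lam powr (2 * m)"
    have T: "T > 0" using t lam0 by (simp add: T_def)
    define G where "G z = g (sqrt z) * cis (T * scaled_phase m \<phi> lam z)" for z
    have I_eq: "I t lam s = integral {1/4..4} (\<lambda>z. G z * cis (- (T * s * z)))" for s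
      by (simp add: I_def G_def T_def)
    have TP: "t * lam powr (2 * m - 2) = T / lam\<^sup>2"
      using lam0 by (simp add: T_def powr_diff powr_numeral)
    have phase: "T * scaled_phase m \<phi> lam (x / lam\<^sup>2) = t * \<phi> x" for x
      using lam0 by (simp add: T_def scaled_phase_def powr_minus)
    have sq: "sqrt x / lam = sqrt (x / lam\<^sup>2)" for x
      using lam0 by (simp add: real_sqrt_divide)
    have Osc_eq: "Osc t x lam = \<eta> (x / lam\<^sup>2) / (2 * pi) * freq_cutoff \<theta> (1/4) 4 T G (x / lam\<^sup>2)" for x
    proof -
      have "(LINT s|lborel. exp (\<i> * complex_of_real (x * t * lam powr (2 * m - 2) * s)) * a t s lam)
        = (LINT s|lborel. of_real (W t lam / (2 * pi)) * (\<theta> s * integral {1/4..4} (\<lambda>z. G z * cis (- (T * s * z))) * cis (T * s * (x / lam\<^sup>2))))"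
      proof (rule Bochner_Integration.integral_cong[OF refl])
        fix s
        have "x * t * lam powr (2 * m - 2) * s = T * s * (x / lam\<^sup>2)"
          using TP by (metis (no_types, opaque_lifting) mult.assoc mult.commute times_divide_eq_right)
        then show "exp (\<i> * complex_of_real (x * t * lam powr (2 * m - 2) * s)) * a t s lam
          = of_real (W t lam / (2 * pi)) * (\<theta> s * integral {1/4..4} (\<lambda>z. G z * cis (- (T * s * z))) * cis (T * s * (x / lam\<^sup>2)))"
          by (simp add: a_def I_eq cis_conv_exp)
      qed
      also have "\<dots> = of_real (W t lam / (2 * pi)) * (LINT s|lborel. \<theta> s * integral {1/4..4} (\<lambda>z. G z * cis (- (T * s * z))) * cis (T * s * (x / lam\<^sup>2)))"
        by (rule integral_mult_right_zero)
      finally have "Osc t x lam = of_real (A t lam) * \<eta> (x / lam\<^sup>2) * (of_real (W t lam / (2 * pi))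
          * (LINT s|lborel. \<theta> s * integral {1/4..4} (\<lambda>z. G z * cis (- (T * s * z))) * cis (T * s * (x / lam\<^sup>2))))"
        by (simp only: Osc_def)
      also have "\<dots> = \<eta> (x / lam\<^sup>2) / (2 * pi) * (of_real (A t lam * W t lam)
          * (LINT s|lborel. \<theta> s * integral {1/4..4} (\<lambda>z. G z * cis (- (T * s * z))) * cis (T * s * (x / lam\<^sup>2))))"
        by simp
      also have "A t lam * W t lam = T" using W(1)[OF t lam] by (simp add: T_def)
      finally show ?thesis by (simp only: freq_cutoff_def)
    qed
    have \<rho>_eq: "\<rho> t x lam = \<eta> (x / lam\<^sup>2) / (2 * pi) * (2 * pi * G (x / lam\<^sup>2) - freq_cutoff \<theta> (1/4) 4 T G (x / lam\<^sup>2))" for x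
    proof -
      have "g (sqrt x / lam) * exp (\<i> * complex_of_real (t * \<phi> x)) = G (x / lam\<^sup>2)"
        by (simp add: G_def sq phase cis_conv_exp)
      \<comment> \<open>As \<eta> is 1 on the support of g (sqrt z), it factors out of the exact
        term too, which confines \<rho> to the support of \<eta>.\<close>
      moreover have "G (x / lam\<^sup>2) = \<eta> (x / lam\<^sup>2) * G (x / lam\<^sup>2)"
        using \<eta>(2)[of "x / lam\<^sup>2"] supp_sqrt[OF g(2), of "x / lam\<^sup>2"] by (cases "x / lam\<^sup>2 \<in> {1/4..4}") (simp_all add: G_def)
      ultimately show ?thesis unfolding \<rho>_def Osc_eq by (simp add: field_simps)
    qed
    have \<rho>0: "\<rho> t x lam = 0" if "x / lam\<^sup>2 \<notin> {1/5..5}" for x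
      unfolding \<rho>_eq using supp_zero[OF \<eta>(1) that] by simp
    have "{x. \<rho> t x lam \<noteq> 0} \<subseteq> {lam\<^sup>2 / 5..5 * lam\<^sup>2}"
    proof
      fix x assume "x \<in> {x. \<rho> t x lam \<noteq> 0}"
      then have "x / lam\<^sup>2 \<in> {1/5..5}" using \<rho>0 by blast
      then show "x \<in> {lam\<^sup>2 / 5..5 * lam\<^sup>2}" using lam0 by (simp add: field_simps)
    qed
    then show "supp (\<lambda>x. \<rho> t x lam) \<subseteq> {lam\<^sup>2 / 5..5 * lam\<^sup>2}"
      unfolding supp_def by (rule closure_minimal) auto
    show "norm (\<rho> t x lam) \<le> H * B k * (t * lam powr (2 * m)) powi (- int k)" for k x
    proof -
      have pw: "(t * lam powr (2 * m)) powi (- int k) = 1 / T ^ k"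
        by (simp add: T_def power_int_minus inverse_eq_divide)
      show ?thesis
      proof (cases "x / lam\<^sup>2 \<in> {1/5..5}")
        case True
        have "norm (\<rho> t x lam) = norm (\<eta> (x / lam\<^sup>2)) / (2 * pi) * norm (2 * pi * G (x / lam\<^sup>2) - freq_cutoff \<theta> (1/4) 4 T G (x / lam\<^sup>2))"
          unfolding \<rho>_eq by (simp add: norm_mult norm_divide)
        also have "\<dots> \<le> H * (B k / T ^ k)"
        proof (intro mult_mono)
          have "norm (\<eta> (x / lam\<^sup>2)) / (2 * pi) \<le> norm (\<eta> (x / lam\<^sup>2)) / 1"
            using pi_ge_two by (intro divide_left_mono) auto
          then show "norm (\<eta> (x / lam\<^sup>2)) / (2 * pi) \<le> H" using \<eta>(3)[of "x / lam\<^sup>2"] by simp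
          show "norm (2 * pi * G (x / lam\<^sup>2) - freq_cutoff \<theta> (1/4) 4 T G (x / lam\<^sup>2)) \<le> B k / T ^ k"
            using approx[OF lam T True] unfolding G_def .
        qed (use H in auto)
        finally show ?thesis unfolding pw by simp
      next
        case False
        then show ?thesis unfolding pw using \<rho>0[OF False] H B0[of k] T by simp
      qed
    qed
    have a_supp: "{s. a t s lam \<noteq> 0} \<subseteq> (\<lambda>s. \<sigma> * s) ` {2 / c0..2 * c0}"
    proof
      fix s assume "s \<in> {s. a t s lam \<noteq> 0}"
      then have "\<theta> s \<noteq> 0" by (auto simp: a_def)
      then have "\<sigma> * s \<in> {2 / c0..2 * c0}" using \<theta>(4) by (simp add: \<sigma>_def)
      moreover have "s = \<sigma> * (\<sigma> * s)" using \<sigma>2 by (simp flip: mult.assoc)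
      ultimately show "s \<in> (\<lambda>s. \<sigma> * s) ` {2 / c0..2 * c0}" by blast
    qed
    have "closed ((\<lambda>s. \<sigma> * s) ` {2 / c0..2 * c0})"
      by (intro compact_imp_closed compact_continuous_image continuous_intros) auto
    then show "supp (\<lambda>s. a t s lam) \<subseteq> (\<lambda>s. sgn (nth_deriv 1 \<phi> 1) * s) ` {2 / c0..2 * c0}"
      using closure_minimal[OF a_supp] by (simp add: supp_def \<sigma>_def)
    show "norm (a t s lam) \<le> M * K" for s
    proof -
      have "norm (a t s lam) = norm (\<theta> s) / (2 * pi) * (norm (I t lam s) * W t lam)"
        using W(2)[OF t lam] by (simp add: a_def norm_mult norm_divide)
      also have "\<dots> \<le> M * K"
      proof (intro mult_mono)
        have "norm (\<theta> s) / (2 * pi) \<le> norm (\<theta> s) / 1" using pi_ge_two by (intro divide_left_mono) auto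
        then show "norm (\<theta> s) / (2 * pi) \<le> M" using \<theta>(2)[of s] by simp
        show "norm (I t lam s) * W t lam \<le> K" unfolding I_def by (rule W(3)[OF t lam])
      qed (use M W(2)[OF t lam] in auto)
      finally show ?thesis .
    qed
    show "integrable lborel (\<lambda>s. a t s lam)"
    proof -
      have "continuous_on {1/4..4} (scaled_phase m \<phi> lam)"
        by (rule continuous_on_subset[OF scaled_phase_continuous[OF \<phi> lam0]]) auto
      then have "continuous_on {1/4..4} G" unfolding G_def
        by (intro continuous_intros continuous_on_compose2[OF gc]) auto
      \<comment> \<open>At y = 0 the exponential factor is 1.\<close>
      note freq_cutoff_integrable[OF \<theta>(1) this, of T 0]
      then have "integrable lborel (\<lambda>s. \<theta> s * integral {1/4..4} (\<lambda>z. G z * cis (- (T * s * z))) * cis (T * s * 0))"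
        by simp
      then have "integrable lborel (\<lambda>s. of_real (W t lam / (2 * pi)) * (\<theta> s * I t lam s))"
        unfolding I_eq by simp
      moreover have "of_real (W t lam / (2 * pi)) * (\<theta> s * I t lam s) = a t s lam" for s
        by (simp add: a_def)
      ultimately show ?thesis by (simp only:)
    qed
    show "g (sqrt x / lam) * exp (\<i> * complex_of_real (t * \<phi> x)) =
          \<rho> t x lam + complex_of_real (A t lam) * \<eta> (x / lam\<^sup>2) *
            (LINT s|lborel. exp (\<i> * complex_of_real (x * t * lam powr (2 * m - 2) * s)) * a t s lam)" for x
      unfolding \<rho>_def Osc_def by simp
  qed
qed

section \<open>Bounds on the phase and on the amplitude integrals\<close>

lemma freq_start_range: "freq_start n \<phi> > 0" "(freq_start n \<phi>)\<^sup>2 / 4 \<le> 1"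
  by (auto simp: freq_start_def)

text \<open>The least argument of \<phi> for z >= 1/4 is the square of \<open>freq_start\<close>
  over 4. It is 1/4 when the definition grants nonvanishing on [1/4, 1], and 1 otherwise, where the
  second hypothesis suffices.\<close>

lemma freq_start_nonzero:
  assumes "j \<in> {1..n}" "\<And>r. r \<ge> 1 \<Longrightarrow> nth_deriv j \<phi> r \<noteq> 0" "r \<ge> (freq_start n \<phi>)\<^sup>2 / 4"
  shows "nth_deriv j \<phi> r \<noteq> 0"
proof (cases "\<forall>j\<in>{1..n}. \<forall>r\<in>{1/4..1}. nth_deriv j \<phi> r \<noteq> 0")
  case True
  then have "freq_start n \<phi> = 1" by (simp add: freq_start_def)
  then show ?thesis using True assms by (cases "r \<ge> 1") auto
next
  case False
  then have "freq_start n \<phi> = 2" by (simp only: freq_start_def if_False)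
  then show ?thesis using assms by simp
qed

lemma sim_on_bounds:
  assumes "sim_on {1..} (\<lambda>r. \<bar>f r\<bar>) (\<lambda>r. r powr \<beta>)"
  obtains c C where "c > 0" "\<And>r. r \<ge> 1 \<Longrightarrow> c * r powr \<beta> \<le> \<bar>f r\<bar>" "\<And>r. r \<ge> 1 \<Longrightarrow> \<bar>f r\<bar> \<le> C * r powr \<beta>"
proof -
  obtain C where C: "\<And>r. r \<ge> 1 \<Longrightarrow> \<bar>f r\<bar> \<le> C * r powr \<beta>"
    using assms by (auto simp: sim_on_def lesssim_on_def)
  obtain D where D: "D > 0" "\<And>r. r \<ge> 1 \<Longrightarrow> r powr \<beta> \<le> D * \<bar>f r\<bar>"
    using assms by (auto simp: sim_on_def lesssim_on_def)
  have "(1 / D) * r powr \<beta> \<le> \<bar>f r\<bar>" if "r \<ge> 1" for r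
    using D(2)[OF that] D(1) by (simp add: field_simps)
  with C D(1) show ?thesis by (intro that[of "1 / D" C]) auto
qed

lemma smooth_on_continuous_nth_deriv:
  assumes "smooth_on S f"
  shows "continuous_on S (nth_deriv j f)"
  by (rule continuous_on_vector_derivative[OF has_vector_derivative_at_within[OF smooth_on_nth_deriv[OF assms]]])

text \<open>The scaled phases with lam >= L form one family to which
  \<open>cutoff_approximation\<close> applies. The cutoff \<theta> is chosen before \<open>g\<close>
  and \<open>k\<close>, since it determines \<open>a\<close>, and one \<open>a\<close> must serve
  all orders; only \<open>B\<close> varies with \<open>k\<close>.\<close>

lemma oscillatory_approximation:
  fixes \<phi> :: "real \<Rightarrow> real" and \<eta> :: "real \<Rightarrow> complex"
  assumes \<phi>: "smooth_on {0<..} \<phi>"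
    and sim: "sim_on {1..} (\<lambda>r. \<bar>nth_deriv 1 \<phi> r\<bar>) (\<lambda>r. r powr (m - 1))"
    and higher: "\<And>j. j \<ge> 2 \<Longrightarrow> lesssim_on {1..} (\<lambda>r. \<bar>nth_deriv j \<phi> r\<bar>) (\<lambda>r. r powr (m - real j))"
    and \<eta>: "smooth_on UNIV \<eta>" "supp \<eta> \<subseteq> {1/5..5}" "\<And>x. x \<in> {1/4..4} \<Longrightarrow> \<eta> x = 1"
    and L: "L > 0" "L\<^sup>2 / 4 \<le> 1" "\<And>r. r \<in> {L\<^sup>2/4..1} \<Longrightarrow> nth_deriv 1 \<phi> r \<noteq> 0"
  obtains \<theta> \<alpha> \<beta> c0 B where "test_function \<alpha> \<beta> \<theta>" "c0 > 1"
    "\<And>s. \<theta> s \<noteq> 0 \<Longrightarrow> sgn (nth_deriv 1 \<phi> 1) * s \<in> {2 / c0..2 * c0}"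
    "\<bar>sgn (nth_deriv 1 \<phi> 1)\<bar> = 1"
    "\<And>g k lam T y. smooth_on UNIV g \<Longrightarrow> supp g \<subseteq> {1/2..2} \<Longrightarrow> lam \<ge> L \<Longrightarrow> T > 0 \<Longrightarrow> y \<in> {1/5..5} \<Longrightarrow>
      norm (2 * pi * (g (sqrt y) * cis (T * scaled_phase m \<phi> lam y))
        - freq_cutoff \<theta> (1/4) 4 T (\<lambda>z. g (sqrt z) * cis (T * scaled_phase m \<phi> lam z)) y)
      \<le> B k * (1 + Ck_norm k g) / T ^ k"
proof -
  let ?f = "nth_deriv 1 \<phi>"
  have cont: "continuous_on {0<..} (nth_deriv j \<phi>)" for j by (rule smooth_on_continuous_nth_deriv[OF \<phi>])
  obtain c C where c: "c > 0" "\<And>r. r \<ge> 1 \<Longrightarrow> c * r powr (m - 1) \<le> \<bar>?f r\<bar>" "\<And>r. r \<ge> 1 \<Longrightarrow> \<bar>?f r\<bar> \<le> C * r powr (m - 1)"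
    by (rule sim_on_bounds[OF sim]) (rule that)
  obtain r1 c' where r1: "0 < r1" "r1 < L\<^sup>2 / 4" "c' > 0" "\<And>r. r \<ge> r1 \<Longrightarrow> c' * r powr (m - 1) \<le> \<bar>?f r\<bar>"
    by (rule lower_bound_extends[OF cont c(1,2) _ L(2,3)]) (use L(1) in auto)
  \<comment> \<open>For lam >= L and z >= q the argument lam^2 z is at least \<open>r1\<close>, so
    the extended bounds apply throughout.\<close>
  define q where "q = r1 / L\<^sup>2"
  have q: "0 < q" "q < 1/4" "L\<^sup>2 * q = r1" using r1 L(1) by (auto simp: q_def field_simps)
  have upper: "\<exists>C\<ge>0. \<forall>r\<ge>L\<^sup>2 * q. \<bar>nth_deriv j \<phi> r\<bar> \<le> C * r powr (m - real j)" if "j \<ge> 1" for j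
  proof -
    obtain D where D: "\<And>r. r \<ge> 1 \<Longrightarrow> \<bar>nth_deriv j \<phi> r\<bar> \<le> D * r powr (m - real j)"
    proof (cases "j = 1")
      case True
      then show ?thesis using c(3) that by auto
    next
      case False
      then show ?thesis using higher[of j] \<open>j \<ge> 1\<close> that by (auto simp: lesssim_on_def)
    qed
    show ?thesis unfolding q(3)
    proof (rule upper_bound_extends[OF cont _ r1(1)])
      show "\<bar>nth_deriv j \<phi> r\<bar> \<le> D * r powr (m - real j)" if "r \<ge> 1" for r by (rule D[OF that])
    qed (auto intro: less_imp_le)
  qed
  obtain D where D: "D \<ge> 0" "\<And>r. r \<ge> L\<^sup>2 * q \<Longrightarrow> \<bar>?f r\<bar> \<le> D * r powr (m - real 1)"
    using upper[of 1] by auto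
  define c1 where "c1 = c' * min (q powr (m - 1)) (5 powr (m - 1))"
  define c2 where "c2 = D * (q powr (m - 1) + 5 powr (m - 1))"
  have c1: "c1 > 0" using r1 q by (simp add: c1_def)
  define \<sigma> where "\<sigma> = sgn (?f 1)"
  have nz: "?f r \<noteq> 0" if "r \<ge> r1" for r
  proof -
    have "0 < c' * r powr (m - 1)" using r1 that by simp
    then show ?thesis using r1(4)[OF that] by linarith
  qed
  have r11: "r1 \<le> 1" using r1 L by linarith
  have \<sigma>: "\<bar>\<sigma>\<bar> = 1" using nz[OF r11] by (simp add: \<sigma>_def abs_sgn_eq)
  have range: "\<sigma> * scaled_phase_deriv m \<phi> 1 lam z \<in> {c1..c2}" if "lam \<in> {L..}" "z \<in> {q<..<5}" for lam z
  proof -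
    have lz: "L\<^sup>2 * q \<le> lam\<^sup>2 * z" using that L q by (intro mult_mono power_mono) auto
    have "sgn (?f (lam\<^sup>2 * z)) = \<sigma>" unfolding \<sigma>_def
    proof (rule sgn_eq_of_nonzero[where f="?f" and ?r1.0=r1])
      show "continuous_on {r1..} ?f" by (rule continuous_on_subset[OF cont]) (use r1 in auto)
    qed (use nz lz q r11 in auto)
    then have "\<sigma> * ?f (lam\<^sup>2 * z) = \<bar>?f (lam\<^sup>2 * z)\<bar>" by (simp add: abs_sgn mult.commute)
    then have "\<sigma> * scaled_phase_deriv m \<phi> 1 lam z = \<bar>scaled_phase_deriv m \<phi> 1 lam z\<bar>"
      by (simp add: scaled_phase_deriv_def abs_mult mult.left_commute)
    moreover have "\<bar>scaled_phase_deriv m \<phi> 1 lam z\<bar> \<le> c2"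
      using scaled_phase_deriv_bounds(1)[of L lam q z 5 1 \<phi> D m] that L(1) q(1) D by (simp add: c2_def)
    moreover have "c1 \<le> \<bar>scaled_phase_deriv m \<phi> 1 lam z\<bar>"
      using scaled_phase_deriv_bounds(2)[of L lam q z 5 c' m 1 \<phi>] that L(1) q r1(3,4) by (simp add: c1_def)
    ultimately show ?thesis by simp
  qed
  have c12: "c1 \<le> c2" using range[of L 1] q by auto
  \<comment> \<open>Two equally spaced points between \<open>q\<close> and 1/4; on the right 17/4
    and 9/2 between 4 and 5 play the same part.\<close>
  define l' l where "l' = (2 * q + 1/4) / 3" and "l = (q + 1/2) / 3"
  have l: "q < l'" "l' < l" "l < 1/4" using q by (auto simp: l'_def l_def)
  obtain \<Theta> where \<Theta>: "test_function l (17/4) \<Theta>" "\<And>s. s \<in> {1/4..4} \<Longrightarrow> \<Theta> s = 1"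
    by (rule smooth_cutoff_exists[OF \<eta>, of l "1/4" 4 "17/4"]) (use l in auto)
  obtain \<theta> \<alpha> \<beta> where \<theta>: "test_function \<alpha> \<beta> \<theta>" "\<And>s. \<sigma> * s \<in> {c1/2..2*c2} \<Longrightarrow> \<theta> s = 1"
    "\<And>s. \<theta> s \<noteq> 0 \<Longrightarrow> \<sigma> * s \<in> {c1/4..4*c2}"
  \<comment> \<open>For \<sigma> = -1 the cutoff is built on the mirrored intervals.\<close>
  proof (cases "\<sigma> = 1")
    case True
    obtain \<theta> where \<theta>: "test_function (c1/4) (4*c2) \<theta>" "\<And>s. s \<in> {c1/2..2*c2} \<Longrightarrow> \<theta> s = 1"
      by (rule smooth_cutoff_exists[OF \<eta>, of "c1/4" "c1/2" "2*c2" "4*c2"]) (use c1 c12 in auto)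
    show ?thesis by (rule that[OF \<theta>(1)]) (use True \<theta> in \<open>auto simp: test_function_def\<close>)
  next
    case False
    then have m1: "\<sigma> = -1" using \<sigma> by (auto simp: abs_if split: if_splits)
    obtain \<theta> where \<theta>: "test_function (-4*c2) (-c1/4) \<theta>" "\<And>s. s \<in> {-2*c2..-c1/2} \<Longrightarrow> \<theta> s = 1"
      by (rule smooth_cutoff_exists[OF \<eta>, of "-4*c2" "-2*c2" "-c1/2" "-c1/4"]) (use c1 c12 in auto)
    have "\<sigma> * s \<in> {c1/4..4*c2}" if "\<theta> s \<noteq> 0" for s
    proof -
      have "s \<in> {-4*c2..-c1/4}" using \<theta>(1) that by (auto simp: test_function_def)
      then show ?thesis using m1 by auto
    qed
    moreover have "\<theta> s = 1" if "\<sigma> * s \<in> {c1/2..2*c2}" for s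
      by (rule \<theta>(2)) (use that m1 in auto)
    ultimately show ?thesis using that[OF \<theta>(1)] by blast
  qed
  \<comment> \<open>Chosen so that [2 / c0, 2 c0] contains [c1/4, 4 c2], where \<sigma> s lies if
    \<theta> s is nonzero.\<close>
  define c0 where "c0 = max 2 (max (8 / c1) (2 * c2))"
  have c0: "c0 > 1" "8 / c1 \<le> c0" "2 * c2 \<le> c0" by (auto simp: c0_def)
  have "8 \<le> c0 * c1" using c0(2) c1 by (simp add: pos_divide_le_eq)
  then have "2 / c0 \<le> c1 / 4" using c0(1) by (simp add: pos_divide_le_eq mult.commute)
  then have supp_\<theta>: "\<sigma> * s \<in> {2 / c0..2 * c0}" if "\<theta> s \<noteq> 0" for s
    using \<theta>(3)[OF that] c0(3) by auto
  define Q where "Q k C \<longleftrightarrow> (\<forall>g. smooth_on UNIV g \<and> supp g \<subseteq> {1/2..2} \<longrightarrow> (\<forall>lam\<in>{L..}. \<forall>T>0. \<forall>y\<in>{1/5..5}.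
      norm (2 * pi * (g (sqrt y) * cis (T * scaled_phase m \<phi> lam y))
        - freq_cutoff \<theta> l' (9/2) T (\<lambda>z. g (sqrt z) * cis (T * scaled_phase m \<phi> lam z)) y) \<le> C * (1 + Ck_norm k g) / T ^ k))" for k C
  have "\<exists>C\<ge>0. Q k C" for k unfolding Q_def
  proof (rule cutoff_approximation[where \<Phi>'="scaled_phase_deriv m \<phi> 1" and q=q and Q=5 and l=l and u="17/4"
        and \<sigma>=\<sigma> and ?c1.0=c1 and ?c2.0=c2 and \<Theta>=\<Theta> and \<alpha>=\<alpha> and \<beta>=\<beta>])
    show "(scaled_phase m \<phi> lam has_real_derivative scaled_phase_deriv m \<phi> 1 lam z) (at z)"
      if "lam \<in> {L..}" "z \<in> {q<..<5}" for lam z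
      using scaled_phase_deriv_has_derivative[OF \<phi>, of lam z m 0] that L(1) q(1) by (simp add: scaled_phase_eq)
    show "unif_smooth n {q<..<5} {L..} (\<lambda>lam z. complex_of_real (scaled_phase_deriv m \<phi> 1 lam z))" for n
      by (rule unif_smooth_scaled_phase_deriv[OF \<phi> L(1) q(1) upper])
  qed (use q l range c1 \<sigma> \<theta>(1,2) \<Theta> in auto)
  then have "\<forall>k. \<exists>C. Q k C" by blast
  from choice[OF this] obtain B where B: "\<And>k. Q k (B k)" by blast
  show ?thesis
  proof (rule that[OF \<theta>(1) c0(1)])
    fix g :: "real \<Rightarrow> complex" and k lam T y assume a: "smooth_on UNIV g" "supp g \<subseteq> {1/2..2}" "lam \<ge> L" "T > (0::real)" "y \<in> {1/5..5::real}"
    \<comment> \<open>\<open>cutoff_approximation\<close> integrates over a padded interval, but g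
      (sqrt z) vanishes off [1/4, 4].\<close>
    have eq: "freq_cutoff \<theta> (1/4) 4 T (\<lambda>z. g (sqrt z) * cis (T * scaled_phase m \<phi> lam z)) y
        = freq_cutoff \<theta> l' (9/2) T (\<lambda>z. g (sqrt z) * cis (T * scaled_phase m \<phi> lam z)) y"
      by (rule freq_cutoff_support_subset[symmetric]) (use supp_sqrt[OF a(2)] l in auto)
    have "lam \<in> {L..}" using a(3) by simp
    from B[of k, unfolded Q_def, rule_format, OF conjI[OF a(1,2)] this a(4,5)]
    show "norm (2 * pi * (g (sqrt y) * cis (T * scaled_phase m \<phi> lam y))
        - freq_cutoff \<theta> (1/4) 4 T (\<lambda>z. g (sqrt z) * cis (T * scaled_phase m \<phi> lam z)) y)
      \<le> B k * (1 + Ck_norm k g) / T ^ k"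
      unfolding eq .
  qed (use supp_\<theta> \<sigma> in \<open>auto simp: \<sigma>_def\<close>)
qed

lemma amplitude_integral_bound:
  assumes \<phi>: "smooth_on {0<..} \<phi>" "lam > 0" and g: "smooth_on UNIV g" "supp g \<subseteq> {1/2..2}"
  shows "norm (integral {1/4..4} (\<lambda>z. g (sqrt z) * cis (T * scaled_phase m \<phi> lam z) * cis (- (T * s * z))))
    \<le> 4 * (1 + Ck_norm 1 g)"
proof -
  have N: "norm (g x) \<le> Ck_norm 1 g" for x using norm_nth_deriv_le_Ck_norm[OF g, of 0 1] by simp
  have "continuous_on {1/4..4} (scaled_phase m \<phi> lam)"
    by (rule continuous_on_subset[OF scaled_phase_continuous[OF \<phi>]]) auto
  then have "norm (integral {1/4..4} (\<lambda>z. g (sqrt z) * cis (T * scaled_phase m \<phi> lam z) * cis (- (T * s * z))))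
    \<le> Ck_norm 1 g * (4 - 1/4)"
    by (intro integral_bound continuous_intros continuous_on_compose2[OF smooth_on_UNIV_continuous[OF g(1)]])
      (auto simp: norm_mult N[unfolded One_nat_def])
  also have "\<dots> \<le> 4 * (1 + Ck_norm 1 g)" using order_trans[OF norm_ge_zero N[of 0]] by simp
  finally show ?thesis .
qed

text \<open>The linear term s z has no second derivative, and \<open>m\<close> cancels: the second
  derivative of the phase is t lam^4 \<phi>''(lam^2 z), at least of size t lam^(2 \<alpha>). Its
  inverse square root is the gain, uniformly in \<open>s\<close>.\<close>

lemma amplitude_integral_van_der_Corput:
  fixes \<phi> :: "real \<Rightarrow> real"
  assumes \<phi>: "smooth_on {0<..} \<phi>" and L: "L > 0" "L\<^sup>2 / 4 \<le> 1"
    and sim: "sim_on {1..} (\<lambda>r. \<bar>nth_deriv 2 \<phi> r\<bar>) (\<lambda>r. r powr (\<alpha> - 2))"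
    and nz: "\<And>r. r \<in> {L\<^sup>2/4..1} \<Longrightarrow> nth_deriv 2 \<phi> r \<noteq> 0"
  shows "\<exists>K\<ge>0. \<forall>g. smooth_on UNIV g \<and> supp g \<subseteq> {1/2..2} \<longrightarrow> (\<forall>t>0. \<forall>lam\<ge>L. \<forall>s.
    norm (integral {1/4..4} (\<lambda>z. g (sqrt z) * cis (t * lam powr (2 * m) * scaled_phase m \<phi> lam z)
      * cis (- (t * lam powr (2 * m) * s * z)))) * (t powr (1/2) * lam powr \<alpha>) \<le> K * Ck_norm 1 g)"
proof -
  let ?f = "nth_deriv 2 \<phi>"
  have cont: "continuous_on {0<..} ?f" by (rule smooth_on_continuous_nth_deriv[OF \<phi>])
  obtain c C where c: "c > 0" "\<And>r. r \<ge> 1 \<Longrightarrow> c * r powr (\<alpha> - 2) \<le> \<bar>?f r\<bar>" "\<And>r. r \<ge> 1 \<Longrightarrow> \<bar>?f r\<bar> \<le> C * r powr (\<alpha> - 2)"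
    by (rule sim_on_bounds[OF sim]) (rule that)
  obtain r1 c' where r1: "0 < r1" "r1 < L\<^sup>2 / 4" "c' > 0" "\<And>r. r \<ge> r1 \<Longrightarrow> c' * r powr (\<alpha> - 2) \<le> \<bar>?f r\<bar>"
    by (rule lower_bound_extends[OF cont c(1,2) _ L(2) nz]) (use L(1) in auto)
  have nz': "?f r \<noteq> 0" if "r \<ge> r1" for r
  proof -
    have "0 < c' * r powr (\<alpha> - 2)" using r1 that by simp
    then show ?thesis using r1(4)[OF that] by linarith
  qed
  have r11: "r1 \<le> 1" using r1 L by linarith
  define \<epsilon> where "\<epsilon> = sgn (?f 1)"
  have \<epsilon>: "\<bar>\<epsilon>\<bar> = 1" using nz'[OF r11] by (simp add: \<epsilon>_def abs_sgn_eq)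
  define d where "d = c' * min ((1/4) powr (\<alpha> - 2)) (4 powr (\<alpha> - 2))"
  have d: "d > 0" using r1 by (simp add: d_def)
  have "norm (integral {1/4..4} (\<lambda>z. g (sqrt z) * cis (t * lam powr (2 * m) * scaled_phase m \<phi> lam z)
      * cis (- (t * lam powr (2 * m) * s * z)))) * (t powr (1/2) * lam powr \<alpha>) \<le> (2 * pi + 15/4) / sqrt d * Ck_norm 1 g"
    if g: "smooth_on UNIV g" "supp g \<subseteq> {1/2..2}" and t: "t > 0" and lam: "lam \<ge> L" for g t lam s
  proof -
    have lam0: "lam > 0" using lam L by simp
    define T where "T = t * lam powr (2 * m)"
    have T: "T > 0" using t lam0 by (simp add: T_def)
    define N where "N = Ck_norm 1 g"
    have N: "norm (g x) \<le> N" "norm (nth_deriv 1 g x) \<le> N" for x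
      using norm_nth_deriv_le_Ck_norm[OF g, of 0 1] norm_nth_deriv_le_Ck_norm[OF g, of 1 1] by (simp_all add: N_def)
    define \<psi> where "\<psi> z = T * scaled_phase_deriv m \<phi> 0 lam z - T * s * z" for z
    define \<psi>1 where "\<psi>1 z = T * scaled_phase_deriv m \<phi> 1 lam z - T * s" for z
    define \<psi>2 where "\<psi>2 z = T * scaled_phase_deriv m \<phi> 2 lam z" for z
    \<comment> \<open>The square of \<open>w\<close> is the size of the second derivative of the
      phase, so \<open>w\<close> compensates the decay from \<open>van_der_Corput\<close>.\<close>
    define w where "w = t powr (1/2) * lam powr \<alpha>"
    have w: "w > 0" using t lam0 by (simp add: w_def)
    have w2: "w\<^sup>2 = t * lam powr (2 * \<alpha>)"
      using t lam0 by (simp add: w_def power2_eq_square powr_add[symmetric] mult_ac flip: powr_add)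
    \<comment> \<open>The length 4 - 1/4 gives the 15/4 of the constant; the chain rule factor 1 /
      (2 sqrt z) is at most 1 on [1/4, 4].\<close>
    have "norm (integral {1/4..4} (\<lambda>z. g (sqrt z) * cis (\<psi> z))) \<le> (2 * pi * N + (4 - 1/4) * N) / sqrt (d * w\<^sup>2)"
    proof (rule van_der_Corput[where ?\<psi>1.0=\<psi>1 and ?\<psi>2.0=\<psi>2 and \<epsilon>=\<epsilon> and b'="\<lambda>z. (inverse (sqrt z) / 2) *\<^sub>R nth_deriv 1 g (sqrt z)"])
      fix z :: real assume z: "z \<in> {1/4..4}"
      then have z0: "z > 0" by simp
      note D = scaled_phase_deriv_has_derivative[OF \<phi> lam0 z0, of m]
      show "(\<psi> has_real_derivative \<psi>1 z) (at z)"
        unfolding \<psi>_def \<psi>1_def using DERIV_diff[OF DERIV_cmult[OF D[of 0], of T] DERIV_cmult[OF DERIV_ident, of "T * s"]] by simp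
      show "(\<psi>1 has_real_derivative \<psi>2 z) (at z)"
        unfolding \<psi>1_def \<psi>2_def using DERIV_diff[OF DERIV_cmult[OF D[of 1], of T] DERIV_const[of "T * s"]]
        by (simp add: numeral_2_eq_2)
      have "L\<^sup>2 \<le> lam\<^sup>2" using lam L by (intro power_mono) auto
      then have lz: "L\<^sup>2 * (1/4) \<le> lam\<^sup>2 * z" using z by (intro mult_mono) auto
      have "sgn (?f (lam\<^sup>2 * z)) = \<epsilon>" unfolding \<epsilon>_def
      proof (rule sgn_eq_of_nonzero[where f="?f" and ?r1.0=r1])
        show "continuous_on {r1..} ?f" by (rule continuous_on_subset[OF cont]) (use r1 in auto)
      qed (use nz' lz r1(2) r11 in auto)
      then have "\<epsilon> * ?f (lam\<^sup>2 * z) = \<bar>?f (lam\<^sup>2 * z)\<bar>" by (simp add: abs_sgn mult.commute)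
      then have "\<epsilon> * \<psi>2 z = T * lam powr (4 - 2 * m) * \<bar>?f (lam\<^sup>2 * z)\<bar>"
        by (simp add: \<psi>2_def scaled_phase_deriv_def mult.left_commute)
      \<comment> \<open>Trading \<open>m\<close> for \<alpha> produces
        \<open>scaled_phase_deriv\<close> with exponent \<alpha>, whose lower bound does not involve
        \<open>lam\<close>.\<close>
      also have "T * lam powr (4 - 2 * m) = w\<^sup>2 * lam powr (4 - 2 * \<alpha>)"
        unfolding w2 T_def using lam0 by (simp add: mult.assoc flip: powr_add)
      also have "w\<^sup>2 * lam powr (4 - 2 * \<alpha>) * \<bar>?f (lam\<^sup>2 * z)\<bar> = w\<^sup>2 * \<bar>scaled_phase_deriv \<alpha> \<phi> 2 lam z\<bar>"
        by (simp add: scaled_phase_deriv_def abs_mult)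
      also have "\<dots> \<ge> w\<^sup>2 * d"
        using scaled_phase_deriv_bounds(2)[OF lam L(1) _ z, of c' \<alpha> 2 \<phi>] r1
        by (intro mult_left_mono) (auto simp: d_def)
      finally show "d * w\<^sup>2 \<le> \<epsilon> * \<psi>2 z" by (simp add: mult.commute)
      have "(sqrt has_vector_derivative inverse (sqrt z) / 2) (at z)"
        using DERIV_real_sqrt[OF z0] by (simp add: has_real_derivative_iff_has_vector_derivative)
      from vector_diff_chain_at[OF this, of g "nth_deriv 1 g (sqrt z)"]
      show "((\<lambda>z. g (sqrt z)) has_vector_derivative (inverse (sqrt z) / 2) *\<^sub>R nth_deriv 1 g (sqrt z)) (at z)"
        using smooth_on_nth_deriv[OF g(1), of "sqrt z" 0] by (simp add: o_def)
      show "norm (g (sqrt z)) \<le> N" by (rule N)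
      have "sqrt (1/4) \<le> sqrt z" using z by (intro real_sqrt_le_mono) auto
      then have "1/2 \<le> sqrt z" by (simp add: real_sqrt_divide)
      then have "inverse (sqrt z) / 2 \<le> 1" using le_imp_inverse_le[of "1/2" "sqrt z"] by simp
      then have "(inverse (sqrt z) / 2) * norm (nth_deriv 1 g (sqrt z)) \<le> 1 * N" using z0 by (intro mult_mono N) auto
      then show "norm ((inverse (sqrt z) / 2) *\<^sub>R nth_deriv 1 g (sqrt z)) \<le> N" using z0 by simp
    next
      have s: "sqrt (1/4) = 1/2" "sqrt 4 = 2" by (simp_all add: real_sqrt_divide)
      show "g (sqrt (1/4)) = 0" "g (sqrt 4) = 0"
        unfolding s by (rule supp_endpoints_zero[OF smooth_on_UNIV_continuous[OF g(1)] g(2)])+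
    qed (use d w \<epsilon> in auto)
    also have "\<dots> = (2 * pi + 15/4) / sqrt d * N / w"
      using w by (simp add: real_sqrt_mult algebra_simps add_divide_distrib)
    finally have "norm (integral {1/4..4} (\<lambda>z. g (sqrt z) * cis (\<psi> z))) * w \<le> (2 * pi + 15/4) / sqrt d * N"
      using w by (simp only: pos_le_divide_eq)
    moreover have "g (sqrt z) * cis (T * scaled_phase m \<phi> lam z) * cis (- (T * s * z)) = g (sqrt z) * cis (\<psi> z)" for z
      by (simp add: \<psi>_def scaled_phase_eq mult.assoc cis_mult)
    ultimately show ?thesis unfolding w_def[symmetric] N_def[symmetric] T_def[symmetric] by (simp only:)
  qed
  moreover have "(2 * pi + 15/4) / sqrt d \<ge> 0" using d by simp
  ultimately show ?thesis by blast
qed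

lemma sim_on_powr_nonzero:
  assumes "sim_on {1..} (\<lambda>r. \<bar>f r\<bar>) (\<lambda>r. r powr \<beta>)" "r \<ge> 1"
  shows "f r \<noteq> 0"
proof (rule sim_on_bounds[OF assms(1)])
  fix c assume c: "c > 0" "\<And>r. r \<ge> 1 \<Longrightarrow> c * r powr \<beta> \<le> \<bar>f r\<bar>"
  have "0 < c * r powr \<beta>" using c(1) assms(2) by simp
  also have "\<dots> \<le> \<bar>f r\<bar>" by (rule c(2)[OF assms(2)])
  finally show ?thesis by simp
qed

text \<open>Common source of both decompositions, with the weight \<open>W\<close> still free.
  \<open>C\<close> and \<open>C'\<close> are functions of the norms fixed before \<open>g\<close>,
  and \<open>n\<close> fixes the range of \<open>lam\<close>.\<close>

lemma weighted_oscillatory_decomposition: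
  fixes \<phi> :: "real \<Rightarrow> real" and \<eta> :: "real \<Rightarrow> complex"
  assumes \<phi>: "smooth_on {0<..} \<phi>"
    and sim: "sim_on {1..} (\<lambda>r. \<bar>nth_deriv 1 \<phi> r\<bar>) (\<lambda>r. r powr (m - 1))"
    and higher: "\<And>j. j \<ge> 2 \<Longrightarrow> lesssim_on {1..} (\<lambda>r. \<bar>nth_deriv j \<phi> r\<bar>) (\<lambda>r. r powr (m - real j))"
    and \<eta>: "smooth_on UNIV \<eta>" "supp \<eta> \<subseteq> {1/5..5}" "\<And>x. x \<in> {1/4..4} \<Longrightarrow> \<eta> x = 1"
    and n: "n \<ge> 1"
    and W: "\<And>t lam. t > 0 \<Longrightarrow> lam \<ge> freq_start n \<phi> \<Longrightarrow> A t lam * W t lam = t * lam powr (2 * m)"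
      "\<And>t lam. t > 0 \<Longrightarrow> lam \<ge> freq_start n \<phi> \<Longrightarrow> W t lam \<ge> 0"
      "\<And>g t lam s. smooth_on UNIV g \<Longrightarrow> supp g \<subseteq> {1/2..2} \<Longrightarrow> t > 0 \<Longrightarrow> lam \<ge> freq_start n \<phi> \<Longrightarrow>
        norm (integral {1/4..4} (\<lambda>z. g (sqrt z) * cis (t * lam powr (2 * m) * scaled_phase m \<phi> lam z)
          * cis (- (t * lam powr (2 * m) * s * z)))) * W t lam \<le> K * (1 + Ck_norm 1 g)"
  shows "\<exists>(C :: nat \<Rightarrow> real \<Rightarrow> real) (C' :: real \<Rightarrow> real). \<forall>g :: real \<Rightarrow> complex. smooth_on UNIV g \<and> supp g \<subseteq> {1/2..2} \<longrightarrow>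
    oscillatory_decomposition m \<phi> \<eta> A (freq_start n \<phi>) (\<lambda>k. C k (Ck_norm k g)) (C' (Ck_norm 1 g)) g"
proof -
  define L where "L = freq_start n \<phi>"
  have L: "L > 0" "L\<^sup>2 / 4 \<le> 1" unfolding L_def by (rule freq_start_range)+
  have nz: "nth_deriv 1 \<phi> r \<noteq> 0" if "r \<in> {L\<^sup>2/4..1}" for r
    by (rule freq_start_nonzero[of 1 n]) (use n that sim_on_powr_nonzero[OF sim] in \<open>auto simp: L_def\<close>)
  show ?thesis
  proof (rule oscillatory_approximation[OF \<phi> sim higher \<eta> L nz])
    fix \<theta> \<alpha> \<beta> c0 B
    assume \<theta>: "test_function \<alpha> \<beta> \<theta>" "c0 > 1"
        "\<And>s. \<theta> s \<noteq> 0 \<Longrightarrow> sgn (nth_deriv 1 \<phi> 1) * s \<in> {2 / c0..2 * c0}" "\<bar>sgn (nth_deriv 1 \<phi> 1)\<bar> = 1"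
      and B: "\<And>g k lam T y. smooth_on UNIV g \<Longrightarrow> supp g \<subseteq> {1/2..2} \<Longrightarrow> lam \<ge> L \<Longrightarrow> T > 0 \<Longrightarrow> y \<in> {1/5..5} \<Longrightarrow>
        norm (2 * pi * (g (sqrt y) * cis (T * scaled_phase m \<phi> lam y))
          - freq_cutoff \<theta> (1/4) 4 T (\<lambda>z. g (sqrt z) * cis (T * scaled_phase m \<phi> lam z)) y)
        \<le> B k * (1 + Ck_norm k g) / T ^ k"
    obtain M where M: "\<And>s. norm (\<theta> s) \<le> M" using test_function_bounded[OF \<theta>(1)] by metis
    have H: "norm (\<eta> x) \<le> Ck_norm 0 \<eta>" for x using norm_nth_deriv_le_Ck_norm[OF \<eta>(1,2), of 0 0 x] by simp
    show ?thesis
    proof (rule exI[of _ "\<lambda>k X. Ck_norm 0 \<eta> * (B k * (1 + X))"], rule exI[of _ "\<lambda>X. M * (K * (1 + X))"], intro allI impI, elim conjE)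
      fix g :: "real \<Rightarrow> complex" assume g: "smooth_on UNIV g" "supp g \<subseteq> {1/2..2}"
      show "oscillatory_decomposition m \<phi> \<eta> A (freq_start n \<phi>) (\<lambda>k. Ck_norm 0 \<eta> * (B k * (1 + Ck_norm k g)))
          (M * (K * (1 + Ck_norm 1 g))) g"
        by (rule oscillatory_decompositionI[OF g \<eta>(2,3) H \<theta>(1) M \<theta>(2,3,4) freq_start_range(1) \<phi> B[OF g, folded L_def] W(1,2) W(3)[OF g]])
          (simp_all add: L_def)
    qed
  qed
qed

theorem theorem3p1:
  fixes \<phi> :: "real \<Rightarrow> real" and m\<^sub>1 :: real and \<eta> :: "real \<Rightarrow> complex"
  assumes "smooth_on {0<..} \<phi>"
    and "m\<^sub>1 > 0"
    and "sim_on {1..} (\<lambda>r. \<bar>nth_deriv 1 \<phi> r\<bar>) (\<lambda>r. r powr (m\<^sub>1 - 1))"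
    and "\<And>\<alpha>::nat. \<alpha> \<ge> 2 \<Longrightarrow>
           lesssim_on {1..} (\<lambda>r. \<bar>nth_deriv \<alpha> \<phi> r\<bar>) (\<lambda>r. r powr (m\<^sub>1 - real \<alpha>))"
    and "smooth_on UNIV \<eta>"
    and "supp \<eta> \<subseteq> {1/5..5}"
    and "\<And>x. x \<in> {1/4..4} \<Longrightarrow> \<eta> x = 1"
  shows
    "(\<exists>(C :: nat \<Rightarrow> real \<Rightarrow> real) (C' :: real \<Rightarrow> real).
        \<forall>g :: real \<Rightarrow> complex. smooth_on UNIV g \<and> supp g \<subseteq> {1/2..2} \<longrightarrow>
          oscillatory_decomposition m\<^sub>1 \<phi> \<eta> (\<lambda>t lam. t * lam powr (2 * m\<^sub>1)) (freq_start 1 \<phi>)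
            (\<lambda>k. C k (Ck_norm k g)) (C' (Ck_norm 1 g)) g) \<and>
     (\<forall>\<alpha>\<^sub>1 :: real.
        sim_on {1..} (\<lambda>r. \<bar>nth_deriv 2 \<phi> r\<bar>) (\<lambda>r. r powr (\<alpha>\<^sub>1 - 2)) \<longrightarrow>
        (\<exists>(C :: nat \<Rightarrow> real \<Rightarrow> real) (C' :: real \<Rightarrow> real).
          \<forall>g :: real \<Rightarrow> complex. smooth_on UNIV g \<and> supp g \<subseteq> {1/2..2} \<longrightarrow>
            oscillatory_decomposition m\<^sub>1 \<phi> \<eta>
              (\<lambda>t lam. t powr (1/2) * lam powr (2 * m\<^sub>1 - \<alpha>\<^sub>1)) (freq_start 2 \<phi>)
              (\<lambda>k. C k (Ck_norm k g)) (C' (Ck_norm 1 g)) g))"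
proof (intro conjI allI impI)
  note core = weighted_oscillatory_decomposition[OF assms(1,3,4,5,6,7)]
  show "\<exists>(C :: nat \<Rightarrow> real \<Rightarrow> real) (C' :: real \<Rightarrow> real).
        \<forall>g :: real \<Rightarrow> complex. smooth_on UNIV g \<and> supp g \<subseteq> {1/2..2} \<longrightarrow>
          oscillatory_decomposition m\<^sub>1 \<phi> \<eta> (\<lambda>t lam. t * lam powr (2 * m\<^sub>1)) (freq_start 1 \<phi>)
            (\<lambda>k. C k (Ck_norm k g)) (C' (Ck_norm 1 g)) g"
  \<comment> \<open>Without a lower bound on \<phi>'' there is no decay to exploit: the amplitude
    integral is bounded by length times supremum, and T stays in front.\<close>
  proof (rule core[where W="\<lambda>t lam. 1" and K=4])
    fix g :: "real \<Rightarrow> complex" and t lam s :: real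
    assume g: "smooth_on UNIV g" "supp g \<subseteq> {1/2..2}" and "t > 0" and lam: "lam \<ge> freq_start 1 \<phi>"
    have "lam > 0" using lam freq_start_range(1)[of 1 \<phi>] by linarith
    from amplitude_integral_bound[OF assms(1) this g]
    show "norm (integral {1/4..4} (\<lambda>z. g (sqrt z) * cis (t * lam powr (2 * m\<^sub>1) * scaled_phase m\<^sub>1 \<phi> lam z)
        * cis (- (t * lam powr (2 * m\<^sub>1) * s * z)))) * 1 \<le> 4 * (1 + Ck_norm 1 g)"
      unfolding mult_1_right .
  qed simp_all
next
  fix \<alpha>\<^sub>1 :: real
  assume sim: "sim_on {1..} (\<lambda>r. \<bar>nth_deriv 2 \<phi> r\<bar>) (\<lambda>r. r powr (\<alpha>\<^sub>1 - 2))"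
  note core = weighted_oscillatory_decomposition[OF assms(1,3,4,5,6,7)]
  define L where "L = freq_start 2 \<phi>"
  have L: "L > 0" "L\<^sup>2 / 4 \<le> 1" unfolding L_def by (rule freq_start_range)+
  have nz: "nth_deriv 2 \<phi> r \<noteq> 0" if "r \<in> {L\<^sup>2/4..1}" for r
    by (rule freq_start_nonzero[of 2 2]) (use that sim_on_powr_nonzero[OF sim] in \<open>auto simp: L_def\<close>)
  obtain K where K: "K \<ge> 0" "\<And>(g :: real \<Rightarrow> complex) t lam s. smooth_on UNIV g \<Longrightarrow> supp g \<subseteq> {1/2..2} \<Longrightarrow> t > 0 \<Longrightarrow> lam \<ge> L \<Longrightarrow>
      norm (integral {1/4..4} (\<lambda>z. g (sqrt z) * cis (t * lam powr (2 * m\<^sub>1) * scaled_phase m\<^sub>1 \<phi> lam z)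
      * cis (- (t * lam powr (2 * m\<^sub>1) * s * z)))) * (t powr (1/2) * lam powr \<alpha>\<^sub>1) \<le> K * Ck_norm 1 g"
    using amplitude_integral_van_der_Corput[OF assms(1) L sim nz, of m\<^sub>1] by blast
  show "\<exists>(C :: nat \<Rightarrow> real \<Rightarrow> real) (C' :: real \<Rightarrow> real).
          \<forall>g :: real \<Rightarrow> complex. smooth_on UNIV g \<and> supp g \<subseteq> {1/2..2} \<longrightarrow>
            oscillatory_decomposition m\<^sub>1 \<phi> \<eta>
              (\<lambda>t lam. t powr (1/2) * lam powr (2 * m\<^sub>1 - \<alpha>\<^sub>1)) (freq_start 2 \<phi>)
              (\<lambda>k. C k (Ck_norm k g)) (C' (Ck_norm 1 g)) g"
  \<comment> \<open>The weight is the reciprocal of the decay given by van der Corput, and its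
    product with the prefactor is again T.\<close>
  proof (rule core[where W="\<lambda>t lam. t powr (1/2) * lam powr \<alpha>\<^sub>1" and K=K])
    fix t lam :: real assume "t > 0" and lam: "lam \<ge> freq_start 2 \<phi>"
    have "t powr (1/2) * lam powr (2 * m\<^sub>1 - \<alpha>\<^sub>1) * (t powr (1/2) * lam powr \<alpha>\<^sub>1)
        = (t powr (1/2) * t powr (1/2)) * (lam powr (2 * m\<^sub>1 - \<alpha>\<^sub>1) * lam powr \<alpha>\<^sub>1)"
      by (simp only: mult_ac)
    also have "\<dots> = t * lam powr (2 * m\<^sub>1)" using \<open>t > 0\<close> by (simp flip: powr_add)
    finally show "t powr (1/2) * lam powr (2 * m\<^sub>1 - \<alpha>\<^sub>1) * (t powr (1/2) * lam powr \<alpha>\<^sub>1) = t * lam powr (2 * m\<^sub>1)" .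
  next
    fix g :: "real \<Rightarrow> complex" and t lam s :: real
    assume g: "smooth_on UNIV g" "supp g \<subseteq> {1/2..2}" and t: "t > 0" and "lam \<ge> freq_start 2 \<phi>"
    then have "lam \<ge> L" by (simp add: L_def)
    note K(2)[OF g t this, of s]
    also have "K * Ck_norm 1 g \<le> K * (1 + Ck_norm 1 g)" using K(1) by (intro mult_left_mono) auto
    finally show "norm (integral {1/4..4} (\<lambda>z. g (sqrt z) * cis (t * lam powr (2 * m\<^sub>1) * scaled_phase m\<^sub>1 \<phi> lam z)
        * cis (- (t * lam powr (2 * m\<^sub>1) * s * z)))) * (t powr (1/2) * lam powr \<alpha>\<^sub>1) \<le> K * (1 + Ck_norm 1 g)" .
  qed simp_all
qed

end
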